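(* Let $d\ge 1$, let $\pi$ be a probability density on $\mathbb{R}^d$, let $f:\mathbb{R}^d\to\mathbb{R}$, and let $\boldsymbol\tau:(0,1)^d\to\mathbb{R}^d$ be a $C^1$ diffeomorphism, with Jacobian matrix $J_{\boldsymbol\tau}(\mathbf u)=(\partial\tau_i/\partial u_j)_{i,j}$. Write $m(u)=\min(u,1-u)$ for $u\in(0,1)$. Assume the following. (A) [Integrand growth] There is a univariate CDF $F:\mathbb{R}\to(0,1)$ such that for all multi-indices $\lambda\in\mathbb{N}_0^d$ with $|\lambda|\le d$ and for arbitrarily small $B>0$ there exists $C_1>0$ such that for all $\mathbf x\in\mathbb{R}^d$, $$|\partial^\lambda f(\mathbf x)|\le C_1\prod_{k=1}^d\bigl[\min(F(x_k),1-F(x_k))\bigr]^{-B}.$$ (B) [Target decay] There exist $C_2>0$ and $\alpha>0$ such that for all multi-indices $\lambda\in\mathbb{N}_0^d$ with $|\lambda|\le d$ and all $\mathbf x\in\mathbb{R}^d$, $$|\partial^\lambda\pi(\mathbf x)|\le C_2\prod_{k=1}^d e^{-\alpha x_k^2}.$$ (C) [Transport growth] With the same $F$ as in (A), put $\rho(x)=\min(F(x),1-F(x))$. (C1) For all $v\subseteq\{1,\dots,d\}$, all $i,j\in\{1,\dots,d\}$ and arbitrarily small $B>0$ there exists $C_3>0$ such that for all $\mathbf u\in(0,1)^d$, $$\bigl|\partial^v(\partial^{\{i\}}\tau_j)(\mathbf u)\bigr|\le C_3\,m(u_i)^{-1}\prod_{k=1}^d m(u_k)^{-B-\mathbf 1_{\{k\in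 v\}}}.$$ (C2) There exist $B_0>0$ and $C_4>0$ such that for all $k\in\{1,\dots,d\}$ and all $\mathbf u\in(0,1)^d$, $\rho(\tau_k(\mathbf u))^{-1}\le C_4\prod_{\ell=1}^d m(u_\ell)^{-B_0}$. (C3) There exist $C_5>1/\alpha$ (with $\alpha$ from (B)) and $C'\in\mathbb{R}$ such that for all $j\in\{1,\dots,d\}$ and all $\mathbf u\in(0,1)^d$, $|\tau_j(\mathbf u)|^2\ge C_5|\ln m(u_j)|-C'$. Then the function $h:(0,1)^d\to\mathbb{R}$, $$h(\mathbf u)=f(\boldsymbol\tau(\mathbf u))\,\pi(\boldsymbol\tau(\mathbf u))\,|\det J_{\boldsymbol\tau}(\mathbf u)|,$$ satisfies the boundary growth condition: for arbitrarily small $B>0$ there exists $C>0$ such that for all $v\subseteq\{1,\dots,d\}$ and all $\mathbf u\in(0,1)^d$, $$|\partial^v h(\mathbf u)|\le C\prod_{j=1}^d m(u_j)^{-B-\mathbf 1_{\{j\in v\}}}.$$ Consequently, the scrambled-net estimator $\widehat\mu_N=\frac1N\sum_{i=1}^N h(\mathbf u_i')$ of $\mu=\mathbb{E}_{\mathbf x\sim\pi}[f(\mathbf x)]$ has root-mean-square error $(\mathbb{E}|\widehat\mu_N-\mu|^2)^{1/2}=O(N^{-1+\varepsilon})$ for every $\varepsilon>0$.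
   Context: For $v\subseteq\{1,\dots,d\}$, $\partial^v=\prod_{j\in v}\partial/\partial u_j$ is the mixed partial derivative taken once in each coordinate of $v$ ($\partial^\emptyset$ is the identity). Multi-index derivatives $\partial^\lambda$ are the usual ones, $|\lambda|=\sum_k\lambda_k$. "For arbitrarily small $B>0$" means for every $B>0$, with the constant allowed to depend on $B$. All derivatives appearing in the hypotheses are understood to exist and be continuous. A $C^1$ diffeomorphism is onto $\mathbb{R}^d$ with $C^1$ inverse. The points $\mathbf u_1',\dots,\mathbf u_N'$ are obtained by applying Owen scrambling (nested uniform random scrambling) in base $b$ to a $(t,m,d)$-net in base $b$ with $N=b^m$ points ($b$, $t$ fixed); each $\mathbf u_i'$ is marginally uniform on $[0,1]^d$. The $O(\cdot)$ is as $N\to\infty$ along such sizes, with constant depending on $\varepsilon$. By change of variables $\mu=\int_{(0,1)^d}h(\mathbf u)\,d\mathbf u$. *)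

theory Defs
  imports "HOL-Probability.Probability" "HOL-Combinatorics.Permutations"
begin

section \<open>Partial derivatives\<close>

definition partial_deriv :: "'d::finite \<Rightarrow> (real^'d \<Rightarrow> real) \<Rightarrow> real^'d \<Rightarrow> real" where
  "partial_deriv k g x = deriv (\<lambda>t. g (x + t *\<^sub>R axis k 1)) 0"

text \<open>The coordinate at the head of the list is differentiated last.\<close>

primrec iter_partial :: "'d::finite list \<Rightarrow> (real^'d \<Rightarrow> real) \<Rightarrow> real^'d \<Rightarrow> real" where
  "iter_partial [] g = g"
| "iter_partial (k # ks) g = partial_deriv k (iter_partial ks g)"

text \<open>All iterated partial derivatives of \<open>g\<close> met when differentiating successively along the
  list exist on the open set \<open>S\<close> and are continuous there.\<close>

primrec cont_partials :: "(real^'d) set \<Rightarrow> 'd::finite list \<Rightarrow> (real^'d \<Rightarrow> real) \<Rightarrow> bool" where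
  "cont_partials S [] g \<longleftrightarrow> continuous_on S g"
| "cont_partials S (k # ks) g \<longleftrightarrow> cont_partials S ks g \<and>
     (\<forall>x\<in>S. (\<lambda>t. iter_partial ks g (x + t *\<^sub>R axis k 1)) field_differentiable (at 0)) \<and>
     continuous_on S (iter_partial (k # ks) g)"

text \<open>All partial derivatives of order at most \<open>n\<close>, in every order of differentiation.\<close>

definition C_n_on :: "nat \<Rightarrow> (real^'d) set \<Rightarrow> (real^'d::finite \<Rightarrow> real) \<Rightarrow> bool" where
  "C_n_on n S g \<longleftrightarrow> (\<forall>ks. length ks \<le> n \<longrightarrow> cont_partials S ks g)"

text \<open>All mixed partial derivatives at most once in each coordinate, in every order of
  differentiation.\<close>

definition C_mixed_on :: "(real^'d) set \<Rightarrow> (real^'d::finite \<Rightarrow> real) \<Rightarrow> bool" where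
  "C_mixed_on S g \<longleftrightarrow> (\<forall>ks. distinct ks \<longrightarrow> cont_partials S ks g)"

text \<open>The order of differentiation is left unspecified. It is irrelevant (Schwarz) wherever
  \<open>C_n_on\<close>, respectively \<open>C_mixed_on\<close>, holds, and these operators are only used there.\<close>

definition multi_deriv :: "('d \<Rightarrow> nat) \<Rightarrow> (real^'d::finite \<Rightarrow> real) \<Rightarrow> real^'d \<Rightarrow> real" where
  "multi_deriv l g = iter_partial (SOME ks. \<forall>k. count_list ks k = l k) g"

definition mixed_deriv :: "'d set \<Rightarrow> (real^'d::finite \<Rightarrow> real) \<Rightarrow> real^'d \<Rightarrow> real" where
  "mixed_deriv v = multi_deriv (\<lambda>k. if k \<in> v then 1 else 0)"

lemma multi_deriv_witness:
  fixes l :: "'d::finite \<Rightarrow> nat"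
  obtains ks where "\<forall>k. count_list ks k = l k" "multi_deriv l g = iter_partial ks g"
proof -
  obtain xs :: "'d list" where xs: "set xs = UNIV" "distinct xs"
    using finite_distinct_list[of "UNIV :: 'd set"] by auto
  have "count_list (concat (map (\<lambda>j. replicate (l j) j) ys)) k = (if k \<in> set ys then l k else 0)"
    if "distinct ys" for ys k
  proof -
    have r: "count_list (replicate n j) k = (if j = k then n else 0)" for n j
      by (induction n) auto
    show ?thesis using that by (induction ys) (auto simp: r)
  qed
  with xs have "\<exists>ks. \<forall>k. count_list ks k = l k"
    by (metis UNIV_I)
  from someI_ex[OF this] show ?thesis
    by (intro that[of "SOME ks. \<forall>k. count_list ks k = l k"]) (auto simp: multi_deriv_def)
qed

lemma mixed_deriv_empty: "mixed_deriv {} g = g"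
proof -
  obtain ks where ks: "\<forall>k. count_list ks k = (if k \<in> {} then 1 else 0)"
    "mixed_deriv {} g = iter_partial ks g"
    unfolding mixed_deriv_def by (rule multi_deriv_witness)
  have "ks = []" using ks(1) by (cases ks) (auto split: if_splits)
  with ks(2) show ?thesis by simp
qed

lemma mixed_deriv_singleton: "mixed_deriv {i} g = partial_deriv i g"
proof -
  obtain ks where ks: "\<forall>k. count_list ks k = (if k \<in> {i} then 1 else 0)"
    "mixed_deriv {i} g = iter_partial ks g"
    unfolding mixed_deriv_def by (rule multi_deriv_witness)
  have c: "count_list ks k = (if k = i then 1 else 0)" for k using ks(1) by simp
  have "ks \<noteq> []" using c[of i] by auto
  then obtain j js where j: "ks = j # js" by (cases ks) auto
  have "j = i" using c[of j] j by (auto split: if_splits)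
  then have z: "count_list js k = 0" for k using c[of k] j by (auto split: if_splits)
  have "js = []" using z[of "hd js"] by (cases js) auto
  with j \<open>j = i\<close> have "ks = [i]" by simp
  with ks(2) show ?thesis by simp
qed


section \<open>The transport map\<close>

definition open_cube :: "(real^'d::finite) set" where
  "open_cube = {u. \<forall>k. 0 < u $ k \<and> u $ k < 1}"

definition edge_dist :: "real \<Rightarrow> real" where
  "edge_dist u = min u (1 - u)"

definition C1_on :: "'a::real_normed_vector set \<Rightarrow> ('a \<Rightarrow> 'b::real_normed_vector) \<Rightarrow> bool" where
  "C1_on S g \<longleftrightarrow> (\<exists>g'::'a \<Rightarrow> 'a \<Rightarrow>\<^sub>L 'b.
     (\<forall>x\<in>S. (g has_derivative blinfun_apply (g' x)) (at x)) \<and> continuous_on S g')"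

definition C1_diffeomorphism ::
  "'a::real_normed_vector set \<Rightarrow> 'b::real_normed_vector set \<Rightarrow> ('a \<Rightarrow> 'b) \<Rightarrow> bool" where
  "C1_diffeomorphism S T g \<longleftrightarrow>
     open S \<and> open T \<and> bij_betw g S T \<and> C1_on S g \<and> C1_on T (inv_into S g)"

definition jacobian_matrix :: "(real^'d \<Rightarrow> real^'d) \<Rightarrow> real^'d \<Rightarrow> real^'d^'d::finite" where
  "jacobian_matrix \<tau> u = (\<chi> i j. partial_deriv j (\<lambda>w. \<tau> w $ i) u)"

text \<open>The integrand lives on the open cube; it is extended by 0 because a scrambled point may, with
  probability zero, fall on the boundary of the cube.\<close>

definition pullback_integrand ::
  "(real^'d \<Rightarrow> real) \<Rightarrow> (real^'d \<Rightarrow> real) \<Rightarrow> (real^'d \<Rightarrow> real^'d) \<Rightarrow> real^'d::finite \<Rightarrow> real" where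
  "pullback_integrand f \<pi> \<tau> u =
     (if u \<in> open_cube then f (\<tau> u) * \<pi> (\<tau> u) * \<bar>det (jacobian_matrix \<tau> u)\<bar> else 0)"

definition prob_density :: "(real^'d::finite \<Rightarrow> real) \<Rightarrow> bool" where
  "prob_density \<pi> \<longleftrightarrow> \<pi> \<in> borel_measurable borel \<and> (\<forall>x. 0 \<le> \<pi> x) \<and>
     (\<integral>\<^sup>+x. ennreal (\<pi> x) \<partial>lborel) = 1"

definition univariate_cdf :: "(real \<Rightarrow> real) \<Rightarrow> bool" where
  "univariate_cdf F \<longleftrightarrow> (\<exists>D. real_distribution D \<and> F = cdf D)"


section \<open>Nets and nested uniform scrambling\<close>

definition elementary_interval ::
  "nat \<Rightarrow> ('d \<Rightarrow> nat) \<Rightarrow> ('d \<Rightarrow> nat) \<Rightarrow> (real^'d::finite) set" where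
  "elementary_interval b c a =
     {x. \<forall>k. real (a k) / real b ^ c k \<le> x $ k \<and> x $ k < (real (a k) + 1) / real b ^ c k}"

text \<open>A net is a family indexed by \<open>i < b ^ m\<close>, so repeated points are counted with
  multiplicity.\<close>

definition tms_net :: "nat \<Rightarrow> nat \<Rightarrow> nat \<Rightarrow> (nat \<Rightarrow> real^'d::finite) \<Rightarrow> bool" where
  "tms_net b t m P \<longleftrightarrow> t \<le> m \<and> (\<forall>i<b ^ m. \<forall>k. 0 \<le> P i $ k \<and> P i $ k < 1) \<and>
     (\<forall>c a. (\<Sum>k\<in>UNIV. c k) = m - t \<longrightarrow> (\<forall>k. a k < b ^ c k) \<longrightarrow>
        card {i. i < b ^ m \<and> P i \<in> elementary_interval b c a} = b ^ t)"

text \<open>Digit number \<open>l\<close> (counted from 0) after the point of the base-\<open>b\<close> expansion of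
  \<open>x \<in> [0,1)\<close>; the expansion obtained is the one not ending in \<open>b - 1\<close> forever.\<close>

definition digit :: "nat \<Rightarrow> real \<Rightarrow> nat \<Rightarrow> nat" where
  "digit b x l = nat \<lfloor>x * real b ^ Suc l\<rfloor> mod b"

text \<open>Each digit is permuted by a permutation that depends on all the preceding original
  digits.\<close>

definition scramble_coord :: "nat \<Rightarrow> (nat list \<Rightarrow> nat \<Rightarrow> nat) \<Rightarrow> real \<Rightarrow> real" where
  "scramble_coord b \<sigma> x =
     (\<Sum>l. real (\<sigma> (map (digit b x) [0..<l]) (digit b x l)) / real b ^ Suc l)"

definition scramble ::
  "nat \<Rightarrow> ('d \<Rightarrow> nat list \<Rightarrow> nat \<Rightarrow> nat) \<Rightarrow> real^'d \<Rightarrow> real^'d::finite" where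
  "scramble b \<sigma> x = (\<chi> k. scramble_coord b (\<sigma> k) (x $ k))"

text \<open>One uniformly random permutation of the digits for each coordinate and each digit prefix,
  all of them mutually independent.\<close>

definition nested_uniform_scrambling ::
  "nat \<Rightarrow> 'w measure \<Rightarrow> ('w \<Rightarrow> 'd::finite \<Rightarrow> nat list \<Rightarrow> nat \<Rightarrow> nat) \<Rightarrow> bool" where
  "nested_uniform_scrambling b M \<Sigma> \<longleftrightarrow> prob_space M \<and>
     prob_space.indep_vars M (\<lambda>_. count_space {\<sigma>. \<sigma> permutes {..<b}})
       (\<lambda>(k, p) \<omega>. \<Sigma> \<omega> k p) (UNIV \<times> lists {..<b}) \<and>
     (\<forall>k. \<forall>p\<in>lists {..<b}.
        distr M (count_space {\<sigma>. \<sigma> permutes {..<b}}) (\<lambda>\<omega>. \<Sigma> \<omega> k p)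
          = uniform_count_measure {\<sigma>. \<sigma> permutes {..<b}})"

definition scrambled_net_estimator ::
  "nat \<Rightarrow> nat \<Rightarrow> (real^'d::finite \<Rightarrow> real) \<Rightarrow> (nat \<Rightarrow> real^'d) \<Rightarrow>
     ('w \<Rightarrow> 'd \<Rightarrow> nat list \<Rightarrow> nat \<Rightarrow> nat) \<Rightarrow> 'w \<Rightarrow> real" where
  "scrambled_net_estimator b m h P \<Sigma> \<omega> =
     (1 / real (b ^ m)) * (\<Sum>i<b ^ m. h (scramble b (\<Sigma> \<omega>) (P i)))"

end

theory Submission
  imports Defs
begin

text \<open>Every mixed derivative of \<open>h\<close> is a sum of products of a derivative of \<open>f\<close>, a derivative of \<open>\<pi>\<close> (both
  at \<open>\<tau> u\<close>) and mixed derivatives of \<open>\<tau>\<close>. The Gaussian decay of \<open>\<pi>\<close> together with the lower bound on \<open>\<tau>\<close>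
  contributes \<open>m(u_k)\<close> to a power \<open>\<alpha> C5 > 1\<close> in each coordinate, whereas the Jacobian determinant costs only
  one inverse power of each \<open>m(u_k)\<close>, because every coordinate is differentiated exactly once in each of
  its terms. Hence \<open>h\<close> even satisfies the growth condition with a positive exponent \<open>c\<close> in place of \<open>- B\<close>:
  it vanishes on the faces of the cube and its full mixed derivative is integrable. A
  Koksma-Hlawka bound therefore applies to every realisation of the scrambled net, which is again a
  net and has star discrepancy \<open>O((ln N) ^ d / N)\<close>; the randomness of the scrambling plays no role.\<close>

section \<open>Iterated partial derivatives\<close>

text \<open>The full mixed derivative of \<open>h\<close> may still blow up at the faces, like
  \<open>edge_dist\<close> to the power \<open>c - 1\<close> in each coordinate, so no constant
  bounds it. It is dominated instead by a product of derivatives of a bounded univariate potential,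
  whose increments telescope to at most \<open>2 / c\<close> per coordinate; this plays the part of
  the variation of \<open>h\<close>. Summation by parts is carried out on the finite grid of
  \<open>n\<close>-digit points, where it is an identity between finite sums: as \<open>h\<close>
  vanishes where a coordinate is 0, its value at a grid point is the sum of its mixed differences
  over the cells below that point, and only counts of points in upper orthants enter. The same
  identity for the full grid supplies the comparison value, which becomes the integral as
  \<open>n\<close> grows. Of the gap \<open>\<alpha> * C5 - 1\<close>, one half pays for the small
  losses from \<open>f\<close>, the chain rule and the Jacobian; the other half is \<open>c\<close>.
  The absolute value around the determinant does not disturb differentiation, because a nonvanishing
  continuous function on the cube has constant sign.\<close>

lemma iter_partial_append: "iter_partial (ks @ js) g = iter_partial ks (iter_partial js g)"
  by (induction ks) auto

lemma cont_partials_continuous: "cont_partials S ks g \<Longrightarrow> continuous_on S (iter_partial ks g)"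
  by (cases ks) auto

lemma cont_partials_append:
  "cont_partials S (ks @ js) g \<longleftrightarrow> cont_partials S js g \<and> cont_partials S ks (iter_partial js g)"
  by (induction ks) (auto simp: iter_partial_append intro: cont_partials_continuous)

lemma eventually_line_in_open:
  fixes S :: "(real^'d::finite) set"
  assumes "open S" "x \<in> S"
  shows "eventually (\<lambda>t. x + t *\<^sub>R axis k 1 \<in> S) (nhds 0)"
proof -
  have "((\<lambda>t. x + t *\<^sub>R axis k 1) \<longlongrightarrow> x + 0 *\<^sub>R axis k 1) (nhds 0)"
    by (intro tendsto_intros filterlim_ident)
  then show ?thesis
    using assms by (auto dest: topological_tendstoD)
qed

lemma partial_deriv_cong:
  assumes "open S" "x \<in> S" "\<And>y. y \<in> S \<Longrightarrow> g y = g' y"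
  shows "partial_deriv k g x = partial_deriv k g' x"
  unfolding partial_deriv_def
proof (rule deriv_cong_ev)
  show "\<forall>\<^sub>F t in nhds 0. g (x + t *\<^sub>R axis k 1) = g' (x + t *\<^sub>R axis k 1)"
    using eventually_line_in_open[OF assms(1,2)] by eventually_elim (rule assms(3))
qed simp

lemma line_differentiable_cong:
  fixes g g' :: "real^'d::finite \<Rightarrow> real"
  assumes "open S" "x \<in> S" "\<And>y. y \<in> S \<Longrightarrow> g y = g' y"
    and "(\<lambda>t. g (x + t *\<^sub>R axis k 1)) field_differentiable (at 0)"
  shows "(\<lambda>t. g' (x + t *\<^sub>R axis k 1)) field_differentiable (at 0)"
proof -
  obtain D where "((\<lambda>t. g (x + t *\<^sub>R axis k 1)) has_field_derivative D) (at 0)"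
    using assms(4) by (auto simp: field_differentiable_def)
  then have "((\<lambda>t. g' (x + t *\<^sub>R axis k 1)) has_field_derivative D) (at 0)"
  proof (rule DERIV_cong_ev[THEN iffD1, rotated -1])
    show "\<forall>\<^sub>F t in nhds 0. g (x + t *\<^sub>R axis k 1) = g' (x + t *\<^sub>R axis k 1)"
      using eventually_line_in_open[OF assms(1,2)] by eventually_elim (rule assms(3))
  qed simp_all
  then show ?thesis by (auto simp: field_differentiable_def)
qed

lemma iter_partial_cong:
  assumes "open S" "\<And>y. y \<in> S \<Longrightarrow> g y = g' y"
  shows "x \<in> S \<Longrightarrow> iter_partial ks g x = iter_partial ks g' x"
proof (induction ks arbitrary: x)
  case (Cons k ks)
  then show ?case
    by (simp, intro partial_deriv_cong[OF assms(1)]) auto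
qed (simp add: assms(2))

lemma cont_partials_cong:
  assumes "open S" "\<And>y. y \<in> S \<Longrightarrow> g y = g' y" "cont_partials S ks g"
  shows "cont_partials S ks g'"
  using assms(3)
proof (induction ks)
  case Nil
  then show ?case using assms(2) by (auto cong: continuous_on_cong)
next
  case (Cons k ks)
  note eq = iter_partial_cong[of S g g', OF assms(1,2)]
  have "continuous_on S (iter_partial (k # ks) g')"
    using Cons.prems eq[of _ "k # ks"] by (auto cong: continuous_on_cong)
  moreover have "(\<lambda>t. iter_partial ks g' (x + t *\<^sub>R axis k 1)) field_differentiable (at 0)" if "x \<in> S" for x
    using line_differentiable_cong[OF assms(1) that, of "iter_partial ks g"] eq[of _ ks] Cons.prems that
    by auto
  ultimately show ?case using Cons by auto
qed

text \<open>\<open>partial_deriv\<close> looks at a line only at parameter 0; moving the base point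
  along the line gives the derivative at every parameter, as the mean value theorem
  requires.\<close>

lemma line_has_derivative:
  assumes "\<And>y. y \<in> S \<Longrightarrow> (\<lambda>t. g (y + t *\<^sub>R axis k 1)) field_differentiable (at 0)"
    and "x + s *\<^sub>R axis k 1 \<in> S"
  shows "((\<lambda>t. g (x + t *\<^sub>R axis k 1)) has_real_derivative partial_deriv k g (x + s *\<^sub>R axis k 1)) (at s)"
proof -
  let ?y = "x + s *\<^sub>R axis k 1"
  have "((\<lambda>t. g (?y + t *\<^sub>R axis k 1)) has_real_derivative partial_deriv k g ?y) (at 0)"
    unfolding partial_deriv_def by (rule field_differentiable_derivI[THEN iffD2[OF refl]]) (simp add: assms)
  then have "((\<lambda>t. g (?y + t *\<^sub>R axis k 1)) has_real_derivative partial_deriv k g ?y) (at (s + - s))"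
    by simp
  then have "((\<lambda>t. g (?y + (t + - s) *\<^sub>R axis k 1)) has_real_derivative partial_deriv k g ?y) (at s)"
    by (rule DERIV_shift[THEN iffD1])
  then show ?thesis by (simp add: algebra_simps)
qed

text \<open>The mean value theorem in direction \<open>j\<close> and again in direction
  \<open>k\<close> turns the second difference quotient into the mixed partial at a nearby point,
  and continuity gives the limit. The quotient is symmetric in \<open>j\<close> and
  \<open>k\<close>, which is how Schwarz's theorem comes out.\<close>

lemma second_difference_tendsto:
  fixes G :: "real^'d::finite \<Rightarrow> real"
  assumes S: "open S" "x \<in> S" and G: "cont_partials S [k, j] G"
  shows "((\<lambda>s. (G (x + s *\<^sub>R axis j 1 + s *\<^sub>R axis k 1) - G (x + s *\<^sub>R axis j 1)
     - G (x + s *\<^sub>R axis k 1) + G x) / s\<^sup>2) \<longlongrightarrow> partial_deriv k (partial_deriv j G) x) (at_right 0)"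
proof (rule tendstoI)
  fix e :: real assume "e > 0"
  let ?D = "partial_deriv k (partial_deriv j G)"
  have "continuous_on S ?D" using G by simp
  then have "isCont ?D x" using S by (simp add: continuous_on_eq_continuous_at)
  then obtain d1 where d1: "d1 > 0" "\<And>y. dist y x < d1 \<Longrightarrow> dist (?D y) (?D x) < e"
    using \<open>e > 0\<close> unfolding continuous_at_eps_delta by (metis dist_commute)
  obtain d2 where d2: "d2 > 0" "ball x d2 \<subseteq> S" using S openE by blast
  define d where "d = min d1 d2"
  have d: "d > 0" using d1 d2 by (simp add: d_def)
  have near: "dist (x + a *\<^sub>R axis j 1 + b *\<^sub>R axis k 1) x < d" if "\<bar>a\<bar> < d/2" "\<bar>b\<bar> < d/2" for a b
  proof -
    have "norm (a *\<^sub>R axis j 1 + b *\<^sub>R axis k 1 :: real^'d) \<le> \<bar>a\<bar> + \<bar>b\<bar>"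
      by (rule order_trans[OF norm_triangle_ineq]) simp
    then show ?thesis using that by (simp add: dist_norm add.assoc)
  qed
  have inS: "x + a *\<^sub>R axis j 1 + b *\<^sub>R axis k 1 \<in> S" if "\<bar>a\<bar> < d/2" "\<bar>b\<bar> < d/2" for a b
    using near[OF that] d2 by (auto simp: d_def dist_commute subset_eq)
  have "dist ((G (x + s *\<^sub>R axis j 1 + s *\<^sub>R axis k 1) - G (x + s *\<^sub>R axis j 1)
     - G (x + s *\<^sub>R axis k 1) + G x) / s\<^sup>2) (?D x) < e" if s: "0 < s" "s < d/2" for s
  proof -
    define \<phi> where "\<phi> a = G ((x + s *\<^sub>R axis k 1) + a *\<^sub>R axis j 1) - G (x + a *\<^sub>R axis j 1)" for a
    have "\<exists>a. 0 < a \<and> a < s \<and> \<phi> s - \<phi> 0 = (s - 0) *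
      (partial_deriv j G ((x + s *\<^sub>R axis k 1) + a *\<^sub>R axis j 1) - partial_deriv j G (x + a *\<^sub>R axis j 1))"
    proof (rule MVT2)
      fix a assume a: "0 \<le> a" "a \<le> s"
      have 1: "(x + s *\<^sub>R axis k 1) + a *\<^sub>R axis j 1 \<in> S" using inS[of a s] a s by (simp add: algebra_simps)
      have 2: "x + a *\<^sub>R axis j 1 \<in> S" using inS[of a 0] a s d by (simp add: algebra_simps)
      show "(\<phi> has_real_derivative
        partial_deriv j G ((x + s *\<^sub>R axis k 1) + a *\<^sub>R axis j 1) - partial_deriv j G (x + a *\<^sub>R axis j 1)) (at a)"
        unfolding \<phi>_def
        by (intro DERIV_diff line_has_derivative[where S = S] 1 2) (use G in auto)
    qed (use s in auto)
    then obtain a where a: "0 < a" "a < s" "\<phi> s - \<phi> 0 = s *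
      (partial_deriv j G ((x + s *\<^sub>R axis k 1) + a *\<^sub>R axis j 1) - partial_deriv j G (x + a *\<^sub>R axis j 1))"
      by auto
    have "\<exists>b. 0 < b \<and> b < s \<and> partial_deriv j G ((x + a *\<^sub>R axis j 1) + s *\<^sub>R axis k 1)
      - partial_deriv j G ((x + a *\<^sub>R axis j 1) + 0 *\<^sub>R axis k 1)
      = (s - 0) * ?D ((x + a *\<^sub>R axis j 1) + b *\<^sub>R axis k 1)"
    proof (rule MVT2)
      fix b assume b: "0 \<le> b" "b \<le> s"
      have 1: "(x + a *\<^sub>R axis j 1) + b *\<^sub>R axis k 1 \<in> S" using inS[of a b] a b s by simp
      show "((\<lambda>b. partial_deriv j G ((x + a *\<^sub>R axis j 1) + b *\<^sub>R axis k 1)) has_real_derivative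
         ?D ((x + a *\<^sub>R axis j 1) + b *\<^sub>R axis k 1)) (at b)"
        by (intro line_has_derivative[where S = S] 1) (use G in auto)
    qed (use s in auto)
    then obtain b where b: "0 < b" "b < s" "partial_deriv j G ((x + a *\<^sub>R axis j 1) + s *\<^sub>R axis k 1)
      - partial_deriv j G (x + a *\<^sub>R axis j 1)
      = s * ?D ((x + a *\<^sub>R axis j 1) + b *\<^sub>R axis k 1)"
      by auto
    have "G (x + s *\<^sub>R axis j 1 + s *\<^sub>R axis k 1) - G (x + s *\<^sub>R axis j 1) - G (x + s *\<^sub>R axis k 1) + G x
       = \<phi> s - \<phi> 0"
      by (simp add: \<phi>_def algebra_simps)
    also have "\<dots> = s\<^sup>2 * ?D ((x + a *\<^sub>R axis j 1) + b *\<^sub>R axis k 1)"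
      using a(3) b(3) by (simp add: algebra_simps power2_eq_square)
    finally show ?thesis
      using s d1(2)[of "x + a *\<^sub>R axis j 1 + b *\<^sub>R axis k 1"] near[of a b] a b by (simp add: d_def)
  qed
  then show "\<forall>\<^sub>F s in at_right 0. dist ((G (x + s *\<^sub>R axis j 1 + s *\<^sub>R axis k 1) - G (x + s *\<^sub>R axis j 1)
     - G (x + s *\<^sub>R axis k 1) + G x) / s\<^sup>2) (?D x) < e"
    unfolding eventually_at_right_field using d by (intro exI[of _ "d/2"]) auto
qed

lemma partial_deriv_commute:
  fixes G :: "real^'d::finite \<Rightarrow> real"
  assumes "open S" "x \<in> S" "cont_partials S [k, j] G" "cont_partials S [j, k] G"
  shows "partial_deriv k (partial_deriv j G) x = partial_deriv j (partial_deriv k G) x"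
proof (rule tendsto_unique[OF _ second_difference_tendsto[OF assms(1-3)]])
  have "(\<lambda>s. (G (x + s *\<^sub>R axis k 1 + s *\<^sub>R axis j 1) - G (x + s *\<^sub>R axis k 1)
     - G (x + s *\<^sub>R axis j 1) + G x) / s\<^sup>2) = (\<lambda>s. (G (x + s *\<^sub>R axis j 1 + s *\<^sub>R axis k 1)
     - G (x + s *\<^sub>R axis j 1) - G (x + s *\<^sub>R axis k 1) + G x) / s\<^sup>2)" (is "?l = ?r")
  proof
    fix s
    have eq: "x + s *\<^sub>R axis k 1 + s *\<^sub>R axis j 1 = x + s *\<^sub>R axis j 1 + s *\<^sub>R axis k 1"
      by simp
    show "?l s = ?r s"
      unfolding eq by simp
  qed
  then show "((\<lambda>s. (G (x + s *\<^sub>R axis j 1 + s *\<^sub>R axis k 1) - G (x + s *\<^sub>R axis j 1)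
     - G (x + s *\<^sub>R axis k 1) + G x) / s\<^sup>2) \<longlongrightarrow> partial_deriv j (partial_deriv k G) x) (at_right 0)"
    using second_difference_tendsto[OF assms(1,2,4)] by simp
qed simp

text \<open>Strong induction on the length: if the heads \<open>k\<close> and \<open>k'\<close>
  differ, each list is compared with one that starts with both of them, and the two leading
  derivatives are swapped. Smoothness is demanded for every rearrangement because the tails are
  reordered on the way.\<close>

lemma iter_partial_perm:
  fixes g :: "real^'d::finite \<Rightarrow> real"
  assumes "open S" "x \<in> S" "mset ks = mset ks'"
    and "\<And>js. mset js = mset ks \<Longrightarrow> cont_partials S js g"
  shows "iter_partial ks g x = iter_partial ks' g x"
  using assms(2-)
proof (induction "length ks" arbitrary: ks ks' x rule: less_induct)
  case less
  show ?case
  proof (cases ks)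
    case Nil
    then show ?thesis using less.prems by simp
  next
    case (Cons k xs)
    with less.prems(2) obtain k' xs' where ks': "ks' = k' # xs'" by (cases ks') auto
    have sub: "cont_partials S js g" if "mset (k # js) = mset ks \<or> mset (k' # js) = mset ks" for js
      using that less.prems(3)[of "k # js"] less.prems(3)[of "k' # js"] by auto
    show ?thesis
    proof (cases "k = k'")
      case True
      have "iter_partial xs g y = iter_partial xs' g y" if "y \<in> S" for y
        by (rule less.hyps) (use less.prems(2) ks' Cons True that sub in auto)
      from partial_deriv_cong[OF assms(1) less.prems(1) this] show ?thesis
        using True ks' Cons by simp
    next
      case False
      have "k' \<in># mset xs" using less.prems(2) Cons ks' False
        by (auto dest: arg_cong[of _ _ "\<lambda>M. k' \<in># M"])
      then obtain us vs where "xs = us @ k' # vs"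
        by (auto simp: in_set_conv_decomp)
      then obtain zs where zs: "mset xs = mset (k' # zs)"
        by (intro that[of "us @ vs"]) simp
      then have zs': "mset xs' = mset (k # zs)"
        using less.prems(2) Cons ks' by (simp add: add_mset_commute)
      have ms: "mset ks = mset (k # k' # zs)" using zs Cons by simp
      have 1: "iter_partial xs g y = iter_partial (k' # zs) g y" if "y \<in> S" for y
        by (rule less.hyps) (use that zs Cons sub in auto)
      have 2: "iter_partial xs' g y = iter_partial (k # zs) g y" if "y \<in> S" for y
      proof (rule less.hyps)
        show "length xs' < length ks"
          using arg_cong[OF less.prems(2), of size] ks' by simp
        show "cont_partials S js g" if "mset js = mset xs'" for js
          using that less.prems(2) ks' by (intro sub) auto
      qed (use that zs' in auto)
      have c: "cont_partials S [k, k'] (iter_partial zs g)" "cont_partials S [k', k] (iter_partial zs g)"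
        using less.prems(3)[of "[k, k'] @ zs"] less.prems(3)[of "[k', k] @ zs"] ms
        unfolding cont_partials_append by (auto simp: add_mset_commute)
      have "iter_partial ks g x = iter_partial (k # k' # zs) g x"
        using Cons partial_deriv_cong[OF assms(1) less.prems(1) 1] by simp
      also have "\<dots> = iter_partial (k' # k # zs) g x"
        using partial_deriv_commute[OF assms(1) less.prems(1) c] by simp
      also have "\<dots> = iter_partial ks' g x"
        using ks' partial_deriv_cong[OF assms(1) less.prems(1) 2] by simp
      finally show ?thesis .
    qed
  qed
qed

text \<open>The chain rule for \<open>g\<close> composed with \<open>\<tau>\<close> needs a total
  derivative, whereas smoothness is given through partials. Coordinates are switched on one at a
  time: \<open>P A v\<close> keeps those in \<open>A\<close>, and each further one adds an increment
  along an axis, controlled by a mean value inequality.\<close>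

lemma has_derivative_from_partials:
  fixes G :: "real^'d::finite \<Rightarrow> real"
  assumes G: "\<And>j. cont_partials UNIV [j] G"
  shows "(G has_derivative (\<lambda>v. \<Sum>j\<in>UNIV. partial_deriv j G x * v $ j)) (at x)"
proof -
  define P :: "'d set \<Rightarrow> real^'d \<Rightarrow> real^'d" where "P A v = (\<Sum>j\<in>A. v $ j *\<^sub>R axis j 1)" for A v
  have P_UNIV: "P UNIV v = v" for v
    unfolding P_def by (simp add: vec_eq_iff axis_def if_distrib sum.delta cong: if_cong)
  have normP: "norm (P A v) \<le> real (card A) * norm v" if "finite A" for A v
  proof -
    have "norm (P A v) \<le> (\<Sum>j\<in>A. norm (v $ j *\<^sub>R axis j 1 :: real^'d))"
      unfolding P_def by (rule norm_sum)
    also have "\<dots> \<le> (\<Sum>j\<in>A. norm v)" by (intro sum_mono) (simp add: component_le_norm_cart)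
    finally show ?thesis by simp
  qed
  have "((\<lambda>v. G (x + P A v)) has_derivative (\<lambda>v. \<Sum>j\<in>A. partial_deriv j G x * v $ j)) (at 0)" for A
    using finite[of A]
  proof (induction A)
    case empty
    then show ?case by (simp add: P_def)
  next
    case (insert k A)
    let ?D = "partial_deriv k G"
    have ins: "P (insert k A) v = P A v + v $ k *\<^sub>R axis k 1" for v using insert.hyps by (simp add: P_def)
    have "((\<lambda>v. G (x + P (insert k A) v) - G (x + P A v)) has_derivative (\<lambda>v. ?D x * v $ k)) (at 0)"
      unfolding has_derivative_at_alt
    proof (intro conjI allI impI)
      show "bounded_linear (\<lambda>v::real^'d. ?D x * v $ k)"
        by (intro bounded_linear_const_mult bounded_linear_vec_nth)
      fix e :: real assume "e > 0"
      have "isCont ?D x" using G[of k] by (simp add: continuous_on_eq_continuous_at)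
      then obtain d1 where d1: "d1 > 0" "\<And>y. dist y x < d1 \<Longrightarrow> dist (?D y) (?D x) < e"
        using \<open>e > 0\<close> unfolding continuous_at_eps_delta by (metis dist_commute)
      \<comment> \<open>The points met lie within \<open>(card A + 1) * norm y\<close> of
        \<open>x\<close>: at most \<open>norm y\<close> for each coordinate in \<open>A\<close> and
        for \<open>k\<close>.\<close>
      define d where "d = d1 / (real (card A) + 1)"
      have "d > 0" using d1 by (simp add: d_def)
      moreover have "norm (G (x + P (insert k A) y) - G (x + P A y) - (G (x + P (insert k A) 0) - G (x + P A 0))
            - ?D x * (y - 0) $ k) \<le> e * norm (y - 0)" if y: "norm (y - 0) < d" for y
      proof -
        have P0: "P B 0 = 0" for B by (simp add: P_def)
        have est: "dist (x + P A y + s *\<^sub>R axis k 1) x < d1" if "\<bar>s\<bar> \<le> \<bar>y $ k\<bar>" for s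
        proof -
          have "norm (P A y + s *\<^sub>R axis k 1) \<le> norm (P A y) + \<bar>s\<bar>"
            by (rule order_trans[OF norm_triangle_ineq]) simp
          also have "\<dots> \<le> real (card A) * norm y + norm y"
            using normP[of A y] that component_le_norm_cart[of y k] by simp
          also have "\<dots> = (real (card A) + 1) * norm y" by (simp add: algebra_simps)
          also have "\<dots> < d1" using y by (simp add: d_def field_simps)
          finally show ?thesis by (simp add: dist_norm add.assoc)
        qed
        define \<psi> where "\<psi> s = G ((x + P A y) + s *\<^sub>R axis k 1) - ?D x * s" for s
        have "norm (\<psi> (y $ k) - \<psi> 0) \<le> e * norm (y $ k - 0)"
        proof (rule field_differentiable_bound[where S = "closed_segment 0 (y $ k)" and f = \<psi>
              and f' = "\<lambda>s. ?D ((x + P A y) + s *\<^sub>R axis k 1) - ?D x"])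
          fix s assume s: "s \<in> closed_segment 0 (y $ k)"
          have "(\<psi> has_real_derivative ?D ((x + P A y) + s *\<^sub>R axis k 1) - ?D x * 1) (at s)"
            unfolding \<psi>_def
            by (intro DERIV_diff line_has_derivative[where S = UNIV] DERIV_cmult DERIV_ident) (use G[of k] in auto)
          then show "(\<psi> has_real_derivative ?D ((x + P A y) + s *\<^sub>R axis k 1) - ?D x) (at s within closed_segment 0 (y $ k))"
            by (auto intro: has_field_derivative_at_within)
          have "\<bar>s\<bar> \<le> \<bar>y $ k\<bar>" using s by (auto simp: closed_segment_eq_real_ivl split: if_splits)
          then have "dist (?D (x + P A y + s *\<^sub>R axis k 1)) (?D x) < e" by (intro d1 est)
          then show "norm (?D ((x + P A y) + s *\<^sub>R axis k 1) - ?D x) \<le> e"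
            by (simp add: dist_norm)
        qed auto
        also have "\<dots> \<le> e * norm y" using component_le_norm_cart[of y k] \<open>e > 0\<close> by simp
        finally show ?thesis by (simp add: \<psi>_def ins P0 algebra_simps)
      qed
      ultimately show "\<exists>d>0. \<forall>y. norm (y - 0) < d \<longrightarrow> norm (G (x + P (insert k A) y) - G (x + P A y)
         - (G (x + P (insert k A) 0) - G (x + P A 0)) - ?D x * (y - 0) $ k) \<le> e * norm (y - 0)"
        by blast
    qed
    from has_derivative_add[OF this insert.IH] insert.hyps show ?case by simp
  qed
  from this[of UNIV] have "((\<lambda>v. G (x + v)) has_derivative (\<lambda>v. \<Sum>j\<in>UNIV. partial_deriv j G x * v $ j)) (at 0)"
    by (simp add: P_UNIV)
  moreover have "((\<lambda>y. y - x) has_derivative (\<lambda>y. y)) (at x)" by (auto intro!: derivative_eq_intros)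
  ultimately have "((\<lambda>v. G (x + v)) \<circ> (\<lambda>y. y - x) has_derivative (\<lambda>v. \<Sum>j\<in>UNIV. partial_deriv j G x * v $ j) \<circ> (\<lambda>y. y)) (at x)"
    by (intro diff_chain_at) auto
  then show ?thesis by (simp add: o_def)
qed

lemma has_derivative_along_axis:
  assumes "(G has_derivative G') (at x)"
  shows "((\<lambda>t. G (x + t *\<^sub>R axis k 1)) has_vector_derivative G' (axis k 1)) (at 0)"
proof -
  have 1: "((\<lambda>t. x + t *\<^sub>R axis k 1) has_derivative (\<lambda>t. t *\<^sub>R axis k 1)) (at (0::real))"
    by (auto intro!: derivative_eq_intros)
  have "(G \<circ> (\<lambda>t. x + t *\<^sub>R axis k 1) has_derivative G' \<circ> (\<lambda>t. t *\<^sub>R axis k 1)) (at 0)"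
    by (rule diff_chain_at[OF 1]) (simp add: assms)
  moreover have "linear G'" using assms by (rule has_derivative_linear)
  ultimately show ?thesis by (simp add: o_def has_vector_derivative_def linear_cmul)
qed

lemma partial_deriv_has_derivative:
  fixes G :: "real^'d::finite \<Rightarrow> real"
  assumes "(G has_derivative G') (at x)"
  shows "partial_deriv k G x = G' (axis k 1)"
    and "(\<lambda>t. G (x + t *\<^sub>R axis k 1)) field_differentiable (at 0)"
proof -
  have "((\<lambda>t. G (x + t *\<^sub>R axis k 1)) has_real_derivative G' (axis k 1)) (at 0)"
    unfolding has_real_derivative_iff_has_vector_derivative by (rule has_derivative_along_axis[OF assms])
  then show "partial_deriv k G x = G' (axis k 1)" "(\<lambda>t. G (x + t *\<^sub>R axis k 1)) field_differentiable (at 0)"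
    by (auto simp: partial_deriv_def field_differentiable_def DERIV_imp_deriv)
qed

section \<open>Growth at the boundary of the cube\<close>

lemma open_cube_eq_box: "(open_cube :: (real^'d::finite) set) = box 0 1"
  by (auto simp: open_cube_def mem_box_cart)

lemma open_open_cube: "open (open_cube :: (real^'d::finite) set)"
  unfolding open_cube_eq_box by (rule open_box)

lemma convex_open_cube: "convex (open_cube :: (real^'d::finite) set)"
  unfolding open_cube_eq_box by (rule convex_box)

lemma edge_dist_bounds: "u \<in> open_cube \<Longrightarrow> 0 < edge_dist (u $ k)" "u \<in> open_cube \<Longrightarrow> edge_dist (u $ k) < 1"
  by (auto simp: edge_dist_def open_cube_def min_def)

text \<open>Exponents are kept per coordinate because a derivative in coordinate \<open>k\<close>
  lowers only the exponent at \<open>k\<close>. Larger exponents mean stronger decay at the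
  faces.\<close>

definition edge_weight :: "('d::finite \<Rightarrow> real) \<Rightarrow> real^'d \<Rightarrow> real" where
  "edge_weight e u = (\<Prod>k\<in>UNIV. edge_dist (u $ k) powr e k)"

lemma edge_weight_pos: "u \<in> open_cube \<Longrightarrow> 0 < edge_weight e u"
  unfolding edge_weight_def by (intro prod_pos) (auto dest: edge_dist_bounds(1)[of u] less_imp_neq[symmetric])

lemma edge_weight_add: "edge_weight (\<lambda>k. e k + e' k) u = edge_weight e u * edge_weight e' u"
  by (simp add: edge_weight_def powr_add prod.distrib)

lemma edge_weight_antimono:
  assumes "u \<in> open_cube" "\<And>k. e k \<le> e' k"
  shows "edge_weight e' u \<le> edge_weight e u"
  unfolding edge_weight_def
  using edge_dist_bounds[OF assms(1)] assms(2) by (intro prod_mono conjI powr_mono') (auto intro: less_imp_le)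

lemma edge_weight_powr: "u \<in> open_cube \<Longrightarrow> edge_weight e u powr r = edge_weight (\<lambda>k. e k * r) u"
  unfolding edge_weight_def
  by (subst prod_powr_distrib) (auto simp: powr_powr)

lemma edge_weight_0: "u \<in> open_cube \<Longrightarrow> edge_weight (\<lambda>k. 0) u = 1"
  unfolding edge_weight_def using edge_dist_bounds(1)[of u] by (simp add: less_imp_neq[symmetric])

definition edge_bounded :: "('d::finite \<Rightarrow> real) \<Rightarrow> (real^'d \<Rightarrow> real) \<Rightarrow> bool" where
  "edge_bounded e G \<longleftrightarrow> (\<exists>C. \<forall>u\<in>open_cube. \<bar>G u\<bar> \<le> C * edge_weight e u)"

lemma edge_bounded_mono:
  assumes "edge_bounded e G" "\<And>k. e' k \<le> e k"
  shows "edge_bounded e' G"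
proof -
  obtain C where C: "\<And>u. u \<in> open_cube \<Longrightarrow> \<bar>G u\<bar> \<le> C * edge_weight e u"
    using assms(1) by (auto simp: edge_bounded_def)
  have "\<bar>G u\<bar> \<le> max C 0 * edge_weight e' u" if u: "u \<in> open_cube" for u
  proof -
    have "\<bar>G u\<bar> \<le> max C 0 * edge_weight e u"
      by (rule order_trans[OF C[OF u]]) (use edge_weight_pos[OF u] in \<open>auto intro: mult_right_mono less_imp_le\<close>)
    also have "\<dots> \<le> max C 0 * edge_weight e' u"
      by (intro mult_left_mono edge_weight_antimono[OF u] assms) auto
    finally show ?thesis .
  qed
  then show ?thesis by (auto simp: edge_bounded_def)
qed

lemma edge_bounded_add:
  assumes "edge_bounded e G" "edge_bounded e H"
  shows "edge_bounded e (\<lambda>u. G u + H u)"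
proof -
  obtain C D where C: "\<And>u. u \<in> open_cube \<Longrightarrow> \<bar>G u\<bar> \<le> C * edge_weight e u"
    and D: "\<And>u. u \<in> open_cube \<Longrightarrow> \<bar>H u\<bar> \<le> D * edge_weight e u"
    using assms by (auto simp: edge_bounded_def)
  have "\<bar>G u + H u\<bar> \<le> (C + D) * edge_weight e u" if "u \<in> open_cube" for u
    using C[OF that] D[OF that] by (simp add: algebra_simps)
  then show ?thesis by (auto simp: edge_bounded_def)
qed

lemma edge_bounded_mult:
  assumes "edge_bounded e G" "edge_bounded e' H"
  shows "edge_bounded (\<lambda>k. e k + e' k) (\<lambda>u. G u * H u)"
proof -
  obtain C D where C: "\<And>u. u \<in> open_cube \<Longrightarrow> \<bar>G u\<bar> \<le> C * edge_weight e u"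
    and D: "\<And>u. u \<in> open_cube \<Longrightarrow> \<bar>H u\<bar> \<le> D * edge_weight e' u"
    using assms by (auto simp: edge_bounded_def)
  have "\<bar>G u * H u\<bar> \<le> (C * D) * edge_weight (\<lambda>k. e k + e' k) u" if "u \<in> open_cube" for u
  proof -
    have "\<bar>G u * H u\<bar> \<le> (C * edge_weight e u) * (D * edge_weight e' u)"
      unfolding abs_mult
      by (rule mult_mono[OF C[OF that] D[OF that]]) (use C[OF that] in linarith, simp)
    then show ?thesis by (simp add: edge_weight_add mult_ac)
  qed
  then show ?thesis by (auto simp: edge_bounded_def)
qed

lemma edge_bounded_cong:
  "(\<And>u. u \<in> open_cube \<Longrightarrow> G u = H u) \<Longrightarrow> edge_bounded e G \<longleftrightarrow> edge_bounded e H"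
  by (simp add: edge_bounded_def)

text \<open>Quantifying over all orders of differentiation keeps the calculus below free of
  Schwarz's theorem, which enters only in the translation to and from \<open>mixed_deriv\<close> and
  \<open>multi_deriv\<close>. \<open>V\<close> holds the coordinates that may still be
  differentiated.\<close>

definition boundary_growth :: "'d set \<Rightarrow> ('d::finite \<Rightarrow> real) \<Rightarrow> (real^'d \<Rightarrow> real) \<Rightarrow> bool" where
  "boundary_growth V e G \<longleftrightarrow> (\<forall>ks. distinct ks \<longrightarrow> set ks \<subseteq> V \<longrightarrow> cont_partials open_cube ks G \<and>
     edge_bounded (\<lambda>k. e k - (if k \<in> set ks then 1 else 0)) (iter_partial ks G))"

text \<open>Splitting off the innermost derivative, which reduces statements about \<open>boundary_growth\<close> to an
  induction on the set of coordinates.\<close>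

lemma boundary_growth_iff:
  "boundary_growth V e G \<longleftrightarrow> continuous_on open_cube G \<and> edge_bounded e G \<and>
     (\<forall>k\<in>V. (\<forall>x\<in>open_cube. (\<lambda>t. G (x + t *\<^sub>R axis k 1)) field_differentiable (at 0)) \<and>
        boundary_growth (V - {k}) (\<lambda>i. e i - (if i = k then 1 else 0)) (partial_deriv k G))"
  (is "?L \<longleftrightarrow> ?R")
proof
  assume L: ?L
  have "boundary_growth (V - {k}) (\<lambda>i. e i - (if i = k then 1 else 0)) (partial_deriv k G)" if "k \<in> V" for k
    unfolding boundary_growth_def
  proof (intro allI impI)
    fix ks assume ks: "distinct ks" "set ks \<subseteq> V - {k}"
    have "cont_partials open_cube (ks @ [k]) G \<and>
      edge_bounded (\<lambda>i. e i - (if i \<in> set (ks @ [k]) then 1 else 0)) (iter_partial (ks @ [k]) G)"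
      using L ks that unfolding boundary_growth_def by (intro L[unfolded boundary_growth_def, rule_format]) auto
    moreover have "(\<lambda>i. e i - (if i \<in> set (ks @ [k]) then 1 else 0))
       = (\<lambda>i. e i - (if i = k then 1 else 0) - (if i \<in> set ks then 1 else 0))"
      using ks by (auto simp: fun_eq_iff)
    ultimately show "cont_partials open_cube ks (partial_deriv k G) \<and>
      edge_bounded (\<lambda>i. e i - (if i = k then 1 else 0) - (if i \<in> set ks then 1 else 0))
         (iter_partial ks (partial_deriv k G))"
      by (simp add: cont_partials_append iter_partial_append)
  qed
  moreover have "cont_partials open_cube [k] G" if "k \<in> V" for k
    using L that unfolding boundary_growth_def by (metis distinct_singleton empty_set insert_subset list.simps(15) empty_subsetI)
  moreover have "cont_partials open_cube [] G \<and> edge_bounded (\<lambda>k. e k - (if k \<in> set [] then 1 else 0)) (iter_partial [] G)"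
    using L unfolding boundary_growth_def by (metis distinct.simps(1) empty_set empty_subsetI)
  ultimately show ?R by simp
next
  assume R: ?R
  show ?L unfolding boundary_growth_def
  proof (intro allI impI)
    fix ks assume ks: "distinct ks" "set ks \<subseteq> V"
    show "cont_partials open_cube ks G \<and>
      edge_bounded (\<lambda>k. e k - (if k \<in> set ks then 1 else 0)) (iter_partial ks G)"
    proof (cases ks rule: rev_exhaust)
      case Nil
      then show ?thesis using R by simp
    next
      case (snoc js k)
      then have k: "k \<in> V" and js: "distinct js" "set js \<subseteq> V - {k}" using ks by auto
      have *: "boundary_growth (V - {k}) (\<lambda>i. e i - (if i = k then 1 else 0)) (partial_deriv k G)"
        using R k by blast
      have **: "cont_partials open_cube js (partial_deriv k G) \<and>
        edge_bounded (\<lambda>i. e i - (if i = k then 1 else 0) - (if i \<in> set js then 1 else 0))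
         (iter_partial js (partial_deriv k G))"
        using * js unfolding boundary_growth_def by blast
      have "continuous_on open_cube (partial_deriv k G)"
        using * by (auto simp: boundary_growth_def dest: spec[of _ "[]"])
      moreover have "(\<lambda>i. e i - (if i \<in> set (js @ [k]) then 1 else 0))
       = (\<lambda>i. e i - (if i = k then 1 else 0) - (if i \<in> set js then 1 else 0))"
        using js by (auto simp: fun_eq_iff)
      ultimately show ?thesis
        using R k ** by (simp add: snoc cont_partials_append iter_partial_append)
    qed
  qed
qed

lemma boundary_growth_mono:
  assumes "boundary_growth V e G" "V' \<subseteq> V" "\<And>k. e' k \<le> e k"
  shows "boundary_growth V' e' G"
  unfolding boundary_growth_def
proof (intro allI impI conjI)
  fix ks assume ks: "distinct ks" "set ks \<subseteq> V'"
  have *: "cont_partials open_cube ks G \<and>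
     edge_bounded (\<lambda>k. e k - (if k \<in> set ks then 1 else 0)) (iter_partial ks G)"
    using assms(1) order_trans[OF ks(2) assms(2)] ks(1) by (simp add: boundary_growth_def)
  then show "cont_partials open_cube ks G" ..
  show "edge_bounded (\<lambda>k. e' k - (if k \<in> set ks then 1 else 0)) (iter_partial ks G)"
    by (rule edge_bounded_mono[OF conjunct2[OF *]]) (simp add: assms(3))
qed

lemma boundary_growth_cong:
  assumes "\<And>u. u \<in> open_cube \<Longrightarrow> G u = H u" "boundary_growth V e G"
  shows "boundary_growth V e H"
proof -
  have "edge_bounded e' (iter_partial ks H) \<longleftrightarrow> edge_bounded e' (iter_partial ks G)" for e' ks
    by (rule edge_bounded_cong[symmetric]) (rule iter_partial_cong[OF open_open_cube assms(1)])
  moreover have "cont_partials open_cube ks H" if "cont_partials open_cube ks G" for ks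
    using that by (rule cont_partials_cong[OF open_open_cube assms(1), rotated])
  ultimately show ?thesis
    using assms(2) by (simp add: boundary_growth_def)
qed

section \<open>Closure of the growth condition under sums and products\<close>

lemma boundary_growth_const:
  "(\<And>k. e k \<le> 0) \<Longrightarrow> boundary_growth V e (\<lambda>_. c)"
proof (induction "card V" arbitrary: V e c rule: less_induct)
  case less
  have "1 \<le> edge_weight e u" if "u \<in> open_cube" for u
    using edge_weight_antimono[OF that less.prems] edge_weight_0[OF that] by simp
  then have "edge_bounded e (\<lambda>_. c)"
    unfolding edge_bounded_def by (intro exI[of _ "\<bar>c\<bar>"]) (auto simp: mult_le_cancel_left1)
  moreover have "boundary_growth (V - {k}) (\<lambda>i. e i - (if i = k then 1 else 0)) (\<lambda>_. 0)" if "k \<in> V" for k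
    using less.prems that by (intro less.hyps psubset_card_mono) (auto intro: order_trans[OF less.prems])
  moreover have "partial_deriv k (\<lambda>_. c) = (\<lambda>_. 0)" for k :: 'a
    by (simp add: partial_deriv_def fun_eq_iff)
  ultimately show ?case by (subst boundary_growth_iff) simp
qed

lemma boundary_growth_add:
  "boundary_growth V e G \<Longrightarrow> boundary_growth V e H \<Longrightarrow> boundary_growth V e (\<lambda>u. G u + H u)"
proof (induction "card V" arbitrary: V e G H rule: less_induct)
  case less
  note G = less.prems(1)[THEN boundary_growth_iff[THEN iffD1]]
  note H = less.prems(2)[THEN boundary_growth_iff[THEN iffD1]]
  show ?case
  proof (subst boundary_growth_iff, intro conjI ballI)
    fix k assume k: "k \<in> V"
    have "partial_deriv k (\<lambda>u. G u + H u) u = partial_deriv k G u + partial_deriv k H u" if "u \<in> open_cube" for u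
      unfolding partial_deriv_def using G H k that by (intro deriv_add) auto
    moreover have "boundary_growth (V - {k}) (\<lambda>i. e i - (if i = k then 1 else 0)) (\<lambda>u. partial_deriv k G u + partial_deriv k H u)"
      using G H k by (intro less.hyps psubset_card_mono) auto
    ultimately show "boundary_growth (V - {k}) (\<lambda>i. e i - (if i = k then 1 else 0)) (partial_deriv k (\<lambda>u. G u + H u))"
      by (rule_tac boundary_growth_cong) auto
    fix x :: "real^'a" assume "x \<in> open_cube"
    then show "(\<lambda>t. G (x + t *\<^sub>R axis k 1) + H (x + t *\<^sub>R axis k 1)) field_differentiable at 0"
      using G H k by (intro field_differentiable_add) auto
  qed (use G H in \<open>auto intro: continuous_on_add edge_bounded_add\<close>)
qed

text \<open>Leibniz rule: in each of the two terms only the differentiated factor loses one unit of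
  exponent at \<open>k\<close>, so the product loses exactly one unit.\<close>

lemma boundary_growth_mult:
  "boundary_growth V e G \<Longrightarrow> boundary_growth V e' H \<Longrightarrow> boundary_growth V (\<lambda>k. e k + e' k) (\<lambda>u. G u * H u)"
proof (induction "card V" arbitrary: V e e' G H rule: less_induct)
  case less
  note G = less.prems(1)[THEN boundary_growth_iff[THEN iffD1]]
  note H = less.prems(2)[THEN boundary_growth_iff[THEN iffD1]]
  show ?case
  proof (subst boundary_growth_iff, intro conjI ballI)
    fix k assume k: "k \<in> V"
    let ?\<delta> = "\<lambda>i. if i = k then 1 else 0 :: real"
    have eq: "G u * partial_deriv k H u + partial_deriv k G u * H u = partial_deriv k (\<lambda>u. G u * H u) u" if "u \<in> open_cube" for u
      unfolding partial_deriv_def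
      by (subst deriv_mult) (use G H k that in auto)
    have lt: "card (V - {k}) < card V" using k by (intro psubset_card_mono) auto
    have "boundary_growth (V - {k}) (\<lambda>i. e i + (e' i - ?\<delta> i)) (\<lambda>u. G u * partial_deriv k H u)"
      using k H boundary_growth_mono[OF less.prems(1), of "V - {k}" e] by (intro less.hyps lt) auto
    moreover have "boundary_growth (V - {k}) (\<lambda>i. (e i - ?\<delta> i) + e' i) (\<lambda>u. partial_deriv k G u * H u)"
      using k G boundary_growth_mono[OF less.prems(2), of "V - {k}" e'] by (intro less.hyps lt) auto
    ultimately have "boundary_growth (V - {k}) (\<lambda>i. e i + e' i - ?\<delta> i) (\<lambda>u. G u * partial_deriv k H u + partial_deriv k G u * H u)"
      by (intro boundary_growth_add) (simp_all add: algebra_simps)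
    then show "boundary_growth (V - {k}) (\<lambda>i. e i + e' i - ?\<delta> i) (partial_deriv k (\<lambda>u. G u * H u))"
      by (rule boundary_growth_cong[rotated]) (rule eq)
    fix x :: "real^'a" assume "x \<in> open_cube"
    then show "(\<lambda>t. G (x + t *\<^sub>R axis k 1) * H (x + t *\<^sub>R axis k 1)) field_differentiable at 0"
      using G H k by (intro field_differentiable_mult) auto
  qed (use G H in \<open>auto intro: continuous_on_mult edge_bounded_mult\<close>)
qed

text \<open>The condition on \<open>e\<close> serves the empty sum, which is treated as a
  constant.\<close>

lemma boundary_growth_sum:
  assumes "finite I" "\<And>k. e k \<le> 0 \<or> I \<noteq> {}" "\<And>i. i \<in> I \<Longrightarrow> boundary_growth V e (G i)"
  shows "boundary_growth V e (\<lambda>u. \<Sum>i\<in>I. G i u)"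
proof (cases "I = {}")
  case True
  then show ?thesis using assms boundary_growth_const by auto
next
  case False
  show ?thesis using assms(1) False assms(3)
    by (induction rule: finite_ne_induct) (auto intro: boundary_growth_add)
qed

lemma boundary_growth_prod:
  assumes "finite I" "\<And>i. i \<in> I \<Longrightarrow> boundary_growth V (e i) (G i)"
  shows "boundary_growth V (\<lambda>k. \<Sum>i\<in>I. e i k) (\<lambda>u. \<Prod>i\<in>I. G i u)"
  using assms by (induction rule: finite_induct) (auto intro: boundary_growth_const boundary_growth_mult)

text \<open>The order hidden in \<open>mixed_deriv\<close> is some list with the multiset of
  \<open>ks\<close>. All its rearrangements are distinct, so \<open>C_mixed_on\<close> supplies the
  smoothness that Schwarz's theorem asks for.\<close>

lemma mixed_deriv_eq_iter_partial:
  fixes G :: "real^'d::finite \<Rightarrow> real"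
  assumes "open S" "C_mixed_on S G" "distinct ks" "x \<in> S"
  shows "mixed_deriv (set ks) G x = iter_partial ks G x"
proof -
  obtain js where js: "\<forall>k. count_list js k = (if k \<in> set ks then 1 else 0)"
    "mixed_deriv (set ks) G = iter_partial js G"
    unfolding mixed_deriv_def by (rule multi_deriv_witness)
  have m: "mset js = mset ks"
    using js(1) assms(3) by (intro multiset_eqI) (simp add: count_mset distinct_count_atmost_1)
  then have "distinct ls" if "mset ls = mset js" for ls
    using that assms(3) by (metis mset_eq_imp_distinct_iff)
  then have "iter_partial js G x = iter_partial ks G x"
    using m assms by (intro iter_partial_perm[where S = S]) (auto simp: C_mixed_on_def)
  then show ?thesis using js(2) by simp
qed

lemma multi_deriv_eq_iter_partial:
  fixes G :: "real^'d::finite \<Rightarrow> real"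
  assumes "open S" "C_n_on n S G" "length ks \<le> n" "x \<in> S"
  shows "multi_deriv (count_list ks) G x = iter_partial ks G x"
proof -
  obtain js where js: "\<forall>k. count_list js k = count_list ks k"
    "multi_deriv (count_list ks) G = iter_partial js G"
    by (rule multi_deriv_witness)
  have m: "mset js = mset ks"
    using js(1) by (intro multiset_eqI) (simp add: count_mset)
  then have "length ls \<le> n" if "mset ls = mset js" for ls
    using that assms(3) by (metis mset_eq_length)
  then have "iter_partial js G x = iter_partial ks G x"
    using m assms by (intro iter_partial_perm[where S = S]) (auto simp: C_n_on_def)
  then show ?thesis using js(2) by simp
qed

lemma boundary_growth_mixed_derivI:
  assumes "C_mixed_on open_cube G"
    and "\<And>v. edge_bounded (\<lambda>k. e k - (if k \<in> v then 1 else 0)) (mixed_deriv v G)"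
  shows "boundary_growth UNIV e G"
  unfolding boundary_growth_def
proof (intro allI impI conjI)
  fix ks :: "'a list" assume ks: "distinct ks"
  show "cont_partials open_cube ks G" using assms(1) ks by (simp add: C_mixed_on_def)
  show "edge_bounded (\<lambda>k. e k - (if k \<in> set ks then 1 else 0)) (iter_partial ks G)"
    using assms(2)[of "set ks"] mixed_deriv_eq_iter_partial[OF open_open_cube assms(1) ks]
    by (simp add: edge_bounded_def)
qed

lemma boundary_growth_imp_C_mixed_on: "boundary_growth UNIV e G \<Longrightarrow> C_mixed_on open_cube G"
  by (simp add: C_mixed_on_def boundary_growth_def)

lemma boundary_growth_mixed_derivD:
  assumes "boundary_growth UNIV e G"
  shows "\<exists>C>0. \<forall>v. \<forall>u\<in>open_cube.
    \<bar>mixed_deriv v G u\<bar> \<le> C * edge_weight (\<lambda>k. e k - (if k \<in> v then 1 else 0)) u"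
proof -
  have "\<exists>C. \<forall>u\<in>open_cube. \<bar>mixed_deriv v G u\<bar> \<le> C * edge_weight (\<lambda>k. e k - (if k \<in> v then 1 else 0)) u" for v
  proof -
    obtain ks where ks: "set ks = v" "distinct ks" using finite_distinct_list[of v] by auto
    have "edge_bounded (\<lambda>k. e k - (if k \<in> set ks then 1 else 0)) (iter_partial ks G)"
      using assms ks(2) by (simp add: boundary_growth_def)
    then show ?thesis
      using mixed_deriv_eq_iter_partial[OF open_open_cube boundary_growth_imp_C_mixed_on[OF assms] ks(2)] ks(1)
      by (simp add: edge_bounded_def)
  qed
  then obtain C where C: "\<And>v u. u \<in> open_cube \<Longrightarrow>
      \<bar>mixed_deriv v G u\<bar> \<le> C v * edge_weight (\<lambda>k. e k - (if k \<in> v then 1 else 0)) u"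
    by metis
  \<comment> \<open>One constant for all \<open>v\<close>, of which there are finitely many; the
    leading 1 makes it positive.\<close>
  define K where "K = 1 + (\<Sum>v\<in>UNIV. \<bar>C v\<bar>)"
  have "C v \<le> K" for v
  proof -
    have "\<bar>C v\<bar> \<le> (\<Sum>v\<in>UNIV. \<bar>C v\<bar>)" by (rule member_le_sum) auto
    then show ?thesis by (simp add: K_def)
  qed
  then have "\<bar>mixed_deriv v G u\<bar> \<le> K * edge_weight (\<lambda>k. e k - (if k \<in> v then 1 else 0)) u"
    if u: "u \<in> open_cube" for v u
    using C[OF u, of v] edge_weight_pos[OF u] by (meson less_imp_le mult_right_mono order_trans)
  moreover have "K > 0" by (simp add: K_def sum_nonneg add_pos_nonneg)
  ultimately show ?thesis by blast
qed

section \<open>Growth of the factors of the pulled back integrand\<close>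

lemma has_derivative_vec_nth_compose:
  "(g has_derivative g') F \<Longrightarrow> ((\<lambda>x. g x $ j) has_derivative (\<lambda>v. g' v $ j)) F"
  by (rule bounded_linear.has_derivative[OF bounded_linear_vec_nth])

text \<open>Induction on \<open>V\<close> replaces a formula for higher derivatives of a
  composition. One derivative produces a sum of terms
  \<open>iter_partial (j # js) g (\<tau> u)\<close> times an entry of the Jacobian; the first factor
  is again of the form treated, with a longer list and a smaller \<open>V\<close>, so the order
  never exceeds \<open>n\<close>. Half of \<open>\<epsilon>\<close> goes to each factor.\<close>

lemma boundary_growth_compose:
  fixes \<tau> :: "real^'d \<Rightarrow> real^'d::finite" and g :: "real^'d \<Rightarrow> real"
  assumes g: "C_n_on n UNIV g"
    and bd: "\<And>js. length js \<le> n \<Longrightarrow> edge_bounded e (\<lambda>u. iter_partial js g (\<tau> u))"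
    and der: "\<And>u. u \<in> open_cube \<Longrightarrow> (\<tau> has_derivative \<tau>' u) (at u)"
    and part: "\<And>i j B. B > 0 \<Longrightarrow>
      boundary_growth UNIV (\<lambda>k. - B - (if k = i then 1 else 0)) (partial_deriv i (\<lambda>w. \<tau> w $ j))"
  shows "\<epsilon> > 0 \<Longrightarrow> length js + card V \<le> n \<Longrightarrow>
    boundary_growth V (\<lambda>k. e k - \<epsilon>) (\<lambda>u. iter_partial js g (\<tau> u))"
proof (induction "card V" arbitrary: V js \<epsilon> rule: less_induct)
  case less
  let ?G = "\<lambda>u. iter_partial js g (\<tau> u)"
  have "cont_partials UNIV js g" using g less.prems by (simp add: C_n_on_def)
  then have cont: "continuous_on UNIV (iter_partial js g)" by (rule cont_partials_continuous)
  have "continuous_on open_cube \<tau>"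
    using der by (intro has_derivative_continuous_on) (auto intro: has_derivative_at_withinI)
  then have "continuous_on open_cube ?G"
    by (intro continuous_on_compose2[OF cont]) auto
  moreover have "edge_bounded (\<lambda>k. e k - \<epsilon>) ?G"
    by (rule edge_bounded_mono[OF bd]) (use less.prems in auto)
  moreover have "(\<forall>x\<in>open_cube. (\<lambda>t. ?G (x + t *\<^sub>R axis k 1)) field_differentiable (at 0)) \<and>
    boundary_growth (V - {k}) (\<lambda>i. e i - \<epsilon> - (if i = k then 1 else 0)) (partial_deriv k ?G)" if k: "k \<in> V" for k
  proof -
    have lt: "card (V - {k}) < card V" using k by (intro psubset_card_mono) auto
    have "cont_partials UNIV [j] (iter_partial js g)" for j
    proof -
      have "length ([j] @ js) \<le> n" using less.prems lt by simp
      then have "cont_partials UNIV ([j] @ js) g" using g unfolding C_n_on_def by blast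
      then show ?thesis unfolding cont_partials_append ..
    qed
    then have d: "(?G has_derivative (\<lambda>v. \<Sum>j\<in>UNIV. partial_deriv j (iter_partial js g) (\<tau> u) * \<tau>' u v $ j)) (at u)"
      if "u \<in> open_cube" for u
      using diff_chain_at[OF der[OF that] has_derivative_from_partials[of "iter_partial js g"]]
      by (simp add: o_def)
    have "partial_deriv k ?G u = (\<Sum>j\<in>UNIV. iter_partial (j # js) g (\<tau> u) * partial_deriv k (\<lambda>w. \<tau> w $ j) u)"
      if u: "u \<in> open_cube" for u
      using partial_deriv_has_derivative(1)[OF d[OF u]]
        partial_deriv_has_derivative(1)[OF has_derivative_vec_nth_compose[OF der[OF u]]] by simp
    moreover have "boundary_growth (V - {k}) (\<lambda>i. e i - \<epsilon> - (if i = k then 1 else 0))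
      (\<lambda>u. \<Sum>j\<in>UNIV. iter_partial (j # js) g (\<tau> u) * partial_deriv k (\<lambda>w. \<tau> w $ j) u)"
    proof (rule boundary_growth_sum)
      fix j
      have "boundary_growth (V - {k}) (\<lambda>i. e i - \<epsilon> / 2) (\<lambda>u. iter_partial (j # js) g (\<tau> u))"
        using less.prems lt by (intro less.hyps) auto
      moreover have "boundary_growth (V - {k}) (\<lambda>i. - (\<epsilon> / 2) - (if i = k then 1 else 0)) (partial_deriv k (\<lambda>w. \<tau> w $ j))"
        by (rule boundary_growth_mono[OF part[of "\<epsilon> / 2"]]) (use less.prems in auto)
      ultimately have "boundary_growth (V - {k}) (\<lambda>i. (e i - \<epsilon> / 2) + (- (\<epsilon> / 2) - (if i = k then 1 else 0)))
        (\<lambda>u. iter_partial (j # js) g (\<tau> u) * partial_deriv k (\<lambda>w. \<tau> w $ j) u)"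
        by (rule boundary_growth_mult)
      then show "boundary_growth (V - {k}) (\<lambda>i. e i - \<epsilon> - (if i = k then 1 else 0))
        (\<lambda>u. iter_partial (j # js) g (\<tau> u) * partial_deriv k (\<lambda>w. \<tau> w $ j) u)"
        by (rule boundary_growth_mono) auto
    qed auto
    ultimately show ?thesis
      using partial_deriv_has_derivative(2)[OF d] by (auto intro: boundary_growth_cong[rotated])
  qed
  ultimately show ?case by (subst boundary_growth_iff) blast
qed

lemma boundary_growth_det:
  fixes \<tau> :: "real^'d \<Rightarrow> real^'d::finite"
  assumes part: "\<And>i j. boundary_growth UNIV (\<lambda>k. - B - (if k = i then 1 else 0)) (partial_deriv i (\<lambda>w. \<tau> w $ j))"
  shows "boundary_growth UNIV (\<lambda>k. - (real CARD('d) * B) - 1) (\<lambda>u. det (jacobian_matrix \<tau> u))"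
  unfolding det_def
proof (rule boundary_growth_sum)
  fix p :: "'d \<Rightarrow> 'd" assume "p \<in> {p. p permutes UNIV}"
  then have p: "p permutes UNIV" by simp
  have "boundary_growth UNIV (\<lambda>k. \<Sum>i\<in>UNIV. - B - (if k = p i then 1 else 0))
     (\<lambda>u. \<Prod>i\<in>UNIV. partial_deriv (p i) (\<lambda>w. \<tau> w $ i) u)"
    by (intro boundary_growth_prod part) simp
  \<comment> \<open>The bijection \<open>p\<close> takes the value \<open>k\<close> in one row only,
    so the indicators add up to 1, while the losses \<open>B\<close> of all rows accumulate.\<close>
  moreover have "(\<Sum>i\<in>UNIV. - B - (if k = p i then 1 else 0)) = - (real CARD('d) * B) - 1" for k
  proof -
    have "(\<Sum>i\<in>UNIV. if k = p i then 1 else 0 :: real) = (\<Sum>i\<in>UNIV. if k = i then 1 else 0)"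
      by (rule sum.reindex_bij_betw) (rule permutes_bij[OF p])
    then show ?thesis by (simp add: sum_subtractf)
  qed
  ultimately have "boundary_growth UNIV (\<lambda>k. - (real CARD('d) * B) - 1)
     (\<lambda>u. \<Prod>i\<in>UNIV. partial_deriv (p i) (\<lambda>w. \<tau> w $ i) u)" by simp
  from boundary_growth_mult[OF boundary_growth_const[of "\<lambda>_. 0" UNIV "of_int (sign p)"] this]
  show "boundary_growth UNIV (\<lambda>k. - (real CARD('d) * B) - 1)
     (\<lambda>u. of_int (sign p) * (\<Prod>i\<in>UNIV. jacobian_matrix \<tau> u $ i $ p i))"
    by (simp add: jacobian_matrix_def)
next
  show "- (real CARD('d) * B) - 1 \<le> 0 \<or> {p. p permutes (UNIV::'d set)} \<noteq> {}" 
    using permutes_id by blast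
qed (simp add: finite_permutations)

lemma edge_bounded_compose_tails:
  fixes \<tau> :: "real^'d \<Rightarrow> real^'d::finite"
  assumes F: "\<And>x. 0 < F x \<and> F x < 1"
    and tail: "\<forall>k. \<forall>u\<in>open_cube. inverse (min (F (\<tau> u $ k)) (1 - F (\<tau> u $ k))) \<le> C4 * edge_weight (\<lambda>_. - B0) u"
    and B0: "B0 > 0"
    and g: "\<And>B. B > 0 \<Longrightarrow> \<exists>C1>0. \<forall>x. \<bar>g x\<bar> \<le> C1 * (\<Prod>k\<in>UNIV. min (F (x $ k)) (1 - F (x $ k)) powr (- B))"
    and \<delta>: "\<delta> > 0"
  shows "edge_bounded (\<lambda>_. - \<delta>) (\<lambda>u. g (\<tau> u))"
proof -
  let ?d = "real CARD('d)"
  let ?\<rho> = "\<lambda>x. min (F x) (1 - F x)"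
  \<comment> \<open>Each of the \<open>?d\<close> tail factors is bounded by a full weight with
    exponent \<open>- B0 * B\<close>, so their product costs \<open>B0 * B * ?d = \<delta>\<close>
    in every coordinate.\<close>
  define B where "B = \<delta> / (B0 * ?d)"
  have d: "?d > 0" by simp
  have B: "B > 0" using B0 \<delta> by (simp add: B_def)
  obtain C1 where C1: "C1 > 0" "\<And>x. \<bar>g x\<bar> \<le> C1 * (\<Prod>k\<in>UNIV. ?\<rho> (x $ k) powr (- B))"
    using g[OF B] by blast
  have "\<bar>g (\<tau> u)\<bar> \<le> C1 * (\<bar>C4\<bar> powr B) ^ CARD('d) * edge_weight (\<lambda>_. - \<delta>) u" if u: "u \<in> open_cube" for u
  proof -
    have "?\<rho> (\<tau> u $ k) powr (- B) \<le> \<bar>C4\<bar> powr B * edge_weight (\<lambda>_. - B0 * B) u" for k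
    proof -
      have pos: "?\<rho> (\<tau> u $ k) > 0" using F by simp
      have "?\<rho> (\<tau> u $ k) powr (- B) = inverse (?\<rho> (\<tau> u $ k)) powr B"
        using pos by (simp add: powr_minus inverse_powr)
      also have "\<dots> \<le> (\<bar>C4\<bar> * edge_weight (\<lambda>_. - B0) u) powr B"
      proof (rule powr_mono2)
        have "inverse (?\<rho> (\<tau> u $ k)) \<le> C4 * edge_weight (\<lambda>_. - B0) u" using tail u by blast
        also have "\<dots> \<le> \<bar>C4\<bar> * edge_weight (\<lambda>_. - B0) u"
          using edge_weight_pos[OF u, of "\<lambda>_. - B0"] by (intro mult_right_mono) auto
        finally show "inverse (?\<rho> (\<tau> u $ k)) \<le> \<bar>C4\<bar> * edge_weight (\<lambda>_. - B0) u" .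
      qed (use B pos in auto)
      also have "\<dots> = \<bar>C4\<bar> powr B * edge_weight (\<lambda>_. - B0 * B) u"
        using edge_weight_pos[OF u, of "\<lambda>_. - B0"]
        by (simp add: powr_mult edge_weight_powr[OF u])
      finally show ?thesis .
    qed
    then have "(\<Prod>k\<in>UNIV. ?\<rho> (\<tau> u $ k) powr (- B)) \<le> (\<Prod>k\<in>(UNIV::'d set). \<bar>C4\<bar> powr B * edge_weight (\<lambda>_. - B0 * B) u)"
      by (intro prod_mono) auto
    also have "\<dots> = (\<bar>C4\<bar> powr B) ^ CARD('d) * edge_weight (\<lambda>_. - B0 * B) u powr ?d"
      using edge_weight_pos[OF u] by (simp add: power_mult_distrib powr_realpow)
    also have "edge_weight (\<lambda>_. - B0 * B) u powr ?d = edge_weight (\<lambda>_. - \<delta>) u"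
      using B0 by (subst edge_weight_powr[OF u]) (simp add: B_def)
    finally have "C1 * (\<Prod>k\<in>UNIV. ?\<rho> (\<tau> u $ k) powr (- B)) \<le> C1 * ((\<bar>C4\<bar> powr B) ^ CARD('d) * edge_weight (\<lambda>_. - \<delta>) u)"
      using C1(1) by (intro mult_left_mono) auto
    then show ?thesis using C1(2)[of "\<tau> u"] by (simp add: mult.assoc)
  qed
  then show ?thesis by (auto simp: edge_bounded_def)
qed

text \<open>As \<open>edge_dist\<close> is below 1, its logarithm is negative and \<open>far\<close>
  bounds the squared coordinate below by \<open>- C5 * ln\<close> up to \<open>C'\<close>;
  exponentiating turns the Gaussian into a power.\<close>

lemma edge_bounded_compose_gaussian:
  fixes \<tau> :: "real^'d \<Rightarrow> real^'d::finite"
  assumes \<alpha>: "\<alpha> > 0"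
    and far: "\<forall>j. \<forall>u\<in>open_cube. \<bar>\<tau> u $ j\<bar>\<^sup>2 \<ge> C5 * \<bar>ln (edge_dist (u $ j))\<bar> - C'"
    and g: "\<And>x. \<bar>g x\<bar> \<le> C2 * (\<Prod>k\<in>UNIV. exp (- \<alpha> * (x $ k)\<^sup>2))"
    and C2: "C2 > 0"
  shows "edge_bounded (\<lambda>_. \<alpha> * C5) (\<lambda>u. g (\<tau> u))"
proof -
  have "\<bar>g (\<tau> u)\<bar> \<le> C2 * exp (\<alpha> * C') ^ CARD('d) * edge_weight (\<lambda>_. \<alpha> * C5) u" if u: "u \<in> open_cube" for u
  proof -
    have "exp (- \<alpha> * (\<tau> u $ k)\<^sup>2) \<le> exp (\<alpha> * C') * edge_dist (u $ k) powr (\<alpha> * C5)" for k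
    proof -
      note e = edge_dist_bounds[OF u, of k]
      have "C5 * \<bar>ln (edge_dist (u $ k))\<bar> - C' \<le> (\<tau> u $ k)\<^sup>2" using far u by (metis power2_abs)
      then have "\<alpha> * (- C5 * ln (edge_dist (u $ k)) - C') \<le> \<alpha> * (\<tau> u $ k)\<^sup>2"
        using \<alpha> e by (intro mult_left_mono) auto
      then have "exp (- \<alpha> * (\<tau> u $ k)\<^sup>2) \<le> exp (\<alpha> * C' + \<alpha> * C5 * ln (edge_dist (u $ k)))"
        by (simp add: algebra_simps)
      also have "\<dots> = exp (\<alpha> * C') * edge_dist (u $ k) powr (\<alpha> * C5)"
        using e by (simp add: exp_add powr_def)
      finally show ?thesis .
    qed
    then have "(\<Prod>k\<in>UNIV. exp (- \<alpha> * (\<tau> u $ k)\<^sup>2)) \<le> (\<Prod>k\<in>UNIV. exp (\<alpha> * C') * edge_dist (u $ k) powr (\<alpha> * C5))"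
      by (intro prod_mono) auto
    also have "\<dots> = exp (\<alpha> * C') ^ CARD('d) * edge_weight (\<lambda>_. \<alpha> * C5) u"
      by (simp add: prod.distrib edge_weight_def)
    finally have "C2 * (\<Prod>k\<in>UNIV. exp (- \<alpha> * (\<tau> u $ k)\<^sup>2)) \<le> C2 * (exp (\<alpha> * C') ^ CARD('d) * edge_weight (\<lambda>_. \<alpha> * C5) u)"
      using C2 by (intro mult_left_mono) auto
    then show ?thesis using g[of "\<tau> u"] by (simp add: mult.assoc)
  qed
  then show ?thesis by (auto simp: edge_bounded_def)
qed

text \<open>The inverse composed with \<open>\<tau>\<close> is the identity on \<open>S\<close>, so
  by the chain rule the two determinants multiply to 1 and neither can vanish.\<close>

lemma C1_diffeomorphism_derivative:
  fixes \<tau> :: "real^'d \<Rightarrow> real^'d::finite"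
  assumes "C1_diffeomorphism S T \<tau>"
  obtains \<tau>' where "\<And>u. u \<in> S \<Longrightarrow> (\<tau> has_derivative \<tau>' u) (at u)"
    and "\<And>u. u \<in> S \<Longrightarrow> jacobian_matrix \<tau> u = matrix (\<tau>' u)"
    and "\<And>u. u \<in> S \<Longrightarrow> det (jacobian_matrix \<tau> u) \<noteq> 0"
proof -
  obtain g' where g': "\<And>u. u \<in> S \<Longrightarrow> (\<tau> has_derivative blinfun_apply (g' u)) (at u)"
    using assms by (auto simp: C1_diffeomorphism_def C1_on_def)
  obtain h' where h': "\<And>x. x \<in> T \<Longrightarrow> (inv_into S \<tau> has_derivative blinfun_apply (h' x)) (at x)"
    using assms by (auto simp: C1_diffeomorphism_def C1_on_def)
  have bij: "bij_betw \<tau> S T" and S: "open S" using assms by (auto simp: C1_diffeomorphism_def)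
  show ?thesis
  proof (rule that[of "\<lambda>u. blinfun_apply (g' u)"])
    fix u assume u: "u \<in> S"
    show "(\<tau> has_derivative g' u) (at u)" by (rule g'[OF u])
    show jac: "jacobian_matrix \<tau> u = matrix (blinfun_apply (g' u))"
      using partial_deriv_has_derivative(1)[OF has_derivative_vec_nth_compose[OF g'[OF u]]]
      by (simp add: jacobian_matrix_def matrix_def)
    have "\<tau> u \<in> T" using bij u by (auto simp: bij_betw_def)
    then have "(inv_into S \<tau> \<circ> \<tau> has_derivative blinfun_apply (h' (\<tau> u)) \<circ> blinfun_apply (g' u)) (at u)"
      by (intro diff_chain_at g'[OF u] h')
    then have "((\<lambda>x. x) has_derivative blinfun_apply (h' (\<tau> u)) \<circ> blinfun_apply (g' u)) (at u)"
      by (rule has_derivative_transform_within_open[OF _ S u]) (use bij in \<open>auto simp: bij_betw_def\<close>)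
    then have "blinfun_apply (h' (\<tau> u)) \<circ> blinfun_apply (g' u) = (\<lambda>x. x)"
      by (rule has_derivative_unique[OF _ has_derivative_ident])
    then have "matrix (blinfun_apply (h' (\<tau> u))) ** matrix (blinfun_apply (g' u)) = mat 1"
      by (subst matrix_compose[symmetric]) (auto simp: id_def[symmetric] matrix_id_mat_1 blinfun.bounded_linear_right bounded_linear.linear)
    then have "det (matrix (blinfun_apply (h' (\<tau> u)))) * det (matrix (blinfun_apply (g' u))) = 1"
      by (metis det_I det_mul)
    then show "det (jacobian_matrix \<tau> u) \<noteq> 0" unfolding jac by auto
  qed
qed

section \<open>Star discrepancy of nets\<close>

lemma div_eq_iff_less: "b > 0 \<Longrightarrow> (x div b = p) \<longleftrightarrow> b * p \<le> x \<and> x < b * p + b" for x p b :: nat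
  by (metis add.commute div_nat_eqI dividend_less_div_times dividend_less_times_div mult.commute mult_Suc_right times_div_less_eq_dividend)

text \<open>A net whose points have been truncated to \<open>n\<close> digits and scaled by \<open>b ^ n\<close>; its quality
  parameter is \<open>t\<close> and the elementary intervals of volume at least \<open>1 / b ^ M\<close> are hit exactly.\<close>

locale integer_net =
  fixes b n M t :: nat and X :: "nat \<Rightarrow> 'd::finite \<Rightarrow> nat"
  assumes b: "b \<ge> 2" and Mn: "M \<le> n"
    and X_less: "\<And>i k. i < b ^ (M + t) \<Longrightarrow> X i k < b ^ n"
    and exact: "\<And>c a. (\<Sum>k\<in>UNIV. c k) = M \<Longrightarrow> (\<And>k. a k < b ^ c k) \<Longrightarrow>
      card {i. i < b ^ (M + t) \<and> (\<forall>k. X i k div b ^ (n - c k) = a k)} = b ^ t"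
begin

text \<open>Division by \<open>b ^ (n - c k)\<close> reads off the leading \<open>c k\<close>
  digits, so this is the content of an elementary interval.\<close>

definition cell :: "('d \<Rightarrow> nat) \<Rightarrow> ('d \<Rightarrow> nat) \<Rightarrow> nat set" where
  "cell c a = {i. i < b ^ (M + t) \<and> (\<forall>k. X i k div b ^ (n - c k) = a k)}"

lemma finite_cell [simp]: "finite (cell c a)"
  by (simp add: cell_def)

lemma div_refine:
  assumes "Suc c \<le> n"
  shows "x div b ^ (n - c) = x div b ^ (n - Suc c) div b"
proof -
  have "b ^ (n - c) = b ^ (n - Suc c) * b"
    using assms by (metis Suc_diff_le Suc_le_lessD diff_Suc_Suc mult.commute power_Suc)
  then show ?thesis by (simp add: div_mult2_eq)
qed

lemma component_le_sum: "(c :: 'd \<Rightarrow> nat) k \<le> (\<Sum>k\<in>UNIV. c k)"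
  by (rule member_le_sum) auto

lemma sum_upd_Suc: "(\<Sum>j\<in>UNIV. (c(k := Suc (c k))) j) = Suc (\<Sum>j\<in>UNIV. (c :: 'd \<Rightarrow> nat) j)"
proof -
  have "(\<Sum>j\<in>UNIV. (c(k := Suc (c k))) j) = Suc (c k) + (\<Sum>j\<in>UNIV - {k}. c j)"
    by (subst sum.remove[of _ k]) (auto intro: sum.cong)
  also have "\<dots> = Suc (\<Sum>j\<in>UNIV. c j)" by (subst (2) sum.remove[of _ k]) auto
  finally show ?thesis .
qed

text \<open>Exactness at volume \<open>1 / b ^ M\<close> passes to larger intervals, each being the
  disjoint union of its \<open>b\<close> children in one coordinate; \<open>q\<close> counts the
  refinements left.\<close>

lemma card_cell:
  "(\<Sum>k\<in>UNIV. c k) + q = M \<Longrightarrow> (\<And>k. a k < b ^ c k) \<Longrightarrow> card (cell c a) = b ^ (t + q)"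
proof (induction q arbitrary: c a)
  case 0
  then show ?case using exact[of c a] by (simp add: cell_def)
next
  case (Suc q)
  \<comment> \<open>Any coordinate may be the one that is refined.\<close>
  define k :: 'd where "k = undefined"
  let ?c = "c(k := Suc (c k))"
  have n: "Suc (c k) \<le> n" using component_le_sum[of c k] Suc.prems(1) Mn by simp
  have "cell c a = (\<Union>r\<in>{b * a k..<b * a k + b}. cell ?c (a(k := r)))" (is "_ = ?U")
  proof (intro equalityI subsetI)
    fix i assume i: "i \<in> cell c a"
    then have "X i k div b ^ (n - Suc (c k)) div b = a k"
      by (simp add: cell_def div_refine[OF n, symmetric])
    then have "X i k div b ^ (n - Suc (c k)) \<in> {b * a k..<b * a k + b}"
      using b by (subst (asm) div_eq_iff_less) auto
    then show "i \<in> ?U" using i by (intro UN_I) (auto simp: cell_def)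
  next
    fix i assume "i \<in> ?U"
    then obtain r where r: "b * a k \<le> r" "r < b * a k + b" "i \<in> cell ?c (a(k := r))" by auto
    have "r div b = a k" using r b by (subst div_eq_iff_less) auto
    then have "X i k div b ^ (n - c k) = a k"
      using r(3) by (auto simp: cell_def div_refine[OF n] dest: spec[of _ k])
    moreover have "X i j div b ^ (n - c j) = a j" if "j \<noteq> k" for j
      using r(3) that by (auto simp: cell_def dest: spec[of _ j])
    ultimately have "X i j div b ^ (n - c j) = a j" for j by (cases "j = k") auto
    then show "i \<in> cell c a" using r(3) by (simp add: cell_def)
  qed
  moreover have "card ?U = (\<Sum>r\<in>{b * a k..<b * a k + b}. card (cell ?c (a(k := r))))"
    by (rule card_UN_disjoint) (auto simp: cell_def dest: spec[of _ k])
  moreover have "card (cell ?c (a(k := r))) = b ^ (t + q)" if "r \<in> {b * a k..<b * a k + b}" for r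
  proof (rule Suc.IH)
    show "(\<Sum>k\<in>UNIV. ?c k) + q = M" using Suc.prems(1) unfolding sum_upd_Suc by simp
    have "r < b * (a k + 1)" using that by simp
    also have "\<dots> \<le> b * b ^ c k" using Suc.prems(2)[of k] by (intro mult_left_mono) auto
    finally show "(a(k := r)) j < b ^ ?c j" for j using Suc.prems(2)[of j] by auto
  qed
  ultimately show ?case by simp
qed

text \<open>Interpolates between a full cell (\<open>S\<close> empty) and an upper orthant
  (\<open>S = UNIV\<close>, no digit fixed); the discrepancy estimate recurses from the latter to
  the former.\<close>

definition part :: "('d \<Rightarrow> nat) \<Rightarrow> ('d \<Rightarrow> nat) \<Rightarrow> ('d \<Rightarrow> nat) \<Rightarrow> 'd set \<Rightarrow> nat set" where
  "part y c a S = {i \<in> cell c a. \<forall>k\<in>S. y k \<le> X i k}"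

text \<open>The length of what lies at or above \<open>y / b ^ n\<close> in the interval of length
  \<open>1 / b ^ c\<close> containing that point.\<close>

definition tail_fraction :: "nat \<Rightarrow> nat \<Rightarrow> real" where
  "tail_fraction c y = ((real (y div b ^ (n - c)) + 1) * b ^ (n - c) - y) / b ^ n"

definition part_volume :: "('d \<Rightarrow> nat) \<Rightarrow> ('d \<Rightarrow> nat) \<Rightarrow> 'd set \<Rightarrow> real" where
  "part_volume y c S = (\<Prod>k\<in>UNIV. if k \<in> S then tail_fraction (c k) (y k) else 1 / b ^ c k)"

lemma tail_fraction_bounds:
  assumes "c \<le> n"
  shows "0 \<le> tail_fraction c y" "tail_fraction c y \<le> 1 / b ^ c"
proof -
  let ?B = "b ^ (n - c)"
  have "?B > 0" using b by simp
  then have "y < (y div ?B + 1) * ?B" by (metis Suc_eq_plus1 dividend_less_div_times mult.commute mult_Suc_right add.commute)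
  then have "real y \<le> real ((y div ?B + 1) * ?B)" by (intro of_nat_mono) simp
  then show "0 \<le> tail_fraction c y" by (simp add: tail_fraction_def algebra_simps)
  have "(y div ?B) * ?B \<le> y" by simp
  then have "real ((y div ?B) * ?B) \<le> real y" by (intro of_nat_mono)
  then have "(real (y div ?B) + 1) * ?B - y \<le> ?B" by (simp add: algebra_simps)
  then have "tail_fraction c y \<le> real ?B / b ^ n" unfolding tail_fraction_def by (intro divide_right_mono) auto
  also have "real (b ^ n) = real ?B * real (b ^ c)"
    using assms by (simp flip: power_add of_nat_mult)
  also have "real ?B / (real ?B * real (b ^ c)) = 1 / b ^ c" using b by simp
  finally show "tail_fraction c y \<le> 1 / b ^ c" .
qed

text \<open>Outer induction on the constrained coordinates, inner one on the refinements left.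
  Refining in coordinate \<open>k\<close> leaves one child that \<open>y\<close> still cuts and at
  most \<open>b\<close> children lying entirely above it. The latter are free in \<open>k\<close>,
  so each costs an error from the outer induction; the former goes to the inner one.\<close>

lemma discrepancy_part:
  fixes y :: "'d \<Rightarrow> nat" and S :: "'d set"
  shows "(\<Sum>k\<in>UNIV. c k) \<le> M \<Longrightarrow> (\<And>k. a k < b ^ c k) \<Longrightarrow> (\<And>k. k \<in> S \<Longrightarrow> a k = y k div b ^ (n - c k)) \<Longrightarrow>
    \<bar>real (card (part y c a S)) / b ^ (M + t) - part_volume y c S\<bar> \<le> (real b * M + 1) ^ card S / b ^ M"
  using finite[of S]
proof (induction S arbitrary: c a)
  case empty
  obtain q where q: "sum c UNIV + q = M" using empty(1) by (metis le_Suc_ex)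
  have "card (part y c a {}) = b ^ (t + q)"
    using empty q card_cell[of c q a] by (simp add: part_def)
  moreover have "part_volume y c {} = 1 / b ^ sum c UNIV"
    by (simp add: part_volume_def prod_dividef power_sum)
  ultimately have "real (card (part y c a {})) / b ^ (M + t) = part_volume y c {}"
  proof -
    have "real (b ^ (M + t)) = real (b ^ sum c UNIV) * real (b ^ (t + q))"
      by (simp add: q[symmetric] power_add)
    then show ?thesis
      using b \<open>card (part y c a {}) = b ^ (t + q)\<close> \<open>part_volume y c {} = 1 / b ^ sum c UNIV\<close> by simp
  qed
  then show ?case by simp
next
  case (insert k S)
  define K where "K = (real b * M + 1) ^ card S"
  have K: "K \<ge> 0" by (simp add: K_def)
  have "\<bar>real (card (part y c a (insert k S))) / b ^ (M + t) - part_volume y c (insert k S)\<bar> \<le> (q * b * K + 1) / b ^ M"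
    if "(\<Sum>k\<in>UNIV. c k) + q = M" "\<And>k. a k < b ^ c k" "\<And>j. j \<in> insert k S \<Longrightarrow> a j = y j div b ^ (n - c j)" for q c a
    using that
  proof (induction q arbitrary: c a)
    case 0
    \<comment> \<open>With no refinement left, the proportion of points and the volume both lie
      between 0 and \<open>1 / b ^ M\<close>, hence so does their distance.\<close>
    have "card (part y c a (insert k S)) \<le> card (cell c a)" by (intro card_mono) (auto simp: part_def)
    also have "\<dots> = b ^ t" using card_cell[of c 0 a] 0 by simp
    finally have "real (card (part y c a (insert k S))) \<le> real (b ^ t)" by (rule of_nat_mono)
    then have "real (card (part y c a (insert k S))) / b ^ (M + t) \<le> real (b ^ t) / b ^ (M + t)"
      by (intro divide_right_mono) auto
    also have "\<dots> = 1 / b ^ M" using b by (simp add: power_add)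
    finally have 1: "real (card (part y c a (insert k S))) / b ^ (M + t) \<le> 1 / b ^ M" .
    have cn: "c j \<le> n" for j using component_le_sum[of c j] 0(1) Mn by simp
    have "part_volume y c (insert k S) \<le> (\<Prod>j\<in>UNIV. 1 / b ^ c j)"
      unfolding part_volume_def using tail_fraction_bounds[OF cn] by (intro prod_mono) auto
    also have "\<dots> = 1 / b ^ M" using 0(1) by (simp add: prod_dividef flip: power_sum)
    finally have 2: "part_volume y c (insert k S) \<le> 1 / b ^ M" .
    have 3: "0 \<le> part_volume y c (insert k S)"
      unfolding part_volume_def using tail_fraction_bounds[OF cn] by (intro prod_nonneg) auto
    have 4: "0 \<le> real (card (part y c a (insert k S))) / b ^ (M + t)" by simp
    have "\<bar>real (card (part y c a (insert k S))) / b ^ (M + t) - part_volume y c (insert k S)\<bar> \<le> 1 / b ^ M"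
      using 1 2 3 4 by linarith
    then show ?case by simp
  next
    case (Suc q)
    let ?c = "c(k := Suc (c k))"
    define p where "p = a k"
    define p' where "p' = y k div b ^ (n - Suc (c k))"
    \<comment> \<open>Children strictly above the child \<open>p'\<close> that contains
      \<open>y k\<close>: the constraint on \<open>k\<close> holds throughout them, so
      \<open>k\<close> leaves the constrained set.\<close>
    define R where "R = {p'<..<b * p + b}"
    have n: "Suc (c k) \<le> n" using component_le_sum[of c k] Suc.prems(1) Mn by simp
    have p: "p = y k div b ^ (n - c k)" using Suc.prems(3)[of k] by (simp add: p_def)
    have "p' div b = p" by (simp add: p p'_def div_refine[OF n])
    then have p'p: "b * p \<le> p'" "p' < b * p + b" using b by (auto simp: div_eq_iff_less)
    have cardR: "real (card R) = real b * p + b - 1 - p'"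
      using p'p by (simp add: R_def of_nat_diff algebra_simps)
    have cardRb: "card R \<le> b" using p'p by (simp add: R_def)
    let ?P = "part y ?c (a(k := p')) (insert k S)"
    let ?U = "\<Union>r\<in>R. part y ?c (a(k := r)) S"
    have "part y c a (insert k S) = ?P \<union> ?U"
    proof (intro equalityI subsetI)
      fix i assume i: "i \<in> part y c a (insert k S)"
      let ?x = "X i k div b ^ (n - Suc (c k))"
      have "?x div b = p"
        using i by (auto simp: cell_def part_def p_def div_refine[OF n, symmetric])
      then have 1: "b * p \<le> ?x" "?x < b * p + b"
        using b by (auto simp: div_eq_iff_less)
      have 2: "p' \<le> ?x" unfolding p'_def using i by (intro div_le_mono) (auto simp: part_def)
      show "i \<in> ?P \<union> ?U"
      proof (cases "?x = p'")
        case True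
        then have "i \<in> ?P" using i by (auto simp: part_def cell_def)
        then show ?thesis ..
      next
        case False
        then have "?x \<in> R" using 1 2 by (auto simp: R_def)
        moreover have "i \<in> part y ?c (a(k := ?x)) S" using i by (auto simp: part_def cell_def)
        ultimately show ?thesis by blast
      qed
    next
      fix i assume "i \<in> ?P \<union> ?U"
      then obtain r where r: "r \<in> insert p' R" "i \<in> cell ?c (a(k := r))" "\<forall>k\<in>S. y k \<le> X i k" "r \<in> R \<or> y k \<le> X i k"
        by (auto simp: part_def)
      have "r div b = p" using r(1) b p'p by (subst div_eq_iff_less) (auto simp: R_def)
      then have "X i k div b ^ (n - c k) = a k"
        using r(2) by (auto simp: cell_def p_def div_refine[OF n] dest: spec[of _ k])
      moreover have "X i j div b ^ (n - c j) = a j" if "j \<noteq> k" for j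
        using r(2) that by (auto simp: cell_def dest: spec[of _ j])
      moreover have "y k \<le> X i k"
      proof (rule ccontr)
        assume "\<not> y k \<le> X i k"
        then have "X i k div b ^ (n - Suc (c k)) \<le> p'" unfolding p'_def by (intro div_le_mono) simp
        moreover have "X i k div b ^ (n - Suc (c k)) = r" using r(2) by (auto simp: cell_def dest: spec[of _ k])
        ultimately show False using r(4) \<open>\<not> y k \<le> X i k\<close> by (auto simp: R_def)
      qed
      ultimately have "X i j div b ^ (n - c j) = a j" "y k \<le> X i k" for j by (cases "j = k"; auto)+
      then show "i \<in> part y c a (insert k S)" using r by (simp add: part_def cell_def)
    qed
    moreover have "card (?P \<union> ?U) = card ?P + card ?U"
      by (rule card_Un_disjoint) (auto simp: R_def part_def cell_def dest: spec[of _ k])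
    moreover have "card ?U = (\<Sum>r\<in>R. card (part y ?c (a(k := r)) S))"
      by (rule card_UN_disjoint) (auto simp: R_def part_def cell_def dest: spec[of _ k])
    ultimately have card: "real (card (part y c a (insert k S))) = real (card ?P) + (\<Sum>r\<in>R. real (card (part y ?c (a(k := r)) S)))"
      by simp
    have rest: "(\<Prod>j\<in>UNIV - {k}. if j \<in> T then tail_fraction (?c j) (y j) else 1 / b ^ ?c j)
      = (\<Prod>j\<in>UNIV - {k}. if j \<in> S then tail_fraction (c j) (y j) else 1 / b ^ c j)" if "T - {k} = S - {k}" for T
      using that by (intro prod.cong) auto
    have tail: "tail_fraction (c k) (y k) = tail_fraction (Suc (c k)) (y k) + card R * (1 / b ^ Suc (c k))"
    proof -
      let ?B = "real b ^ (n - Suc (c k))"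
      have B: "real b ^ (n - c k) = b * ?B" using n by (metis Suc_diff_le Suc_le_lessD diff_Suc_Suc power_Suc)
      have Bn: "?B / b ^ n = 1 / b ^ Suc (c k)"
        using n b by (simp add: power_diff field_simps)
      have "tail_fraction (c k) (y k) - tail_fraction (Suc (c k)) (y k)
        = ((real p + 1) * (b * ?B) - (real p' + 1) * ?B) / b ^ n"
        unfolding tail_fraction_def p[symmetric] p'_def[symmetric] of_nat_power B diff_divide_distrib[symmetric] by simp
      also have "\<dots> = (real b * p + b - 1 - p') * (?B / b ^ n)" by (simp add: algebra_simps)
      finally show ?thesis unfolding cardR Bn by simp
    qed
    have vol: "part_volume y c (insert k S) = part_volume y ?c (insert k S) + card R * part_volume y ?c S"
      unfolding part_volume_def using insert.hyps
      by (simp add: prod.remove[of UNIV k] rest tail algebra_simps)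
    have a_less: "(a(k := r)) j < b ^ ?c j" if "r \<in> insert p' R" for r j
    proof (cases "j = k")
      case True
      have "r < b * (p + 1)" using that p'p by (auto simp: R_def)
      also have "\<dots> \<le> b * b ^ c k" using Suc.prems(2)[of k] by (intro mult_left_mono) (auto simp: p_def)
      finally show ?thesis using True by simp
    qed (use Suc.prems(2) in auto)
    have sumc: "sum ?c UNIV = Suc (sum c UNIV)" by (rule sum_upd_Suc)
    have e1: "\<bar>real (card ?P) / b ^ (M + t) - part_volume y ?c (insert k S)\<bar> \<le> (q * b * K + 1) / b ^ M"
      using sumc Suc.prems a_less insert.hyps by (intro Suc.IH) (auto simp: p'_def)
    have e2: "\<bar>real (card (part y ?c (a(k := r)) S)) / b ^ (M + t) - part_volume y ?c S\<bar> \<le> K / b ^ M" if "r \<in> R" for r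
      unfolding K_def using sumc Suc.prems a_less insert.hyps that
      by (intro insert.IH) auto
    have "\<bar>(\<Sum>r\<in>R. real (card (part y ?c (a(k := r)) S)) / b ^ (M + t) - part_volume y ?c S)\<bar> \<le> (\<Sum>r\<in>R. K / b ^ M)"
      by (rule order_trans[OF sum_abs sum_mono]) (rule e2)
    also have "\<dots> \<le> b * K / b ^ M" using cardRb K by (simp add: mult_right_mono divide_right_mono)
    finally have e3: "\<bar>(\<Sum>r\<in>R. real (card (part y ?c (a(k := r)) S)) / b ^ (M + t) - part_volume y ?c S)\<bar> \<le> b * K / b ^ M" .
    have "real (card (part y c a (insert k S))) / b ^ (M + t) - part_volume y c (insert k S)
      = (real (card ?P) / b ^ (M + t) - part_volume y ?c (insert k S))
       + (\<Sum>r\<in>R. real (card (part y ?c (a(k := r)) S)) / b ^ (M + t) - part_volume y ?c S)"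
      unfolding card vol by (simp add: add_divide_distrib sum_divide_distrib sum_subtractf)
    then have "\<bar>real (card (part y c a (insert k S))) / b ^ (M + t) - part_volume y c (insert k S)\<bar>
      \<le> (q * b * K + 1) / b ^ M + b * K / b ^ M"
      using e1 e3 by linarith
    also have "\<dots> = (Suc q * b * K + 1) / b ^ M" by (simp add: add_divide_distrib[symmetric] algebra_simps)
    finally show ?case .
  qed
  from this[of c "M - sum c UNIV" a] insert.prems
  have "\<bar>real (card (part y c a (insert k S))) / b ^ (M + t) - part_volume y c (insert k S)\<bar>
     \<le> (real (M - sum c UNIV) * b * K + 1) / b ^ M" by simp
  also have "\<dots> \<le> (real b * M + 1) ^ card (insert k S) / b ^ M"
  proof (rule divide_right_mono)
    \<comment> \<open>This lets the trailing 1 be absorbed into the additional factor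
      \<open>real b * M + 1\<close>.\<close>
    have "K \<ge> 1" unfolding K_def by (intro one_le_power) simp
    moreover have "real (M - sum c UNIV) * b * K \<le> real M * b * K"
      using K by (intro mult_right_mono) auto
    moreover have "(real b * M + 1) * K = real M * b * K + K" by (simp add: algebra_simps)
    ultimately have "real (M - sum c UNIV) * b * K + 1 \<le> (real b * M + 1) * K" by linarith
    then show "real (M - sum c UNIV) * b * K + 1 \<le> (real b * M + 1) ^ card (insert k S)"
      using insert.hyps by (simp add: K_def)
  qed simp
  finally show ?case .
qed

text \<open>The recursion starts from the whole cube: no digit is fixed and all \<open>M\<close>
  refinements are available.\<close>

lemma star_discrepancy:
  assumes "\<And>k. y k < b ^ n"
  shows "\<bar>real (card {i. i < b ^ (M + t) \<and> (\<forall>k. y k \<le> X i k)}) / b ^ (M + t)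
     - (\<Prod>k\<in>UNIV. (real (b ^ n) - y k) / b ^ n)\<bar> \<le> (real b * M + 1) ^ CARD('d) / b ^ M"
proof -
  have "part y (\<lambda>_. 0) (\<lambda>_. 0) UNIV = {i. i < b ^ (M + t) \<and> (\<forall>k. y k \<le> X i k)}"
    using X_less by (auto simp: part_def cell_def)
  moreover have "part_volume y (\<lambda>_. 0) UNIV = (\<Prod>k\<in>UNIV. (real (b ^ n) - y k) / b ^ n)"
    using assms by (simp add: part_volume_def tail_fraction_def)
  moreover have "\<bar>real (card (part y (\<lambda>_. 0) (\<lambda>_. 0) UNIV)) / b ^ (M + t) - part_volume y (\<lambda>_. 0) UNIV\<bar>
     \<le> (real b * M + 1) ^ CARD('d) / b ^ M"
    using assms by (intro discrepancy_part) auto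
  ultimately show ?thesis by simp
qed

end

section \<open>Nested scrambling of nets\<close>

primrec scramble_int :: "nat \<Rightarrow> (nat list \<Rightarrow> nat \<Rightarrow> nat) \<Rightarrow> real \<Rightarrow> nat \<Rightarrow> nat" where
  "scramble_int b \<sigma> x 0 = 0"
| "scramble_int b \<sigma> x (Suc n) = b * scramble_int b \<sigma> x n + \<sigma> (map (digit b x) [0..<n]) (digit b x n)"

text \<open>The only property kept from a realisation of the scrambling. Every outcome in the sample
  space has it, so the error bound needs no exceptional null set.\<close>

definition digit_permutations :: "nat \<Rightarrow> (nat list \<Rightarrow> nat \<Rightarrow> nat) \<Rightarrow> bool" where
  "digit_permutations b \<sigma> \<longleftrightarrow> (\<forall>p\<in>lists {..<b}. \<sigma> p permutes {..<b})"

lemma digit_less: "b > 0 \<Longrightarrow> digit b x l < b"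
  by (simp add: digit_def)

lemma digits_in_lists: "b > 0 \<Longrightarrow> map (digit b x) [0..<l] \<in> lists {..<b}"
  by (auto simp: digit_less)

lemma scrambled_digit_less:
  assumes "b > 0" "digit_permutations b \<sigma>"
  shows "\<sigma> (map (digit b x) [0..<l]) (digit b x l) < b"
proof -
  have "\<sigma> (map (digit b x) [0..<l]) permutes {..<b}"
    using assms digits_in_lists by (simp only: digit_permutations_def)
  from permutes_in_image[OF this, of "digit b x l"] show ?thesis using digit_less[OF assms(1)] by simp
qed

lemma scramble_int_less:
  assumes "b > 0" "digit_permutations b \<sigma>"
  shows "scramble_int b \<sigma> x n < b ^ n"
proof (induction n)
  case (Suc n)
  have "scramble_int b \<sigma> x (Suc n) < b * (scramble_int b \<sigma> x n + 1)"
    using scrambled_digit_less[OF assms] by simp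
  also have "\<dots> \<le> b * b ^ n" using Suc by (intro mult_left_mono) auto
  finally show ?case by simp
qed simp

lemma scramble_int_div:
  assumes "b > 0" "digit_permutations b \<sigma>" "c \<le> n"
  shows "scramble_int b \<sigma> x n div b ^ (n - c) = scramble_int b \<sigma> x c"
  using assms(3)
proof (induction n rule: dec_induct)
  case (step n)
  have "scramble_int b \<sigma> x (Suc n) div b ^ (Suc n - c) = scramble_int b \<sigma> x (Suc n) div b div b ^ (n - c)"
    using step by (simp add: Suc_diff_le div_mult2_eq)
  also have "scramble_int b \<sigma> x (Suc n) div b = scramble_int b \<sigma> x n"
    using assms(1) scrambled_digit_less[OF assms(1,2)] by simp
  finally show ?case using step by simp
qed simp

lemma scramble_int_eq_sum:
  "b > 0 \<Longrightarrow> real (scramble_int b \<sigma> x n) / real b ^ n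
    = (\<Sum>l<n. real (\<sigma> (map (digit b x) [0..<l]) (digit b x l)) / real b ^ Suc l)"
  by (induction n) (simp_all add: add_divide_distrib)

lemma scramble_int_tendsto:
  assumes "b \<ge> 2" "digit_permutations b \<sigma>"
  shows "(\<lambda>n. real (scramble_int b \<sigma> x n) / real b ^ n) \<longlonglongrightarrow> scramble_coord b \<sigma> x"
proof -
  have b: "b > 0" using assms by simp
  have "summable (\<lambda>l. (1 / real b) ^ l)" using assms by (intro summable_geometric) simp
  then have "summable (\<lambda>l. real (\<sigma> (map (digit b x) [0..<l]) (digit b x l)) / real b ^ Suc l)"
  proof (rule summable_comparison_test'[where N = 0])
    fix l
    have "real (\<sigma> (map (digit b x) [0..<l]) (digit b x l)) / real b ^ Suc l \<le> real b / real b ^ Suc l"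
      using scrambled_digit_less[OF b assms(2)] by (intro divide_right_mono) (auto intro: less_imp_le)
    then show "norm (real (\<sigma> (map (digit b x) [0..<l]) (digit b x l)) / real b ^ Suc l) \<le> (1 / real b) ^ l"
      using b by (simp add: power_divide)
  qed
  from summable_LIMSEQ[OF this] show ?thesis
    by (simp add: scramble_int_eq_sum[OF b] scramble_coord_def del: power_Suc)
qed

lemma nat_floor_Suc:
  assumes "b > 0" "x \<ge> 0"
  shows "nat \<lfloor>x * real b ^ Suc c\<rfloor> = b * nat \<lfloor>x * real b ^ c\<rfloor> + digit b x c"
proof -
  have "\<lfloor>x * real b ^ c\<rfloor> = \<lfloor>x * real b ^ Suc c / of_int (int b)\<rfloor>" using assms by simp
  also have "\<dots> = \<lfloor>x * real b ^ Suc c\<rfloor> div int b" by (rule floor_divide_real_eq_div) simp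
  finally have "nat \<lfloor>x * real b ^ c\<rfloor> = nat \<lfloor>x * real b ^ Suc c\<rfloor> div b"
    using assms by (simp add: nat_div_distrib)
  then show ?thesis by (simp add: digit_def)
qed

text \<open>Scrambling permutes the intervals given by \<open>c\<close> leading digits. The common
  digit prefix \<open>L\<close> is carried through the induction because the permutation of the next
  digit depends on it.\<close>

lemma scramble_int_preimage:
  assumes "b > 0" "digit_permutations b \<sigma>"
  shows "A < b ^ c \<Longrightarrow> \<exists>p<b ^ c. \<exists>L\<in>lists {..<b}. \<forall>x\<in>{0..<1}.
    (scramble_int b \<sigma> x c = A \<longleftrightarrow> nat \<lfloor>x * real b ^ c\<rfloor> = p) \<and>
    (nat \<lfloor>x * real b ^ c\<rfloor> = p \<longrightarrow> map (digit b x) [0..<c] = L)"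
proof (induction c arbitrary: A)
  case 0
  have "nat \<lfloor>x\<rfloor> = 0" if "x \<in> {0..<1}" for x :: real using that by simp
  then show ?case using 0 by (intro exI[of _ 0]) auto
next
  case (Suc c)
  have "A div b < b ^ c" using Suc.prems assms by (simp add: less_mult_imp_div_less mult.commute)
  from Suc.IH[OF this] obtain p L where pL: "p < b ^ c" "L \<in> lists {..<b}"
    "\<And>x. x \<in> {0..<1} \<Longrightarrow> scramble_int b \<sigma> x c = A div b \<longleftrightarrow> nat \<lfloor>x * real b ^ c\<rfloor> = p"
    "\<And>x. x \<in> {0..<1} \<Longrightarrow> nat \<lfloor>x * real b ^ c\<rfloor> = p \<Longrightarrow> map (digit b x) [0..<c] = L"
    by blast
  have L: "\<sigma> L permutes {..<b}" using assms pL by (simp only: digit_permutations_def)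
  \<comment> \<open>The original digit that the permutation at prefix \<open>L\<close> sends to the
    last digit of \<open>A\<close>.\<close>
  define s where "s = inv (\<sigma> L) (A mod b)"
  have s: "s < b" using permutes_in_image[OF permutes_inv[OF L], of "A mod b"] assms by (simp add: s_def)
  have s_iff: "\<sigma> L d = A mod b \<longleftrightarrow> d = s" for d
    using permutes_inv_eq[OF L, of "A mod b" d] by (auto simp: s_def)
  have split: "b * u + v = b * u' + v' \<longleftrightarrow> u = u' \<and> v = v'" if "v < b" "v' < b" for u v u' v'
    using that assms(1)
    by (metis add.commute add_left_cancel div_mult_self2 div_less add_0 less_numeral_extra(3))
  have A: "A = b * (A div b) + A mod b" by simp
  show ?case
  proof (intro exI[of _ "b * p + s"] conjI bexI[of _ "L @ [s]"] ballI)
    have "b * p + s < b * (p + 1)" using s by simp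
    also have "\<dots> \<le> b * b ^ c" using pL by (intro mult_left_mono) auto
    finally show "b * p + s < b ^ Suc c" by simp
    show "L @ [s] \<in> lists {..<b}" using pL s by simp
    fix x :: real assume x: "x \<in> {0..<1}"
    note d = digit_less[OF assms(1), of x c]
    have fl: "nat \<lfloor>x * real b ^ Suc c\<rfloor> = b * p + s \<longleftrightarrow> nat \<lfloor>x * real b ^ c\<rfloor> = p \<and> digit b x c = s"
      using x by (subst nat_floor_Suc[OF assms(1)]) (auto simp: split[OF d s])
    have "scramble_int b \<sigma> x (Suc c) = A \<longleftrightarrow> scramble_int b \<sigma> x c = A div b \<and>
        \<sigma> (map (digit b x) [0..<c]) (digit b x c) = A mod b"
      using split[OF scrambled_digit_less[OF assms] mod_less_divisor[OF assms(1)],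
          of "scramble_int b \<sigma> x c" x c "A div b" A] A by simp
    also have "\<dots> \<longleftrightarrow> nat \<lfloor>x * real b ^ c\<rfloor> = p \<and> digit b x c = s"
      using pL(3)[OF x] pL(4)[OF x] s_iff by auto
    finally show "scramble_int b \<sigma> x (Suc c) = A \<longleftrightarrow> nat \<lfloor>x * real b ^ Suc c\<rfloor> = b * p + s"
      using fl by simp
    show "nat \<lfloor>x * real b ^ Suc c\<rfloor> = b * p + s \<longrightarrow> map (digit b x) [0..<Suc c] = L @ [s]"
      using fl pL(4)[OF x] by simp
  qed
qed

lemma nat_floor_eq_iff:
  assumes "b > 0" "x \<ge> 0"
  shows "nat \<lfloor>x * real b ^ c\<rfloor> = a \<longleftrightarrow> real a / real b ^ c \<le> x \<and> x < (real a + 1) / real b ^ c"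
proof -
  have "nat \<lfloor>x * real b ^ c\<rfloor> = a \<longleftrightarrow> \<lfloor>x * real b ^ c\<rfloor> = int a" using assms by auto
  also have "\<dots> \<longleftrightarrow> real a \<le> x * real b ^ c \<and> x * real b ^ c < real a + 1"
    by (simp add: floor_eq_iff)
  also have "\<dots> \<longleftrightarrow> real a / real b ^ c \<le> x \<and> x < (real a + 1) / real b ^ c"
    using assms by (simp add: field_simps)
  finally show ?thesis .
qed

text \<open>Coordinatewise, the preimage of an elementary interval is an elementary interval of the
  same shape \<open>c\<close>, so the counts of the original net carry over. Truncation to
  \<open>n\<close> digits is harmless since \<open>c k \<le> n\<close>.\<close>

lemma integer_net_scramble:
  fixes P :: "nat \<Rightarrow> real^'d::finite"
  assumes b: "b \<ge> 2" and net: "tms_net b t m P" and \<sigma>: "\<And>k. digit_permutations b (\<sigma> k)" and n: "m \<le> n"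
  shows "integer_net b n (m - t) t (\<lambda>i k. scramble_int b (\<sigma> k) (P i $ k) n)"
proof
  show "2 \<le> b" by (rule b)
  show "m - t \<le> n" using n by simp
  have b0: "b > 0" using b by simp
  show "scramble_int b (\<sigma> k) (P i $ k) n < b ^ n" for i k by (rule scramble_int_less[OF b0 \<sigma>])
  have tm: "m - t + t = m" using net by (simp add: tms_net_def)
  fix c a :: "'d \<Rightarrow> nat" assume c: "(\<Sum>k\<in>UNIV. c k) = m - t" and a: "\<And>k. a k < b ^ c k"
  have "\<exists>p<b ^ c k. \<forall>x\<in>{0..<1}. scramble_int b (\<sigma> k) x (c k) = a k \<longleftrightarrow> nat \<lfloor>x * real b ^ c k\<rfloor> = p" for k
    using scramble_int_preimage[OF b0 \<sigma> a, of k k] by blast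
  then obtain p where p: "\<And>k. p k < b ^ c k"
    "\<And>k x. x \<in> {0..<1} \<Longrightarrow> scramble_int b (\<sigma> k) x (c k) = a k \<longleftrightarrow> nat \<lfloor>x * real b ^ c k\<rfloor> = p k"
    by metis
  have cn: "c k \<le> n" for k
    using member_le_sum[of k UNIV c] c n by simp
  have P: "P i $ k \<in> {0..<1}" if "i < b ^ m" for i k using net that by (simp add: tms_net_def)
  have "(\<forall>k. scramble_int b (\<sigma> k) (P i $ k) n div b ^ (n - c k) = a k) \<longleftrightarrow> P i \<in> elementary_interval b c p"
    if "i < b ^ m" for i
    using p(2)[OF P[OF that]] P[OF that] nat_floor_eq_iff[OF b0]
    by (simp add: scramble_int_div[OF b0 \<sigma> cn] elementary_interval_def)
  then have "{i. i < b ^ (m - t + t) \<and> (\<forall>k. scramble_int b (\<sigma> k) (P i $ k) n div b ^ (n - c k) = a k)}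
    = {i. i < b ^ m \<and> P i \<in> elementary_interval b c p}" unfolding tm by blast
  then show "card {i. i < b ^ (m - t + t) \<and> (\<forall>k. scramble_int b (\<sigma> k) (P i $ k) n div b ^ (n - c k) = a k)} = b ^ t"
    using net c p(1) by (simp add: tms_net_def)
qed

lemma scramble_tendsto:
  fixes x :: "real^'d::finite"
  assumes "b \<ge> 2" "\<And>k. digit_permutations b (\<sigma> k)"
  shows "(\<lambda>n. \<chi> k. real (scramble_int b (\<sigma> k) (x $ k) n) / real b ^ n) \<longlonglongrightarrow> scramble b \<sigma> x"
  by (rule vec_tendstoI) (simp add: scramble_def scramble_int_tendsto[OF assms])

text \<open>A coordinate is a countable sum of scrambled digits, each a function of a random
  variable with values in a discrete space. The range of these variables gives the second
  claim.\<close>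

lemma scramble_measurable:
  fixes \<Sigma> :: "'w \<Rightarrow> 'd::finite \<Rightarrow> nat list \<Rightarrow> nat \<Rightarrow> nat" and x :: "real^'d"
  assumes "nested_uniform_scrambling b M \<Sigma>" "b > 0"
  shows "(\<lambda>\<omega>. scramble b (\<Sigma> \<omega>) x) \<in> borel_measurable M"
    and "\<omega> \<in> space M \<Longrightarrow> digit_permutations b (\<Sigma> \<omega> k)"
proof -
  interpret prob_space M using assms by (simp add: nested_uniform_scrambling_def)
  have rv: "(\<lambda>\<omega>. \<Sigma> \<omega> k p) \<in> measurable M (count_space {\<sigma>. \<sigma> permutes {..<b}})" if "p \<in> lists {..<b}" for k p
    using assms that by (auto simp: nested_uniform_scrambling_def indep_vars_def)
  then show "digit_permutations b (\<Sigma> \<omega> k)" if "\<omega> \<in> space M"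
    using that measurable_space[OF rv] by (auto simp: digit_permutations_def)
  have digit_rv: "(\<lambda>\<omega>. real (\<Sigma> \<omega> k p d)) \<in> borel_measurable M" if "p \<in> lists {..<b}" for k p d
    by (rule measurable_compose[OF rv[OF that]]) simp
  have "(\<lambda>\<omega>. scramble_coord b (\<Sigma> \<omega> k) (x $ k)) \<in> borel_measurable M" for k
    unfolding scramble_coord_def
    by (intro borel_measurable_suminf borel_measurable_divide digit_rv digits_in_lists assms borel_measurable_const)
  then have "(\<lambda>\<omega>. \<Sum>k\<in>UNIV. scramble_coord b (\<Sigma> \<omega> k) (x $ k) *\<^sub>R (axis k 1 :: real^'d)) \<in> borel_measurable M"
    by (intro borel_measurable_sum borel_measurable_scaleR borel_measurable_const)
  moreover have "scramble b (\<Sigma> \<omega>) x = (\<Sum>k\<in>UNIV. scramble_coord b (\<Sigma> \<omega> k) (x $ k) *\<^sub>R axis k 1)" for \<omega>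
    by (simp add: scramble_def vec_eq_iff axis_def if_distrib cong: if_cong)
  ultimately show "(\<lambda>\<omega>. scramble b (\<Sigma> \<omega>) x) \<in> borel_measurable M" by simp
qed

section \<open>Quadrature error on digit grids\<close>

text \<open>The alternating sum of \<open>G\<close> over the corners of the box from
  \<open>p\<close> to \<open>q\<close> in the coordinates \<open>ks\<close>, the others being held
  at \<open>g\<close>.\<close>

primrec iter_diff :: "'d list \<Rightarrow> ('d \<Rightarrow> real) \<Rightarrow> ('d \<Rightarrow> real) \<Rightarrow> (real^'d::finite \<Rightarrow> real) \<Rightarrow> ('d \<Rightarrow> real) \<Rightarrow> real" where
  "iter_diff [] p q G g = G (\<chi> i. g i)"
| "iter_diff (k # ks) p q G g = iter_diff ks p q G (g(k := q k)) - iter_diff ks p q G (g(k := p k))"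

lemma iter_diff_cong:
  "(\<And>k. k \<in> set ks \<Longrightarrow> p k = p' k) \<Longrightarrow> (\<And>k. k \<in> set ks \<Longrightarrow> q k = q' k) \<Longrightarrow>
    iter_diff ks p q G g = iter_diff ks p' q' G g"
  by (induction ks arbitrary: g) auto

lemma sum_PiE_insert:
  assumes "k \<notin> S"
  shows "(\<Sum>y\<in>Pi\<^sub>E (insert k S) T. f y) = (\<Sum>z\<in>T k. \<Sum>y\<in>Pi\<^sub>E S T. f (y(k := z)))"
  unfolding PiE_insert_eq
  by (subst sum.reindex[OF inj_combinator[OF assms]]) (simp add: sum.cartesian_product case_prod_unfold)

lemma sum_telescope_pred: "(\<Sum>z = 1..n. f z - f (z - 1)) = f n - (f 0 :: real)" for n :: nat
  by (induction n) simp_all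

text \<open>Discrete fundamental theorem: the mixed differences over the cells below
  \<open>A\<close> telescope in each coordinate, and the terms on the lower faces vanish by
  \<open>G0\<close>.\<close>

lemma sum_iter_diff:
  fixes G :: "real^'d::finite \<Rightarrow> real" and a :: "nat \<Rightarrow> real" and A :: "'d \<Rightarrow> nat"
  assumes G0: "\<And>x k. x $ k = a 0 \<Longrightarrow> G x = 0"
  shows "distinct ks \<Longrightarrow> G (\<chi> i. if i \<in> set ks then a (A i) else g i) =
    (\<Sum>y\<in>Pi\<^sub>E (set ks) (\<lambda>k. {1..A k}). iter_diff ks (\<lambda>k. a (y k - 1)) (\<lambda>k. a (y k)) G g)"
proof (induction ks arbitrary: g)
  case (Cons k ks)
  define \<Phi> where "\<Phi> z = G (\<chi> i. if i \<in> set ks then a (A i) else (g(k := a z)) i)" for z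
  have k: "k \<notin> set ks" "distinct ks" using Cons.prems by auto
  have "iter_diff (k # ks) (\<lambda>j. a ((y(k := z)) j - 1)) (\<lambda>j. a ((y(k := z)) j)) G g
    = iter_diff ks (\<lambda>j. a (y j - 1)) (\<lambda>j. a (y j)) G (g(k := a z))
      - iter_diff ks (\<lambda>j. a (y j - 1)) (\<lambda>j. a (y j)) G (g(k := a (z - 1)))" for y z
    using k by (simp, intro arg_cong2[of _ _ _ _ minus] iter_diff_cong) auto
  then have "(\<Sum>y\<in>Pi\<^sub>E (set (k # ks)) (\<lambda>k. {1..A k}). iter_diff (k # ks) (\<lambda>k. a (y k - 1)) (\<lambda>k. a (y k)) G g)
    = (\<Sum>z = 1..A k. \<Phi> z - \<Phi> (z - 1))"
    using k by (simp add: sum_PiE_insert sum_subtractf Cons.IH \<Phi>_def del: iter_diff.simps fun_upd_apply)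
  also have "\<dots> = \<Phi> (A k) - \<Phi> 0" by (rule sum_telescope_pred)
  also have "\<Phi> 0 = 0" unfolding \<Phi>_def using k by (intro G0[of _ k]) simp
  also have "\<Phi> (A k) = G (\<chi> i. if i \<in> set (k # ks) then a (A i) else g i)"
    unfolding \<Phi>_def using k by (intro arg_cong[of _ _ G]) (auto simp: vec_eq_iff)
  finally show ?case by simp
qed simp

section \<open>Bounding mixed differences by mixed derivatives\<close>

lemma iter_diff_has_derivative:
  fixes G :: "real^'d::finite \<Rightarrow> real"
  assumes G: "\<And>x. x \<in> open_cube \<Longrightarrow> (\<lambda>t. G (x + t *\<^sub>R axis k 1)) field_differentiable (at 0)"
  shows "k \<notin> set ks \<Longrightarrow> (\<And>j. 0 < g j \<and> g j < 1) \<Longrightarrow>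
    (\<And>j. j \<in> set ks \<Longrightarrow> 0 < p j \<and> p j < 1 \<and> 0 < q j \<and> q j < 1) \<Longrightarrow> 0 < s \<Longrightarrow> s < 1 \<Longrightarrow>
    ((\<lambda>s. iter_diff ks p q G (g(k := s))) has_real_derivative iter_diff ks p q (partial_deriv k G) (g(k := s))) (at s)"
proof (induction ks arbitrary: g)
  case Nil
  define x where "x = (\<chi> i. (g(k := 0)) i)"
  have eq: "(\<chi> i. (g(k := r)) i) = x + r *\<^sub>R axis k 1" for r
    by (simp add: vec_eq_iff axis_def x_def)
  have "x + s *\<^sub>R axis k 1 \<in> open_cube"
    unfolding eq[symmetric] using Nil by (auto simp: open_cube_def)
  from line_has_derivative[OF G this] show ?case
    unfolding iter_diff.simps eq .
next
  case (Cons j ks)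
  have tw: "g(k := r, j := z) = (g(j := z))(k := r)" for r z using Cons.prems by (intro fun_upd_twist) auto
  show ?case
    unfolding iter_diff.simps tw using Cons.prems by (intro DERIV_diff Cons.IH) auto
qed

text \<open>An antiderivative of \<open>s powr (c - 1) + (1 - s) powr (c - 1)\<close>, which
  dominates \<open>edge_dist s powr (c - 1)\<close>. Adding both ends instead of taking the nearer
  one gives a closed form, bounded on the unit interval for \<open>c > 0\<close>.\<close>

definition edge_potential :: "real \<Rightarrow> real \<Rightarrow> real" where
  "edge_potential c s = (s powr c - (1 - s) powr c) / c"

definition edge_potential_deriv :: "real \<Rightarrow> real \<Rightarrow> real" where
  "edge_potential_deriv c s = s powr (c - 1) + (1 - s) powr (c - 1)"

lemma edge_potential_has_derivative:
  assumes "0 < s" "s < 1" "c > 0"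
  shows "(edge_potential c has_real_derivative edge_potential_deriv c s) (at s)"
  unfolding edge_potential_def [abs_def] edge_potential_deriv_def using assms
  by (auto intro!: derivative_eq_intros simp: field_simps powr_diff)

lemma edge_potential_bounds:
  assumes "0 \<le> s" "s \<le> 1" "c > 0"
  shows "\<bar>edge_potential c s\<bar> \<le> 1 / c"
proof -
  have "0 \<le> s powr c" "s powr c \<le> 1" "0 \<le> (1 - s) powr c" "(1 - s) powr c \<le> 1"
    using assms by (auto intro: powr_le1)
  then have "\<bar>s powr c - (1 - s) powr c\<bar> \<le> 1" by linarith
  then show ?thesis using assms by (simp add: edge_potential_def divide_right_mono)
qed

lemma edge_potential_tendsto:
  assumes "f \<longlonglongrightarrow> s" "\<And>n. 0 \<le> f n \<and> f n \<le> 1" "c > 0"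
  shows "(\<lambda>n. edge_potential c (f n)) \<longlonglongrightarrow> edge_potential c s"
  unfolding edge_potential_def using assms
  by (intro tendsto_divide tendsto_diff tendsto_powr' tendsto_const) auto

text \<open>Both \<open>K * edge_potential c + \<Phi>\<close> and
  \<open>K * edge_potential c - \<Phi>\<close> are nondecreasing. An increment of the potential thus
  replaces the integral of a singular bound.\<close>

lemma increment_bound:
  assumes "0 < p" "p \<le> q" "q < 1" "c > 0"
    and "\<And>s. 0 < s \<Longrightarrow> s < 1 \<Longrightarrow> (\<Phi> has_real_derivative \<Phi>' s) (at s)"
    and "\<And>s. 0 < s \<Longrightarrow> s < 1 \<Longrightarrow> \<bar>\<Phi>' s\<bar> \<le> K * edge_potential_deriv c s"
  shows "\<bar>\<Phi> q - \<Phi> p\<bar> \<le> K * (edge_potential c q - edge_potential c p)"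
proof -
  have *: "K * edge_potential c p + r * \<Phi> p \<le> K * edge_potential c q + r * \<Phi> q" if r: "\<bar>r\<bar> = 1" for r
  proof (rule DERIV_nonneg_imp_nondecreasing[OF assms(2)])
    fix s assume "p \<le> s" "s \<le> q"
    then have s: "0 < s" "s < 1" using assms by auto
    have "((\<lambda>s. K * edge_potential c s + r * \<Phi> s) has_real_derivative K * edge_potential_deriv c s + r * \<Phi>' s) (at s)"
      using s assms by (intro DERIV_add DERIV_cmult edge_potential_has_derivative)
    moreover have "0 \<le> K * edge_potential_deriv c s + r * \<Phi>' s"
      using assms(6)[OF s] abs_mult[of r "\<Phi>' s"] r by simp
    ultimately show "\<exists>y. ((\<lambda>s. K * edge_potential c s + r * \<Phi> s) has_real_derivative y) (at s) \<and> 0 \<le> y"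
      by blast
  qed
  from *[of 1] *[of "-1"] show ?thesis by (simp add: algebra_simps abs_le_iff)
qed

text \<open>Differences are traded for derivatives one coordinate at a time, with
  \<open>increment_bound\<close> applied in coordinate \<open>k\<close>. \<open>js\<close> collects
  the coordinates already traded; moving \<open>k\<close> there leaves \<open>rev ks @ js\<close>
  unchanged, since new derivatives go to the front.\<close>

lemma iter_diff_bound:
  fixes h :: "real^'d::finite \<Rightarrow> real"
  assumes c: "c > 0"
  shows "cont_partials open_cube (rev ks @ js) h \<Longrightarrow>
    (\<And>u. u \<in> open_cube \<Longrightarrow> \<bar>iter_partial (rev ks @ js) h u\<bar> \<le> C * (\<Prod>j\<in>set (rev ks @ js). edge_potential_deriv c (u $ j))) \<Longrightarrow>
    distinct (ks @ js) \<Longrightarrow> (\<And>j. 0 < g j \<and> g j < 1) \<Longrightarrow>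
    (\<And>k. k \<in> set ks \<Longrightarrow> 0 < p k \<and> p k \<le> q k \<and> q k < 1) \<Longrightarrow>
    \<bar>iter_diff ks p q (iter_partial js h) g\<bar> \<le>
      C * (\<Prod>k\<in>set ks. edge_potential c (q k) - edge_potential c (p k)) * (\<Prod>j\<in>set js. edge_potential_deriv c (g j))"
proof (induction ks arbitrary: js g)
  case Nil
  have "(\<chi> i. g i) \<in> open_cube" using Nil.prems(4) by (simp add: open_cube_def)
  from Nil.prems(2)[OF this] show ?case by simp
next
  case (Cons k ks)
  let ?P = "\<Prod>k\<in>set ks. edge_potential c (q k) - edge_potential c (p k)"
  let ?J = "\<Prod>j\<in>set js. edge_potential_deriv c (g j)"
  have k: "k \<notin> set ks" "k \<notin> set js" using Cons.prems(3) by auto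
  have upd: "0 < (g(k := s)) j \<and> (g(k := s)) j < 1" if "0 < s" "s < 1" for s j
    using Cons.prems(4) that by simp
  have cp: "cont_partials open_cube (k # js) h"
    using Cons.prems(1) cont_partials_append[of _ "rev ks" "k # js"] by simp
  have "\<bar>iter_diff ks p q (iter_partial js h) (g(k := q k)) - iter_diff ks p q (iter_partial js h) (g(k := p k))\<bar>
    \<le> (C * ?P * ?J) * (edge_potential c (q k) - edge_potential c (p k))"
  proof (rule increment_bound[OF _ _ _ c])
    fix s :: real assume s: "0 < s" "s < 1"
    show "((\<lambda>s. iter_diff ks p q (iter_partial js h) (g(k := s))) has_real_derivative
       iter_diff ks p q (partial_deriv k (iter_partial js h)) (g(k := s))) (at s)"
      using k Cons.prems(4,5) s cp by (intro iter_diff_has_derivative) (auto intro: less_le_trans le_less_trans)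
    have "\<bar>iter_diff ks p q (iter_partial (k # js) h) (g(k := s))\<bar>
      \<le> C * ?P * (\<Prod>j\<in>set (k # js). edge_potential_deriv c ((g(k := s)) j))"
      using Cons.prems upd[OF s] by (intro Cons.IH) auto
    also have "(\<Prod>j\<in>set (k # js). edge_potential_deriv c ((g(k := s)) j)) = edge_potential_deriv c s * ?J"
      using k by (auto intro!: arg_cong[of _ _ "(*) _"] prod.cong)
    finally show "\<bar>iter_diff ks p q (partial_deriv k (iter_partial js h)) (g(k := s))\<bar>
      \<le> C * ?P * ?J * edge_potential_deriv c s" by (simp add: mult_ac del: fun_upd_apply)
  qed (use Cons.prems(5) in auto)
  then show ?case using k by (simp add: mult_ac)
qed

lemma iter_diff_tendsto:
  fixes G :: "real^'d::finite \<Rightarrow> real"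
  assumes "continuous_on UNIV G" "\<And>k. (\<lambda>n. p n k) \<longlonglongrightarrow> p' k"
  shows "(\<And>i. (\<lambda>n. g n i) \<longlonglongrightarrow> g' i) \<Longrightarrow> (\<lambda>n. iter_diff ks (p n) q G (g n)) \<longlonglongrightarrow> iter_diff ks p' q G g'"
proof (induction ks arbitrary: g g')
  case Nil
  have "(\<lambda>n. \<chi> i. g n i) \<longlonglongrightarrow> (\<chi> i. g' i)" by (rule vec_tendstoI) (simp add: Nil)
  moreover have "isCont G (\<chi> i. g' i)" using assms(1) by (simp add: continuous_on_eq_continuous_at)
  ultimately show ?case unfolding iter_diff.simps by (rule isCont_tendsto_compose[rotated])
next
  case (Cons k ks)
  show ?case unfolding iter_diff.simps
    by (intro tendsto_diff Cons.IH) (use Cons.prems assms(2) in auto)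
qed

text \<open>Cells touching a lower face are approached by boxes with lower corner
  \<open>p' n\<close> inside the open cube. Continuity of \<open>h\<close> and of the potential
  passes the bound to the limit.\<close>

lemma iter_diff_bound_closed:
  fixes h :: "real^'d::finite \<Rightarrow> real"
  assumes c: "c > 0" and cont: "continuous_on UNIV h"
    and ks: "distinct ks" and cp: "cont_partials open_cube (rev ks) h"
    and bd: "\<And>u. u \<in> open_cube \<Longrightarrow> \<bar>iter_partial (rev ks) h u\<bar> \<le> C * (\<Prod>j\<in>set ks. edge_potential_deriv c (u $ j))"
    and g: "\<And>j. 0 < g j \<and> g j < 1" and pq: "\<And>k. 0 \<le> p k \<and> p k < q k \<and> q k < 1"
  shows "\<bar>iter_diff ks p q h g\<bar> \<le> C * (\<Prod>k\<in>set ks. edge_potential c (q k) - edge_potential c (p k))"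
proof -
  define p' where "p' n k = p k + (q k - p k) * inverse (real (Suc n))" for n k
  have lim: "(\<lambda>n. p' n k) \<longlonglongrightarrow> p k" for k
  proof -
    have "(\<lambda>n. p' n k) \<longlonglongrightarrow> p k + (q k - p k) * 0"
      unfolding p'_def by (intro tendsto_intros LIMSEQ_inverse_real_of_nat)
    then show ?thesis by simp
  qed
  have p': "0 < p' n k \<and> p' n k \<le> q k" for n k
  proof -
    define r where "r = inverse (real (Suc n))"
    have r: "0 < r" "r \<le> 1" by (auto simp: r_def inverse_le_1_iff)
    have pq': "0 \<le> p k" "0 < q k - p k" using pq[of k] by auto
    have "0 < (q k - p k) * r" "(q k - p k) * r \<le> q k - p k"
      using pq' r by (auto simp: mult_left_le)
    then have "0 < p k + (q k - p k) * r" "p k + (q k - p k) * r \<le> q k" using pq' by linarith+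
    then show ?thesis by (simp add: p'_def r_def)
  qed
  have "\<bar>iter_diff ks (p' n) q (iter_partial [] h) g\<bar> \<le> C * (\<Prod>k\<in>set ks. edge_potential c (q k) - edge_potential c (p' n k))
     * (\<Prod>j\<in>set []. edge_potential_deriv c (g j))" for n
    using p' pq g ks cp bd by (intro iter_diff_bound c) auto
  then have "\<bar>iter_diff ks (p' n) q h g\<bar> \<le> C * (\<Prod>k\<in>set ks. edge_potential c (q k) - edge_potential c (p' n k))" for n
    by simp
  moreover have "(\<lambda>n. \<bar>iter_diff ks (p' n) q h g\<bar>) \<longlonglongrightarrow> \<bar>iter_diff ks p q h g\<bar>"
    by (intro tendsto_rabs iter_diff_tendsto cont lim tendsto_const)
  moreover have "p' n k \<le> 1" for n k using p'[of n k] pq[of k] by linarith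
  then have "(\<lambda>n. C * (\<Prod>k\<in>set ks. edge_potential c (q k) - edge_potential c (p' n k)))
    \<longlonglongrightarrow> C * (\<Prod>k\<in>set ks. edge_potential c (q k) - edge_potential c (p k))"
    using p' by (intro tendsto_mult tendsto_prod tendsto_diff tendsto_const edge_potential_tendsto lim c) (auto intro: less_imp_le)
  ultimately show ?thesis by (intro LIMSEQ_le) auto
qed

section \<open>Summation by parts on the digit grid\<close>

definition grid_point :: "nat \<Rightarrow> ('d \<Rightarrow> nat) \<Rightarrow> real^'d::finite" where
  "grid_point L A = (\<chi> k. real (A k) / real L)"

text \<open>After exchanging the sums, the mixed difference at \<open>y\<close> occurs once for
  every point that dominates \<open>y\<close> in all coordinates.\<close>

lemma sum_over_grid_points:
  fixes h :: "real^'d::finite \<Rightarrow> real" and X :: "'i \<Rightarrow> 'd \<Rightarrow> nat"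
  assumes h0: "\<And>x. x \<notin> open_cube \<Longrightarrow> h x = 0" and ks: "distinct ks" "set ks = UNIV"
    and I: "finite I" and X: "\<And>i k. i \<in> I \<Longrightarrow> X i k < L"
  shows "(\<Sum>i\<in>I. h (grid_point L (X i))) =
    (\<Sum>y\<in>Pi\<^sub>E UNIV (\<lambda>_. {1..<L}).
      iter_diff ks (\<lambda>k. real (y k - 1) / real L) (\<lambda>k. real (y k) / real L) h g * real (card {i \<in> I. \<forall>k. y k \<le> X i k}))"
proof -
  let ?D = "\<lambda>y. iter_diff ks (\<lambda>k. real (y k - 1) / real L) (\<lambda>k. real (y k) / real L) h g"
  let ?Y = "Pi\<^sub>E UNIV (\<lambda>_. {1..<L}) :: ('d \<Rightarrow> nat) set"
  have fin: "finite ?Y" by (intro finite_PiE) auto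
  have face: "x \<notin> open_cube" if "x $ k = real 0 / real L" for x :: "real^'d" and k
    using that by (auto simp: open_cube_def intro!: exI[of _ k])
  have "h (grid_point L (X i)) = (\<Sum>y\<in>?Y. if \<forall>k. y k \<le> X i k then ?D y else 0)" if i: "i \<in> I" for i
  proof -
    have "h (grid_point L (X i)) = h (\<chi> j. if j \<in> set ks then real (X i j) / real L else g j)"
      using ks by (simp add: grid_point_def)
    also have "\<dots> = (\<Sum>y\<in>Pi\<^sub>E (set ks) (\<lambda>k. {1..X i k}). ?D y)"
      by (rule sum_iter_diff[where a = "\<lambda>j. real j / real L", OF h0 ks(1)]) (rule face)
    also have "Pi\<^sub>E (set ks) (\<lambda>k. {1..X i k}) = {y \<in> ?Y. \<forall>k. y k \<le> X i k}"
      using X[OF i] ks by (auto simp: PiE_def Pi_def intro: le_less_trans)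
    also have "(\<Sum>y\<in>{y \<in> ?Y. \<forall>k. y k \<le> X i k}. ?D y) = (\<Sum>y\<in>?Y. if \<forall>k. y k \<le> X i k then ?D y else 0)"
      by (rule sum.inter_filter[OF fin])
    finally show ?thesis .
  qed
  then have "(\<Sum>i\<in>I. h (grid_point L (X i))) = (\<Sum>i\<in>I. \<Sum>y\<in>?Y. if \<forall>k. y k \<le> X i k then ?D y else 0)"
    by simp
  also have "\<dots> = (\<Sum>y\<in>?Y. \<Sum>i\<in>I. if \<forall>k. y k \<le> X i k then ?D y else 0)" by (rule sum.swap)
  also have "\<dots> = (\<Sum>y\<in>?Y. ?D y * real (card {i \<in> I. \<forall>k. y k \<le> X i k}))"
    using I by (intro sum.cong refl) (simp add: sum.inter_filter[symmetric] mult.commute)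
  finally show ?thesis .
qed

text \<open>The sum factors over the coordinates and each factor telescopes. The bound does not
  depend on \<open>L\<close>, so refining the grid costs nothing.\<close>

lemma sum_edge_potential_increments:
  assumes "c > 0" "L > 0"
  shows "(\<Sum>y\<in>Pi\<^sub>E (UNIV::'d::finite set) (\<lambda>_. {1..<L}). \<Prod>k\<in>UNIV.
      edge_potential c (real (y k) / real L) - edge_potential c (real (y k - 1) / real L)) \<le> (2 / c) ^ CARD('d)"
proof -
  let ?f = "\<lambda>j. edge_potential c (real j / real L)"
  have "(\<Sum>j = 1..<L. ?f j - ?f (j - 1)) = (\<Sum>j = 1..L - 1. ?f j - ?f (j - 1))"
    using assms by (intro sum.cong) auto
  also have "\<dots> = ?f (L - 1) - ?f 0" by (rule sum_telescope_pred)
  finally have eq: "(\<Sum>j = 1..<L. ?f j - ?f (j - 1)) = ?f (L - 1) - ?f 0" .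
  have "0 \<le> ?f j - ?f (j - 1)" if "j \<in> {1..<L}" for j
  proof -
    have "real (j - 1) / L powr 1 \<le> real j / L powr 1" by (intro divide_right_mono) auto
    then have l: "real (j - 1) / L \<le> real j / L" by simp
    then have "(real (j - 1) / L) powr c \<le> (real j / L) powr c"
      "(1 - real j / L) powr c \<le> (1 - real (j - 1) / L) powr c"
      using assms that by (auto intro!: powr_mono2)
    then show ?thesis using assms(1) by (simp add: edge_potential_def diff_divide_distrib[symmetric])
  qed
  moreover have "?f (L - 1) - ?f 0 \<le> 2 / c"
    using edge_potential_bounds[of "real (L - 1) / L" c] edge_potential_bounds[of "real 0 / L" c] assms
    by (simp add: abs_le_iff)
  ultimately have "(\<Prod>k\<in>(UNIV::'d set). \<Sum>j\<in>{1..<L}. ?f j - ?f (j - 1)) \<le> (\<Prod>k\<in>(UNIV::'d set). 2 / c)"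
    using eq by (intro prod_mono conjI sum_nonneg) auto
  moreover have "(\<Prod>k\<in>(UNIV::'d set). \<Sum>j\<in>{1..<L}. ?f j - ?f (j - 1))
     = (\<Sum>y\<in>Pi\<^sub>E (UNIV::'d set) (\<lambda>_. {1..<L}). \<Prod>k\<in>UNIV. ?f (y k) - ?f (y k - 1))"
    by (rule prod_sum_PiE) auto
  ultimately show ?thesis by simp
qed

lemma sum_mult_factors: "(\<Sum>y\<in>Y. (C * f y) * K) = C * K * (\<Sum>y\<in>Y. f y :: real)"
proof -
  have "(C * f y) * K = C * K * f y" for y by simp
  then show ?thesis by (simp only: sum_distrib_left)
qed

text \<open>Summation by parts for the net and for the full grid uses the same mixed differences, so
  their means differ by these differences weighted with the discrepancies of the orthants. The share
  of grid points above \<open>y\<close> is exactly the product volume in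
  \<open>star_discrepancy\<close>.\<close>

lemma grid_quadrature_error:
  fixes h :: "real^'d::finite \<Rightarrow> real"
  assumes c: "c > 0" and cont: "continuous_on UNIV h" and h0: "\<And>x. x \<notin> open_cube \<Longrightarrow> h x = 0"
    and ks: "distinct ks" "set ks = UNIV" and cp: "cont_partials open_cube (rev ks) h"
    and bd: "\<And>u. u \<in> open_cube \<Longrightarrow> \<bar>iter_partial (rev ks) h u\<bar> \<le> C * (\<Prod>j\<in>UNIV. edge_potential_deriv c (u $ j))"
    and C: "C \<ge> 0" and net: "integer_net b n M t X"
  shows "\<bar>(\<Sum>i<b ^ (M + t). h (grid_point (b ^ n) (X i))) / b ^ (M + t)
      - (\<Sum>A\<in>Pi\<^sub>E (UNIV :: 'd set) (\<lambda>_. {..<b ^ n}). h (grid_point (b ^ n) A)) / (b ^ n) ^ CARD('d)\<bar>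
    \<le> C * (2 / c) ^ CARD('d) * ((real b * M + 1) ^ CARD('d) / b ^ M)"
proof -
  interpret integer_net b n M t X by (rule net)
  define L where "L = b ^ n"
  have L: "L > 0" using b by (simp add: L_def)
  define N where "N = b ^ (M + t)"
  \<comment> \<open>Since \<open>ks\<close> lists every coordinate, any base point inside the cube
    will do.\<close>
  let ?g = "\<lambda>_::'d. 1/2 :: real"
  let ?D = "\<lambda>y. iter_diff ks (\<lambda>k. real (y k - 1) / real L) (\<lambda>k. real (y k) / real L) h ?g"
  let ?Y = "Pi\<^sub>E UNIV (\<lambda>_. {1..<L}) :: ('d \<Rightarrow> nat) set"
  let ?A = "Pi\<^sub>E UNIV (\<lambda>_. {..<L}) :: ('d \<Rightarrow> nat) set"
  let ?K = "(real b * M + 1) ^ CARD('d) / b ^ M"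
  have finA: "finite ?A" by (intro finite_PiE) auto
  have 1: "(\<Sum>i<N. h (grid_point L (X i))) = (\<Sum>y\<in>?Y. ?D y * real (card {i. i < N \<and> (\<forall>k. y k \<le> X i k)}))"
    using sum_over_grid_points[OF h0 ks, where I = "{..<N}" and X = X and L = L and g = ?g] X_less by (simp add: L_def N_def)
  have 2: "(\<Sum>A\<in>?A. h (grid_point L A)) = (\<Sum>y\<in>?Y. ?D y * (\<Prod>k\<in>UNIV. real L - real (y k)))"
  proof -
    have "real (card {A \<in> ?A. \<forall>k. y k \<le> A k}) = (\<Prod>k\<in>UNIV. real L - real (y k))" if "y \<in> ?Y" for y
    proof -
      have y: "y k < L" for k using that by (auto simp: PiE_def Pi_def)
      have "{A \<in> ?A. \<forall>k. y k \<le> A k} = Pi\<^sub>E UNIV (\<lambda>k. {y k..<L})" by (auto simp: PiE_def Pi_def)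
      then show ?thesis using y by (simp add: card_PiE of_nat_diff less_imp_le)
    qed
    then show ?thesis
      using sum_over_grid_points[OF h0 ks finA, where X = "\<lambda>A. A" and L = L and g = ?g] by (auto simp: PiE_def Pi_def)
  qed
  have "(\<Sum>i<N. h (grid_point L (X i))) / N - (\<Sum>A\<in>?A. h (grid_point L A)) / L ^ CARD('d)
    = (\<Sum>y\<in>?Y. ?D y * (real (card {i. i < N \<and> (\<forall>k. y k \<le> X i k)}) / N - (\<Prod>k\<in>UNIV. (real L - real (y k)) / L)))"
    unfolding 1 2 by (simp add: sum_divide_distrib sum_subtractf[symmetric] right_diff_distrib prod_dividef)
  then have "\<bar>(\<Sum>i<N. h (grid_point L (X i))) / N - (\<Sum>A\<in>?A. h (grid_point L A)) / L ^ CARD('d)\<bar>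
    = \<bar>\<Sum>y\<in>?Y. ?D y * (real (card {i. i < N \<and> (\<forall>k. y k \<le> X i k)}) / N - (\<Prod>k\<in>UNIV. (real L - real (y k)) / L))\<bar>"
    by (rule arg_cong)
  also have "\<dots> \<le> (\<Sum>y\<in>?Y. (C * (\<Prod>k\<in>UNIV. edge_potential c (real (y k) / real L) - edge_potential c (real (y k - 1) / real L))) * ?K)"
  proof (intro order_trans[OF sum_abs] sum_mono)
    fix y :: "'d \<Rightarrow> nat" assume y: "y \<in> ?Y"
    then have y': "1 \<le> y k" "y k < L" for k by (auto simp: PiE_def Pi_def)
    have "0 \<le> real (y k - 1) / real L \<and> real (y k - 1) / real L < real (y k) / real L \<and> real (y k) / real L < 1" for k
      using y'[of k] L by (auto simp: divide_strict_right_mono)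
    then have "\<bar>?D y\<bar> \<le> C * (\<Prod>k\<in>set ks. edge_potential c (real (y k) / real L) - edge_potential c (real (y k - 1) / real L))"
      using ks bd by (intro iter_diff_bound_closed c cont cp) auto
    moreover have "\<bar>real (card {i. i < N \<and> (\<forall>k. y k \<le> X i k)}) / N - (\<Prod>k\<in>UNIV. (real L - real (y k)) / L)\<bar> \<le> ?K"
      using star_discrepancy[of y] y'(2) by (simp add: N_def L_def)
    ultimately show "\<bar>?D y * (real (card {i. i < N \<and> (\<forall>k. y k \<le> X i k)}) / N - (\<Prod>k\<in>UNIV. (real L - real (y k)) / L))\<bar>
      \<le> (C * (\<Prod>k\<in>UNIV. edge_potential c (real (y k) / real L) - edge_potential c (real (y k - 1) / real L))) * ?K"
      unfolding abs_mult ks(2) by (intro mult_mono) (auto intro: order_trans[OF abs_ge_zero])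
  qed
  also have "\<dots> = C * ?K * (\<Sum>y\<in>?Y. \<Prod>k\<in>UNIV. edge_potential c (real (y k) / real L) - edge_potential c (real (y k - 1) / real L))"
    by (rule sum_mult_factors)
  also have "\<dots> \<le> C * ?K * (2 / c) ^ CARD('d)"
    using C by (intro mult_left_mono sum_edge_potential_increments c L) auto
  finally show ?thesis by (simp add: L_def N_def mult_ac)
qed

text \<open>\<open>nat\<close> sends negative floors to 0, so without the demand of nonnegativity
  the cells at index 0 would be unbounded.\<close>

definition grid_cell :: "nat \<Rightarrow> ('d \<Rightarrow> nat) \<Rightarrow> (real^'d::finite) set" where
  "grid_cell L A = {u. \<forall>k. nat \<lfloor>u $ k * real L\<rfloor> = A k \<and> 0 \<le> u $ k}"

lemma grid_cell_measure:
  fixes A :: "'d::finite \<Rightarrow> nat"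
  assumes L: "L > 0"
  shows "grid_cell L A \<in> sets lborel" "measure lborel (grid_cell L A) = 1 / real L ^ CARD('d)"
    "emeasure lborel (grid_cell L A) < \<infinity>"
proof -
  define l r :: "real^'d" where "l = (\<chi> k. real (A k) / L)" and "r = (\<chi> k. (real (A k) + 1) / L)"
  have cell: "grid_cell L A = {u. \<forall>k. l $ k \<le> u $ k \<and> u $ k < r $ k}"
  proof -
    have "nat \<lfloor>u * real L\<rfloor> = A k \<and> 0 \<le> u \<longleftrightarrow> l $ k \<le> u \<and> u < r $ k" for u k
    proof (cases "0 \<le> u")
      case True
      then show ?thesis using nat_floor_eq_iff[OF L, of u 1 "A k"] by (simp add: l_def r_def)
    next
      case False
      moreover have "0 \<le> l $ k" by (simp add: l_def)
      ultimately show ?thesis by simp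
    qed
    then show ?thesis by (auto simp: grid_cell_def)
  qed
  have "grid_cell L A = (\<Inter>k\<in>UNIV. {u. l $ k \<le> u $ k} \<inter> {u. u $ k < r $ k})"
    unfolding cell by auto
  also have "\<dots> \<in> sets borel"
    by (intro sets.finite_INT sets.Int borel_closed borel_open closed_Collect_le open_Collect_less continuous_intros) auto
  finally show sets: "grid_cell L A \<in> sets lborel" by simp
  have sub: "box l r \<subseteq> grid_cell L A" "grid_cell L A \<subseteq> cbox l r"
    unfolding cell by (auto simp: mem_box_cart less_imp_le)
  have "\<forall>k. l $ k \<le> r $ k" using L by (simp add: l_def r_def divide_right_mono)
  then have ne: "cbox l r \<noteq> {}" by (auto simp: interval_ne_empty_cart)
  have "measure lborel (cbox l r) = 1 / real L ^ CARD('d)"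
    unfolding content_cbox_cart[OF ne]
    using L by (simp add: l_def r_def diff_divide_distrib[symmetric] power_one_over)
  moreover have "measure lborel (box l r) = measure lborel (cbox l r)"
    by (simp add: measure_lborel_box_eq measure_lborel_cbox_eq)
  moreover show fin: "emeasure lborel (grid_cell L A) < \<infinity>"
    by (rule le_less_trans[OF emeasure_mono[OF sub(2)] emeasure_lborel_cbox_finite]) simp
  moreover have "measure lborel (box l r) \<le> measure lborel (grid_cell L A)"
    using sets fin by (intro measure_mono_fmeasurable[OF sub(1)]) (auto simp: fmeasurable_def)
  moreover have "measure lborel (grid_cell L A) \<le> measure lborel (cbox l r)"
    using sets by (intro measure_mono_fmeasurable[OF sub(2)]) auto
  ultimately show "measure lborel (grid_cell L A) = 1 / real L ^ CARD('d)"
    by simp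
qed

lemma grid_cell_unit_cube:
  fixes u :: "real^'d::finite"
  assumes L: "L > 0" and A: "A \<in> Pi\<^sub>E UNIV (\<lambda>_. {..<L})" and u: "u \<in> grid_cell L A"
  shows "0 \<le> u $ k" "u $ k < 1" "\<bar>grid_point L A $ k - u $ k\<bar> \<le> 1 / L"
proof -
  have f: "nat \<lfloor>u $ k * real L\<rfloor> = A k" and p: "0 \<le> u $ k" using u by (auto simp: grid_cell_def)
  show "0 \<le> u $ k" by (rule p)
  have b: "real (A k) / L \<le> u $ k" "u $ k < (real (A k) + 1) / L"
    using nat_floor_eq_iff[OF L p, of 1 "A k"] f by auto
  have "A k < L" using A by (auto simp: PiE_def Pi_def)
  then have "(real (A k) + 1) / L \<le> 1" using L by (simp add: field_simps)
  then show "u $ k < 1" using b by linarith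
  have "(real (A k) + 1) / L = real (A k) / L + 1 / L" by (simp add: add_divide_distrib)
  then show "\<bar>grid_point L A $ k - u $ k\<bar> \<le> 1 / L"
    using b by (simp add: grid_point_def abs_le_iff)
qed

text \<open>The grid mean is the integral of the step function \<open>s n\<close>, constant on cells
  with the value of \<open>h\<close> at the lower corner. Continuity gives pointwise convergence,
  and a multiple of the indicator of the unit cube dominates.\<close>

lemma grid_mean_tendsto_integral:
  fixes h :: "real^'d::finite \<Rightarrow> real" and L :: "nat \<Rightarrow> nat"
  assumes cont: "continuous_on UNIV h" and h0: "\<And>x. x \<notin> open_cube \<Longrightarrow> h x = 0" and bd: "\<And>x. \<bar>h x\<bar> \<le> K"
    and L: "\<And>n. L n > 0" and lim: "filterlim L at_top sequentially"
  shows "(\<lambda>n. (\<Sum>A\<in>Pi\<^sub>E (UNIV :: 'd set) (\<lambda>_. {..<L n}). h (grid_point (L n) A)) / real (L n) ^ CARD('d))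
    \<longlonglongrightarrow> (\<integral>x. h x \<partial>lborel)"
proof -
  let ?A = "\<lambda>n. Pi\<^sub>E (UNIV :: 'd set) (\<lambda>_. {..<L n})"
  define s where "s n u = (\<Sum>A\<in>?A n. h (grid_point (L n) A) * indicator (grid_cell (L n) A) u)" for n u
  let ?U = "cbox 0 1 :: (real^'d) set"
  have fin: "finite (?A n)" for n by (intro finite_PiE) auto
  have s_int: "integrable lborel (s n)" "(\<integral>u. s n u \<partial>lborel) = (\<Sum>A\<in>?A n. h (grid_point (L n) A)) / real (L n) ^ CARD('d)" for n
  proof -
    have int: "integrable lborel (\<lambda>u. h (grid_point (L n) A) * indicator (grid_cell (L n) A) u)" for A
      using grid_cell_measure[OF L] by (intro integrable_mult_right integrable_real_indicator)
    then show "integrable lborel (s n)" unfolding s_def by (rule Bochner_Integration.integrable_sum)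
    have "(\<integral>u. s n u \<partial>lborel) = (\<Sum>A\<in>?A n. h (grid_point (L n) A) * measure lborel (grid_cell (L n) A))"
      unfolding s_def by (simp add: Bochner_Integration.integral_sum[OF int])
    then show "(\<integral>u. s n u \<partial>lborel) = (\<Sum>A\<in>?A n. h (grid_point (L n) A)) / real (L n) ^ CARD('d)"
      by (simp add: grid_cell_measure(2)[OF L] sum_divide_distrib)
  qed
  have s_in: "s n u = h (grid_point (L n) A)" if "A \<in> ?A n" "u \<in> grid_cell (L n) A" for n u A
  proof -
    have "s n u = (\<Sum>B\<in>?A n. if B = A then h (grid_point (L n) A) else 0)"
      unfolding s_def
    proof (intro sum.cong refl)
      fix B assume "B \<in> ?A n"
      show "h (grid_point (L n) B) * indicator (grid_cell (L n) B) u = (if B = A then h (grid_point (L n) A) else 0)"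
      proof (cases "B = A")
        case False
        then have "u \<notin> grid_cell (L n) B" using that(2) by (auto simp: grid_cell_def fun_eq_iff) metis
        then show ?thesis using False by simp
      qed (use that(2) in simp)
    qed
    then show ?thesis using that(1) fin by simp
  qed
  have s_out: "s n u = 0" if "\<And>A. A \<in> ?A n \<Longrightarrow> u \<notin> grid_cell (L n) A" for n u
    unfolding s_def using that by (auto intro!: sum.neutral)
  have exA: "\<exists>A\<in>?A n. u \<in> grid_cell (L n) A" if "\<And>k. 0 \<le> u $ k \<and> u $ k < 1" for n u
  proof (intro bexI[of _ "\<lambda>k. nat \<lfloor>u $ k * real (L n)\<rfloor>"])
    show "u \<in> grid_cell (L n) (\<lambda>k. nat \<lfloor>u $ k * real (L n)\<rfloor>)" using that by (simp add: grid_cell_def)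
    have "nat \<lfloor>u $ k * real (L n)\<rfloor> < L n" for k
    proof -
      have "u $ k * real (L n) < 1 * real (L n)" using that[of k] L[of n] by (intro mult_strict_right_mono) auto
      then show ?thesis using L[of n] that[of k] by (simp add: nat_less_iff floor_less_iff)
    qed
    then show "(\<lambda>k. nat \<lfloor>u $ k * real (L n)\<rfloor>) \<in> ?A n" by auto
  qed
  have "(\<lambda>n. s n u) \<longlonglongrightarrow> h u" for u
  proof (cases "\<forall>k. 0 \<le> u $ k \<and> u $ k < 1")
    case True
    then have "\<forall>n. \<exists>A\<in>?A n. u \<in> grid_cell (L n) A" using exA by blast
    then obtain A where A: "\<And>n. A n \<in> ?A n" "\<And>n. u \<in> grid_cell (L n) (A n)" by metis
    have "(\<lambda>n. grid_point (L n) (A n) $ k - u $ k) \<longlonglongrightarrow> 0" for k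
    proof (rule Lim_null_comparison)
      show "\<forall>\<^sub>F n in sequentially. norm (grid_point (L n) (A n) $ k - u $ k) \<le> inverse (real (L n))"
        using grid_cell_unit_cube(3)[OF L A] by (simp add: inverse_eq_divide)
      show "(\<lambda>n. inverse (real (L n))) \<longlonglongrightarrow> 0"
        by (intro tendsto_inverse_0_at_top filterlim_compose[OF filterlim_real_sequentially lim])
    qed
    then have "(\<lambda>n. grid_point (L n) (A n)) \<longlonglongrightarrow> u"
      by (intro vec_tendstoI) (simp add: Lim_null[symmetric] LIM_zero_cancel)
    moreover have "isCont h u" using cont by (simp add: continuous_on_eq_continuous_at)
    ultimately have "(\<lambda>n. h (grid_point (L n) (A n))) \<longlonglongrightarrow> h u" by (rule isCont_tendsto_compose[rotated])
    then show ?thesis using s_in[OF A] by simp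
  next
    case False
    then have "u \<notin> open_cube" by (auto simp: open_cube_def intro: less_imp_le)
    moreover have "s n u = 0" for n
      using False grid_cell_unit_cube[OF L] by (intro s_out) blast
    ultimately show ?thesis using h0 by simp
  qed
  moreover have "norm (s n u) \<le> K * indicator ?U u" for n u
  proof (cases "\<exists>A\<in>?A n. u \<in> grid_cell (L n) A")
    case True
    then obtain A where A: "A \<in> ?A n" "u \<in> grid_cell (L n) A" by blast
    have "u \<in> ?U" using grid_cell_unit_cube(1,2)[OF L A] by (auto simp: mem_box_cart less_imp_le)
    then show ?thesis using bd s_in[OF A] by simp
  next
    case False
    then have "s n u = 0" by (intro s_out) blast
    moreover have "0 \<le> K" using bd[of 0] by linarith
    ultimately show ?thesis by simp
  qed
  moreover have "h \<in> borel_measurable lborel" using cont by (simp add: borel_measurable_continuous_onI)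
  moreover have "integrable lborel (\<lambda>u. K * indicator ?U u)" 
    by (intro integrable_mult_right integrable_real_indicator emeasure_lborel_cbox_finite) simp
  ultimately have "(\<lambda>n. \<integral>u. s n u \<partial>lborel) \<longlonglongrightarrow> (\<integral>u. h u \<partial>lborel)"
    using s_int(1) by (intro integral_dominated_convergence[where w = "\<lambda>u. K * indicator ?U u"]) (auto dest: borel_measurable_integrable)
  then show ?thesis by (simp add: s_int(2))
qed

lemma edge_weight_le_single:
  assumes "u \<in> open_cube" "c \<ge> 0"
  shows "edge_weight (\<lambda>_. c) u \<le> edge_dist (u $ k) powr c"
proof -
  note e = edge_dist_bounds[OF assms(1)]
  have le1: "edge_dist (u $ j) powr c \<le> 1" for j
    by (rule powr_le1) (use e[of j] assms(2) in auto)
  have "edge_weight (\<lambda>_. c) u = edge_dist (u $ k) powr c * (\<Prod>j\<in>UNIV - {k}. edge_dist (u $ j) powr c)"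
    unfolding edge_weight_def by (rule prod.remove) auto
  also have "\<dots> \<le> edge_dist (u $ k) powr c * 1"
    by (intro mult_left_mono prod_le_1 conjI le1) auto
  finally show ?thesis by simp
qed

text \<open>With a positive exponent the growth bound forces the function, extended by 0, to be continuous
  across the boundary of the cube.\<close>

lemma boundary_growth_continuous:
  fixes h :: "real^'d::finite \<Rightarrow> real"
  assumes c: "c > 0" and growth: "boundary_growth UNIV (\<lambda>_. c) h" and h0: "\<And>x. x \<notin> open_cube \<Longrightarrow> h x = 0"
  shows "continuous_on UNIV h" "\<exists>K. \<forall>x. \<bar>h x\<bar> \<le> K"
proof -
  note g = growth[THEN boundary_growth_iff[THEN iffD1]]
  obtain C where C: "\<And>u. u \<in> open_cube \<Longrightarrow> \<bar>h u\<bar> \<le> C * edge_weight (\<lambda>_. c) u"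
    using g by (auto simp: edge_bounded_def)
  \<comment> \<open>The cutoff at 0 makes the bound meaningful outside the cube, where
    \<open>edge_dist\<close> may be negative. It holds for every \<open>k\<close>; at a point off
    the open cube, a coordinate on or beyond a face is chosen.\<close>
  define \<beta> where "\<beta> k y = \<bar>C\<bar> * max 0 (edge_dist (y $ k)) powr c" for k and y :: "real^'d"
  have bound: "norm (h y) \<le> \<beta> k y" for y k
  proof (cases "y \<in> open_cube")
    case True
    have "\<bar>h y\<bar> \<le> \<bar>C\<bar> * edge_weight (\<lambda>_. c) y"
      by (rule order_trans[OF C[OF True]]) (use edge_weight_pos[OF True] in \<open>auto intro!: mult_right_mono less_imp_le\<close>)
    also have "\<dots> \<le> \<bar>C\<bar> * edge_dist (y $ k) powr c"
      using c by (intro mult_left_mono edge_weight_le_single[OF True]) auto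
    finally show ?thesis using edge_dist_bounds(1)[OF True, of k] by (simp add: \<beta>_def max_def)
  next
    case False
    then show ?thesis using h0 by (simp add: \<beta>_def)
  qed
  have "isCont h x" for x
  proof (cases "x \<in> open_cube")
    case True
    then show ?thesis using g open_open_cube continuous_on_eq_continuous_at by blast
  next
    case False
    then obtain k where "\<not> (0 < x $ k \<and> x $ k < 1)" by (auto simp: open_cube_def)
    then have k: "edge_dist (x $ k) \<le> 0" by (auto simp: edge_dist_def min_def)
    have "(\<beta> k \<longlongrightarrow> \<bar>C\<bar> * max 0 (edge_dist (x $ k)) powr c) (at x)"
      unfolding \<beta>_def edge_dist_def using c
      by (intro tendsto_mult tendsto_powr' tendsto_max tendsto_min tendsto_diff tendsto_const tendsto_vec_nth tendsto_ident_at) auto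
    moreover have "max 0 (edge_dist (x $ k)) = 0" using k by simp
    ultimately have "(\<beta> k \<longlongrightarrow> 0) (at x)" by simp
    then have "(h \<longlongrightarrow> 0) (at x)"
      by (rule Lim_null_comparison[rotated]) (intro always_eventually allI bound)
    then show ?thesis using h0[OF False] by (simp add: isCont_def)
  qed
  then show "continuous_on UNIV h" by (simp add: continuous_on_eq_continuous_at)
  have "\<beta> k y \<le> \<bar>C\<bar>" for k y
    using c by (auto simp: \<beta>_def edge_dist_def intro!: mult_left_le powr_le1)
  then show "\<exists>K. \<forall>x. \<bar>h x\<bar> \<le> K" using bound by (metis order_trans real_norm_def)
qed

text \<open>A Koksma-Hlawka bound that holds for every realisation of the scrambling: \<open>h\<close> vanishes on the
  faces of the cube and its full mixed derivative is integrable, so only the star discrepancy enters.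
  Truncating the scrambled points to \<open>n\<close> digits and letting \<open>n\<close> tend to infinity avoids digit
  expansions ending in \<open>b - 1\<close> forever.\<close>

lemma scrambled_net_error:
  fixes h :: "real^'d::finite \<Rightarrow> real"
  assumes c: "c > 0" and growth: "boundary_growth UNIV (\<lambda>_. c) h" and h0: "\<And>x. x \<notin> open_cube \<Longrightarrow> h x = 0"
  obtains V where "V \<ge> 0" and "\<And>b t m (P :: nat \<Rightarrow> real^'d) \<sigma>. b \<ge> 2 \<Longrightarrow> tms_net b t m P \<Longrightarrow>
      (\<And>k. digit_permutations b (\<sigma> k)) \<Longrightarrow>
      \<bar>(\<Sum>i<b ^ m. h (scramble b \<sigma> (P i))) / b ^ m - (\<integral>x. h x \<partial>lborel)\<bar>
        \<le> V * ((real b * real (m - t) + 1) ^ CARD('d) / b ^ (m - t))"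
proof -
  note cont = boundary_growth_continuous(1)[OF c growth h0]
  obtain K where K: "\<And>x. \<bar>h x\<bar> \<le> K" using boundary_growth_continuous(2)[OF c growth h0] by blast
  obtain ks :: "'d list" where ks: "set ks = UNIV" "distinct ks"
    using finite_distinct_list[of "UNIV :: 'd set"] by auto
  have rks: "distinct (rev ks)" "set (rev ks) = UNIV" using ks by auto
  have cp: "cont_partials open_cube (rev ks) h"
    using growth rks by (simp add: boundary_growth_def)
  have "edge_bounded (\<lambda>_. c - 1) (iter_partial (rev ks) h)"
    using growth rks unfolding boundary_growth_def
    by (auto dest!: spec[of _ "rev ks"])
  then obtain C0 where C0: "\<And>u. u \<in> open_cube \<Longrightarrow> \<bar>iter_partial (rev ks) h u\<bar> \<le> C0 * edge_weight (\<lambda>_. c - 1) u"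
    by (auto simp: edge_bounded_def)
  have bd: "\<bar>iter_partial (rev ks) h u\<bar> \<le> \<bar>C0\<bar> * (\<Prod>j\<in>UNIV. edge_potential_deriv c (u $ j))" if u: "u \<in> open_cube" for u
  proof -
    have "\<bar>iter_partial (rev ks) h u\<bar> \<le> \<bar>C0\<bar> * edge_weight (\<lambda>_. c - 1) u"
      by (rule order_trans[OF C0[OF u]]) (use edge_weight_pos[OF u] in \<open>auto intro!: mult_right_mono less_imp_le\<close>)
    \<comment> \<open>In each coordinate the left factor is one of the two nonnegative summands on
      the right.\<close>
    also have "edge_weight (\<lambda>_. c - 1) u \<le> (\<Prod>j\<in>UNIV. edge_potential_deriv c (u $ j))"
      unfolding edge_weight_def
      by (intro prod_mono) (auto simp: edge_dist_def edge_potential_deriv_def min_def)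
    finally show ?thesis by (simp add: mult_left_mono)
  qed
  show ?thesis
  proof (rule that[of "\<bar>C0\<bar> * (2 / c) ^ CARD('d)"])
    show "0 \<le> \<bar>C0\<bar> * (2 / c) ^ CARD('d)" using c by simp
    fix b t m :: nat and P :: "nat \<Rightarrow> real^'d" and \<sigma> :: "'d \<Rightarrow> nat list \<Rightarrow> nat \<Rightarrow> nat"
    assume b: "b \<ge> 2" and net: "tms_net b t m P" and \<sigma>: "\<And>k. digit_permutations b (\<sigma> k)"
    have tm: "m - t + t = m" using net by (simp add: tms_net_def)
    let ?X = "\<lambda>n i k. scramble_int b (\<sigma> k) (P i $ k) n"
    let ?S = "\<lambda>n. (\<Sum>i<b ^ m. h (grid_point (b ^ n) (?X n i))) / b ^ m"
    let ?G = "\<lambda>n. (\<Sum>A\<in>Pi\<^sub>E (UNIV :: 'd set) (\<lambda>_. {..<b ^ n}). h (grid_point (b ^ n) A)) / real (b ^ n) ^ CARD('d)"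
    have "\<bar>?S n - ?G n\<bar> \<le> \<bar>C0\<bar> * (2 / c) ^ CARD('d) * ((real b * real (m - t) + 1) ^ CARD('d) / b ^ (m - t))"
      if "m \<le> n" for n
      using grid_quadrature_error[OF c cont h0 ks(2,1) cp bd _ integer_net_scramble[OF b net \<sigma> that]]
      by (simp add: tm)
    moreover have "?S \<longlonglongrightarrow> (\<Sum>i<b ^ m. h (scramble b \<sigma> (P i))) / b ^ m"
    proof (intro tendsto_divide tendsto_sum tendsto_const)
      fix i
      have "(\<lambda>n. grid_point (b ^ n) (?X n i)) \<longlonglongrightarrow> scramble b \<sigma> (P i)"
        using scramble_tendsto[OF b \<sigma>] by (simp add: grid_point_def)
      moreover have "isCont h (scramble b \<sigma> (P i))" using cont by (simp add: continuous_on_eq_continuous_at)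
      ultimately show "(\<lambda>n. h (grid_point (b ^ n) (?X n i))) \<longlonglongrightarrow> h (scramble b \<sigma> (P i))"
        by (rule isCont_tendsto_compose[rotated])
    qed (use b in simp)
    moreover have "?G \<longlonglongrightarrow> (\<integral>x. h x \<partial>lborel)"
    proof (rule grid_mean_tendsto_integral[OF cont h0 K])
      have "n < b ^ n" for n using b by (simp add: power_gt_expt)
      then show "filterlim (\<lambda>n. b ^ n) at_top sequentially"
        by (intro filterlim_at_top_mono[OF filterlim_ident]) (auto intro: always_eventually less_imp_le)
    qed (use b in auto)
    ultimately show "\<bar>(\<Sum>i<b ^ m. h (scramble b \<sigma> (P i))) / b ^ m - (\<integral>x. h x \<partial>lborel)\<bar>
        \<le> \<bar>C0\<bar> * (2 / c) ^ CARD('d) * ((real b * real (m - t) + 1) ^ CARD('d) / b ^ (m - t))"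
      by (intro LIMSEQ_le_const2[OF tendsto_rabs[OF tendsto_diff]]) (auto intro!: exI[of _ m])
  qed
qed

section \<open>Change of variables\<close>

text \<open>The library's change of variables formula requires a well-ordered index type; every finite type
  is in bijection with one.\<close>

typedef ('a::finite) ordered_index = "{..<CARD('a)}"
  by (rule exI[of _ 0]) simp

instantiation ordered_index :: (finite) linorder
begin

definition less_eq_ordered_index :: "'a ordered_index \<Rightarrow> 'a ordered_index \<Rightarrow> bool" where
  "less_eq_ordered_index x y \<longleftrightarrow> Rep_ordered_index x \<le> Rep_ordered_index y"
definition less_ordered_index :: "'a ordered_index \<Rightarrow> 'a ordered_index \<Rightarrow> bool" where
  "less_ordered_index x y \<longleftrightarrow> Rep_ordered_index x < Rep_ordered_index y"

instance
  by standard (auto simp: less_eq_ordered_index_def less_ordered_index_def Rep_ordered_index_inject)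

end

instance ordered_index :: (finite) finite
proof
  have "(UNIV :: 'a ordered_index set) = Abs_ordered_index ` {..<CARD('a)}"
    by (metis type_definition.Abs_image type_definition_ordered_index)
  then show "finite (UNIV :: 'a ordered_index set)" by (metis finite_imageI finite_lessThan)
qed

instance ordered_index :: (finite) wellorder
proof
  fix P :: "'a ordered_index \<Rightarrow> bool" and a
  assume step: "\<And>x. (\<And>y. y < x \<Longrightarrow> P y) \<Longrightarrow> P x"
  show "P a"
    by (induction a rule: measure_induct_rule[of Rep_ordered_index])
      (auto intro: step simp: less_ordered_index_def)
qed

lemma ordered_index_bij: "\<exists>\<rho> :: 'a::finite ordered_index \<Rightarrow> 'a. bij \<rho>"
proof (rule finite_same_card_bij)
  show "CARD('a ordered_index) = CARD('a)"
    using type_definition.card[OF type_definition_ordered_index] by simp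
qed auto

text \<open>Conjugation by \<open>\<rho>\<close> matches the terms of the two Leibniz sums and
  preserves signs.\<close>

lemma det_reindex:
  fixes A :: "real^'d::finite^'d" and \<rho> :: "'e::finite \<Rightarrow> 'd"
  assumes \<rho>: "bij \<rho>"
  shows "det (\<chi> i j. A $ \<rho> i $ \<rho> j) = det A"
proof -
  have inj: "inj_on \<rho> UNIV" using \<rho> by (simp add: bij_is_inj)
  define \<sigma> where "\<sigma> = inv \<rho>"
  have \<sigma>: "bij \<sigma>" "inj_on \<sigma> UNIV" using \<rho> by (auto simp: \<sigma>_def bij_imp_bij_inv bij_is_inj)
  have inv: "\<sigma> (\<rho> i) = i" "\<rho> (\<sigma> k) = k" for i k
    using \<rho> by (auto simp: \<sigma>_def bij_is_inj bij_is_surj surj_f_inv_f)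
  have "(\<Sum>p\<in>{p. p permutes (UNIV::'e set)}. of_int (sign p) * (\<Prod>i\<in>UNIV. A $ \<rho> i $ \<rho> (p i)))
    = (\<Sum>q\<in>{q. q permutes (UNIV::'d set)}. of_int (sign q) * (\<Prod>k\<in>UNIV. A $ k $ q k))"
  proof (rule sum.reindex_bij_witness[where j = "map_permutation UNIV \<rho>" and i = "map_permutation UNIV \<sigma>"])
    fix p :: "'e \<Rightarrow> 'e" assume "p \<in> {p. p permutes UNIV}"
    then have p: "p permutes UNIV" by simp
    show "map_permutation UNIV \<sigma> (map_permutation UNIV \<rho> p) = p"
      using \<rho> p inv by (intro map_permutation_compose_inv) auto
    show "map_permutation UNIV \<rho> p \<in> {q. q permutes UNIV}"
      using \<rho> p by (auto intro: map_permutation_permutes)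
    have "(\<Prod>k\<in>UNIV. A $ k $ map_permutation UNIV \<rho> p k) = (\<Prod>i\<in>UNIV. A $ \<rho> i $ map_permutation UNIV \<rho> p (\<rho> i))"
      by (rule prod.reindex_bij_betw[OF \<rho>, symmetric])
    then show "of_int (sign (map_permutation UNIV \<rho> p)) * (\<Prod>k\<in>UNIV. A $ k $ map_permutation UNIV \<rho> p k)
      = of_int (sign p) * (\<Prod>i\<in>UNIV. A $ \<rho> i $ \<rho> (p i))"
      using p inj by (simp add: sign_map_permutation map_permutation_apply)
  next
    fix q :: "'d \<Rightarrow> 'd" assume "q \<in> {p. p permutes UNIV}"
    then have q: "q permutes UNIV" by simp
    show "map_permutation UNIV \<rho> (map_permutation UNIV \<sigma> q) = q"
      using \<sigma> q inv by (intro map_permutation_compose_inv) auto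
    show "map_permutation UNIV \<sigma> q \<in> {q. q permutes UNIV}"
      using \<sigma> q by (auto intro: map_permutation_permutes)
  qed
  then show ?thesis by (simp add: det_def)
qed

section \<open>Lebesgue measure under relabelling of coordinates\<close>

lemma prod_Basis_cart: "(\<Prod>b\<in>Basis. (x :: real^'d::finite) \<bullet> b) = (\<Prod>i\<in>UNIV. x $ i)"
proof -
  have eq: "(Basis :: (real^'d) set) = (\<lambda>i. axis i 1) ` UNIV" by (auto simp: Basis_vec_def)
  have "inj (\<lambda>i. axis i 1 :: real^'d)" by (auto simp: inj_on_def axis_eq_axis)
  then show ?thesis unfolding eq by (subst prod.reindex) (simp_all add: inner_axis)
qed

definition reindex :: "('e \<Rightarrow> 'd) \<Rightarrow> real^'d \<Rightarrow> real^'e" where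
  "reindex \<rho> x = (\<chi> i. x $ \<rho> i)"

lemma linear_reindex: "bounded_linear (reindex \<rho> :: real^'d::finite \<Rightarrow> real^'e::finite)"
  by (intro linear_conv_bounded_linear[THEN iffD1] linearI) (auto simp: reindex_def vec_eq_iff)

lemma reindex_inv:
  assumes "bij \<rho>"
  shows "reindex (inv \<rho>) (reindex \<rho> x) = x" "reindex \<rho> (reindex (inv \<rho>) y) = y"
  using assms by (auto simp: reindex_def vec_eq_iff bij_is_inj bij_is_surj surj_f_inv_f)

lemma borel_measurable_reindex [measurable]:
  "(reindex \<rho> :: real^'d::finite \<Rightarrow> real^'e::finite) \<in> borel_measurable borel"
  by (intro borel_measurable_continuous_onI linear_continuous_on linear_reindex)

lemma distr_lborel_reindex:
  fixes \<rho> :: "'e::finite \<Rightarrow> 'd::finite"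
  assumes \<rho>: "bij \<rho>"
  shows "lborel = distr lborel borel (reindex \<rho> :: real^'d \<Rightarrow> real^'e)"
proof (rule lborel_eqI)
  fix l u :: "real^'e"
  assume le: "\<And>b. b \<in> Basis \<Longrightarrow> l \<bullet> b \<le> u \<bullet> b"
  have ax: "axis i 1 \<in> (Basis :: (real^'e) set)" for i by (auto simp: Basis_vec_def)
  have le': "l $ i \<le> u $ i" for i using le[OF ax[of i]] by (simp add: inner_axis)
  let ?l = "reindex (inv \<rho>) l" and ?u = "reindex (inv \<rho>) u"
  have "(\<forall>i. l $ i < x $ \<rho> i \<and> x $ \<rho> i < u $ i) \<longleftrightarrow> (\<forall>k. ?l $ k < x $ k \<and> x $ k < ?u $ k)" for x :: "real^'d"
    using \<rho> by (simp add: reindex_def) (metis bij_inv_eq_iff)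
  then have pre: "reindex \<rho> -` box l u = box ?l ?u"
    by (auto simp: mem_box_cart reindex_def)
  have "emeasure (distr lborel borel (reindex \<rho>)) (box l u) = emeasure lborel (box ?l ?u)"
    by (subst emeasure_distr) (auto simp: pre)
  also have "\<dots> = ennreal (\<Prod>b\<in>Basis. (?u - ?l) \<bullet> b)"
    using le' by (intro emeasure_lborel_box) (auto simp: Basis_vec_def inner_axis reindex_def)
  also have "(\<Prod>b\<in>Basis. (?u - ?l) \<bullet> b) = (\<Prod>k\<in>UNIV. u $ inv \<rho> k - l $ inv \<rho> k)"
    by (subst prod_Basis_cart) (simp add: reindex_def)
  also have "\<dots> = (\<Prod>i\<in>UNIV. u $ i - l $ i)"
    using \<rho> by (intro prod.reindex_bij_betw) (simp add: bij_imp_bij_inv)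
  also have "\<dots> = (\<Prod>b\<in>Basis. (u - l) \<bullet> b)" by (subst prod_Basis_cart) simp
  finally show "emeasure (distr lborel borel (reindex \<rho>)) (box l u) = (\<Prod>b\<in>Basis. (u - l) \<bullet> b)" .
qed simp

lemma integrable_reindex:
  fixes \<rho> :: "'e::finite \<Rightarrow> 'd::finite" and G :: "real^'e \<Rightarrow> real"
  assumes \<rho>: "bij \<rho>" and G: "G \<in> borel_measurable borel"
  shows "integrable lborel G \<longleftrightarrow> integrable lborel (\<lambda>x. G (reindex \<rho> x))"
    and "(\<integral>y. G y \<partial>lborel) = (\<integral>x. G (reindex \<rho> x) \<partial>lborel)"
  by (subst distr_lborel_reindex[OF \<rho>], simp add: integrable_distr_eq integral_distr G)+

text \<open>Bridge between gauge integrals over sets and Bochner integrals for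
  \<open>lborel\<close>; Borel measurability is what allows the completion to be dropped.\<close>

lemma set_lebesgue_lborel:
  fixes g :: "'a::euclidean_space \<Rightarrow> real"
  assumes g: "(\<lambda>x. indicator S x * g x) \<in> borel_measurable borel"
  shows "g absolutely_integrable_on S \<longleftrightarrow> integrable lborel (\<lambda>x. indicator S x * g x)"
    and "g absolutely_integrable_on S \<Longrightarrow> integral S g = (\<integral>x. indicator S x * g x \<partial>lborel)"
proof -
  show "g absolutely_integrable_on S \<longleftrightarrow> integrable lborel (\<lambda>x. indicator S x * g x)"
    using g by (simp add: set_integrable_def integrable_completion)
  assume "g absolutely_integrable_on S"
  then show "integral S g = (\<integral>x. indicator S x * g x \<partial>lborel)"
    using g by (simp add: set_lebesgue_integral_eq_integral(2)[symmetric] set_lebesgue_integral_def integral_completion)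
qed

text \<open>The formula applied here is for vector-valued integrands, so \<open>F\<close> is
  embedded into \<open>real^1\<close> by \<open>?v\<close> and projected back afterwards.\<close>

lemma change_of_variables_wellordered:
  fixes g :: "real^'m::{finite,wellorder} \<Rightarrow> real^'m::_" and F :: "real^'m::_ \<Rightarrow> real"
  assumes S: "S \<in> sets lebesgue" and der: "\<And>x. x \<in> S \<Longrightarrow> (g has_derivative g' x) (at x)" and inj: "inj_on g S"
    and int: "(\<lambda>x. \<bar>det (matrix (g' x))\<bar> * F (g x)) absolutely_integrable_on S"
  shows "F absolutely_integrable_on (g ` S)"
    and "integral (g ` S) F = integral S (\<lambda>x. \<bar>det (matrix (g' x))\<bar> * F (g x))"
proof -
  let ?v = "\<lambda>r::real. r *\<^sub>R (1 :: real^1)" and ?G = "\<lambda>x. \<bar>det (matrix (g' x))\<bar> * F (g x)"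
  have bl: "bounded_linear ?v" by (rule bounded_linear_scaleR_left)
  have bl1: "bounded_linear (\<lambda>x::real^1. x $ 1)" by (rule bounded_linear_vec_nth)
  have der': "(g has_derivative g' x) (at x within S)" if "x \<in> S" for x
    using der[OF that] by (rule has_derivative_at_withinI)
  have "(?v \<circ> ?G) absolutely_integrable_on S" by (rule absolutely_integrable_linear[OF int bl])
  moreover have "?v \<circ> ?G = (\<lambda>x. \<bar>det (matrix (g' x))\<bar> *\<^sub>R (?v (F (g x))))" by (simp add: fun_eq_iff)
  ultimately have 1: "(\<lambda>x. ?v (F x)) absolutely_integrable_on (g ` S)"
    "integral (g ` S) (\<lambda>x. ?v (F x)) = integral S (?v \<circ> ?G)"
    using has_absolute_integral_change_of_variables[OF S der' inj, of "\<lambda>x. ?v (F x)" "integral S (?v \<circ> ?G)"] by auto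
  have "F = (\<lambda>x::real^1. x $ 1) \<circ> (\<lambda>x. ?v (F x))" by (simp add: fun_eq_iff)
  then show F: "F absolutely_integrable_on (g ` S)"
    using absolutely_integrable_linear[OF 1(1) bl1] by simp
  have "?v (integral (g ` S) F) = ?v (integral S ?G)"
    using 1(2) integral_linear[OF absolutely_integrable_on_def[THEN iffD1, OF F, THEN conjunct1] bl]
      integral_linear[OF absolutely_integrable_on_def[THEN iffD1, OF int, THEN conjunct1] bl]
    by (simp add: o_def)
  then show "integral (g ` S) F = integral S ?G" by simp
qed

text \<open>Integrability is transferred from the pulled back integrand to \<open>F\<close>. The map
  is conjugated with the relabelling \<open>\<rho>\<close>, which affects neither Lebesgue measure
  nor determinants.\<close>

lemma change_of_variables_open:
  fixes g :: "real^'d::finite \<Rightarrow> real^'d" and F :: "real^'d \<Rightarrow> real"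
  assumes S: "open S" and der: "\<And>x. x \<in> S \<Longrightarrow> (g has_derivative g' x) (at x)" and inj: "inj_on g S"
    and onto: "g ` S = UNIV" and F: "F \<in> borel_measurable borel"
    and int: "integrable lborel (\<lambda>x. indicator S x * (\<bar>det (matrix (g' x))\<bar> * F (g x)))"
  shows "integrable lborel F"
    and "(\<integral>x. F x \<partial>lborel) = (\<integral>x. indicator S x * (\<bar>det (matrix (g' x))\<bar> * F (g x)) \<partial>lborel)"
proof -
  obtain \<rho> :: "'d ordered_index \<Rightarrow> 'd" where \<rho>: "bij \<rho>" using ordered_index_bij by blast
  note ri = reindex_inv[OF \<rho>] and ir = bij_imp_bij_inv[OF \<rho>]
  let ?\<Phi> = "reindex \<rho>" and ?\<Psi> = "reindex (inv \<rho>)"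
  define T where "T = ?\<Psi> -` S"
  define \<gamma> where "\<gamma> = ?\<Phi> \<circ> g \<circ> ?\<Psi>"
  define \<gamma>' where "\<gamma>' y = ?\<Phi> \<circ> g' (?\<Psi> y) \<circ> ?\<Psi>" for y
  let ?G = "\<lambda>x. \<bar>det (matrix (g' x))\<bar> * F (g x)"
  have lin: "(?\<Phi> has_derivative ?\<Phi>) (at x)" "(?\<Psi> has_derivative ?\<Psi>) (at y)" for x y
    by (intro bounded_linear_imp_has_derivative linear_reindex)+
  have der\<gamma>: "(\<gamma> has_derivative \<gamma>' y) (at y)" if "y \<in> T" for y
    unfolding \<gamma>_def \<gamma>'_def
    by (intro diff_chain_at lin der) (use that in \<open>simp add: T_def\<close>)
  have det: "det (matrix (\<gamma>' y)) = det (matrix (g' (?\<Psi> y)))" for y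
  proof -
    have "inv \<rho> k = j \<longleftrightarrow> k = \<rho> j" for j k using \<rho> by (metis bij_inv_eq_iff)
    then have "?\<Psi> (axis j 1) = axis (\<rho> j) 1" for j
      by (simp add: reindex_def axis_def vec_eq_iff)
    then have "matrix (\<gamma>' y) = (\<chi> i j. matrix (g' (?\<Psi> y)) $ \<rho> i $ \<rho> j)"
      by (simp add: matrix_def \<gamma>'_def vec_eq_iff) (simp add: reindex_def)
    then show ?thesis by (simp add: det_reindex[OF \<rho>])
  qed
  have "open T" unfolding T_def
    by (intro open_vimage S linear_continuous_on linear_reindex)
  then have T: "T \<in> sets lebesgue" by simp
  have inj\<gamma>: "inj_on \<gamma> T"
    using inj ri by (auto simp: inj_on_def \<gamma>_def T_def) metis
  have onto\<gamma>: "\<gamma> ` T = UNIV"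
  proof (intro equalityI subsetI UNIV_I)
    fix z
    have "?\<Psi> z \<in> g ` S" using onto by simp
    then obtain x where x: "x \<in> S" "?\<Psi> z = g x" by blast
    then have "\<gamma> (?\<Phi> x) = z" "?\<Phi> x \<in> T" using ri by (auto simp: \<gamma>_def T_def) (metis ri(2))
    then show "z \<in> \<gamma> ` T" by (metis imageI)
  qed
  have pull: "indicator T y * (\<bar>det (matrix (\<gamma>' y))\<bar> * F (?\<Psi> (\<gamma> y))) = indicator S (?\<Psi> y) * ?G (?\<Psi> y)" for y
    by (simp add: det \<gamma>_def ri T_def indicator_def)
  have Gm: "(\<lambda>x. indicator S x * ?G x) \<in> borel_measurable borel"
    using borel_measurable_integrable[OF int] by simp
  then have Gm': "(\<lambda>y. indicator S (?\<Psi> y) * ?G (?\<Psi> y)) \<in> borel_measurable borel" by measurable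
  have int': "integrable lborel (\<lambda>y. indicator S (?\<Psi> y) * ?G (?\<Psi> y))"
    using integrable_reindex(1)[OF ir Gm] int by simp
  have abs: "(\<lambda>y. \<bar>det (matrix (\<gamma>' y))\<bar> * F (?\<Psi> (\<gamma> y))) absolutely_integrable_on T"
    by (subst set_lebesgue_lborel(1)) (simp_all only: pull Gm' int')
  note cv = change_of_variables_wellordered[of T \<gamma> \<gamma>' "\<lambda>y. F (?\<Psi> y)", OF T der\<gamma> inj\<gamma> abs, unfolded onto\<gamma>]
  have Fm: "(\<lambda>y. F (?\<Psi> y)) \<in> borel_measurable borel" using F by measurable
  have "integrable lborel (\<lambda>y. F (?\<Psi> y))"
    using cv(1) set_lebesgue_lborel(1)[of UNIV "\<lambda>y. F (?\<Psi> y)"] Fm by simp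
  then show "integrable lborel F" using integrable_reindex(1)[OF ir F] by simp
  have "(\<integral>x. F x \<partial>lborel) = (\<integral>y. F (?\<Psi> y) \<partial>lborel)" by (rule integrable_reindex(2)[OF ir F])
  also have "\<dots> = integral UNIV (\<lambda>y. F (?\<Psi> y))"
    using set_lebesgue_lborel(2)[of UNIV "\<lambda>y. F (?\<Psi> y)"] Fm cv(1) by simp
  also have "\<dots> = integral T (\<lambda>y. \<bar>det (matrix (\<gamma>' y))\<bar> * F (?\<Psi> (\<gamma> y)))" by (rule cv(2))
  also have "\<dots> = (\<integral>y. indicator T y * (\<bar>det (matrix (\<gamma>' y))\<bar> * F (?\<Psi> (\<gamma> y))) \<partial>lborel)"
    by (rule set_lebesgue_lborel(2)[OF _ abs]) (simp only: pull Gm')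
  also have "\<dots> = (\<integral>y. indicator S (?\<Psi> y) * ?G (?\<Psi> y) \<partial>lborel)" by (simp only: pull)
  also have "\<dots> = (\<integral>x. indicator S x * ?G x \<partial>lborel)" by (rule integrable_reindex(2)[OF ir Gm, symmetric])
  finally show "(\<integral>x. F x \<partial>lborel) = (\<integral>x. indicator S x * ?G x \<partial>lborel)" .
qed

section \<open>Growth of the pulled back integrand and the convergence rate\<close>

text \<open>Meant for the Jacobian determinant: on the cube its absolute value is a constant
  multiple of it, hence as smooth as the determinant itself.\<close>

lemma connected_constant_sign:
  fixes D :: "'a::topological_space \<Rightarrow> real"
  assumes "connected S" "continuous_on S D" "\<And>x. x \<in> S \<Longrightarrow> D x \<noteq> 0"
  shows "\<exists>s. \<forall>x\<in>S. \<bar>D x\<bar> = s * D x"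
proof (cases "\<exists>x\<in>S. D x > 0")
  case True
  then obtain x where x: "x \<in> S" "D x > 0" by blast
  have "D y > 0" if y: "y \<in> S" for y
  proof (rule ccontr)
    assume "\<not> D y > 0"
    then have "0 \<in> D ` S"
      using connectedD_interval[OF connected_continuous_image[OF assms(2,1)], of "D y" "D x" 0] x y by auto
    then show False using assms(3) by force
  qed
  then show ?thesis by (intro exI[of _ 1]) (simp add: abs_of_pos)
next
  case False
  then show ?thesis by (intro exI[of _ "-1"]) (auto simp: not_less)
qed

lemma boundary_growth_pullback:
  fixes f \<pi> :: "real^'d::finite \<Rightarrow> real" and \<tau> :: "real^'d \<Rightarrow> real^'d"
  assumes diffeo: "C1_diffeomorphism open_cube UNIV \<tau>"
    and f: "C_n_on CARD('d) UNIV f"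
    and f_bd: "\<And>js \<delta>. length js \<le> CARD('d) \<Longrightarrow> \<delta> > 0 \<Longrightarrow> edge_bounded (\<lambda>_. - \<delta>) (\<lambda>u. iter_partial js f (\<tau> u))"
    and \<pi>: "C_n_on CARD('d) UNIV \<pi>"
    and \<pi>_bd: "\<And>js. length js \<le> CARD('d) \<Longrightarrow> edge_bounded (\<lambda>_. a) (\<lambda>u. iter_partial js \<pi> (\<tau> u))"
    and part: "\<And>i j B. B > 0 \<Longrightarrow>
      boundary_growth UNIV (\<lambda>k. - B - (if k = i then 1 else 0)) (partial_deriv i (\<lambda>w. \<tau> w $ j))"
    and a: "a > 1"
  shows "boundary_growth UNIV (\<lambda>_. (a - 1) / 2) (pullback_integrand f \<pi> \<tau>)"
proof -
  \<comment> \<open>The exponents add up to \<open>- 2 * e\<close> from \<open>f\<close>,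
    \<open>a - e\<close> from \<open>\<pi>\<close> and \<open>- d * e - 1\<close> from the
    determinant, with \<open>d = CARD('d)\<close>. This \<open>e\<close> makes the total loss
    \<open>(d + 3) * e\<close> half of \<open>a - 1\<close>.\<close>
  define e where "e = (a - 1) / 2 / (real CARD('d) + 3)"
  have e: "e > 0" using a by (simp add: e_def add_pos_pos)
  have "real CARD('d) + 3 \<noteq> 0" by linarith
  from nonzero_eq_divide_eq[THEN iffD1, OF this e_def]
  have e_eq: "e * (real CARD('d) + 3) = (a - 1) / 2" .
  obtain \<tau>' where der: "\<And>u. u \<in> open_cube \<Longrightarrow> (\<tau> has_derivative \<tau>' u) (at u)"
    and nz: "\<And>u. u \<in> open_cube \<Longrightarrow> det (jacobian_matrix \<tau> u) \<noteq> 0"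
    using C1_diffeomorphism_derivative[OF diffeo] by metis
  let ?D = "\<lambda>u. det (jacobian_matrix \<tau> u)"
  have gf: "boundary_growth UNIV (\<lambda>_. - e - e) (\<lambda>u. f (\<tau> u))"
    using boundary_growth_compose[OF f f_bd[OF _ e] der part e, where js = "[]" and V = UNIV] by simp
  have g\<pi>: "boundary_growth UNIV (\<lambda>_. a - e) (\<lambda>u. \<pi> (\<tau> u))"
    using boundary_growth_compose[OF \<pi> \<pi>_bd der part e, where js = "[]" and V = UNIV] by simp
  have gD: "boundary_growth UNIV (\<lambda>_. - (real CARD('d) * e) - 1) ?D"
    by (rule boundary_growth_det) (rule part[OF e])
  have "continuous_on open_cube ?D" using gD[THEN boundary_growth_iff[THEN iffD1]] by blast
  then have "\<exists>s. \<forall>u\<in>open_cube. \<bar>?D u\<bar> = s * ?D u"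
    by (rule connected_constant_sign[OF convex_connected[OF convex_open_cube]]) (rule nz)
  then obtain s where s: "\<And>u. u \<in> open_cube \<Longrightarrow> \<bar>?D u\<bar> = s * ?D u" by blast
  have "boundary_growth UNIV (\<lambda>_. 0 + (- (real CARD('d) * e) - 1)) (\<lambda>u. s * ?D u)"
    by (intro boundary_growth_mult gD boundary_growth_const) simp
  from boundary_growth_mult[OF boundary_growth_mult[OF gf g\<pi>] this]
  have "boundary_growth UNIV (\<lambda>_. (a - 1) / 2) (\<lambda>u. f (\<tau> u) * \<pi> (\<tau> u) * (s * ?D u))"
  proof (rule boundary_growth_mono)
    have eq: "real CARD('d) * e = (a - 1) / 2 - 3 * e" unfolding e_eq[symmetric] by (simp add: algebra_simps)
    show "(a - 1) / 2 \<le> - e - e + (a - e) + (0 + (- (real CARD('d) * e) - 1))"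
      unfolding eq by (simp add: field_simps)
  qed simp
  then show ?thesis
    by (rule boundary_growth_cong[rotated]) (simp add: pullback_integrand_def s)
qed

text \<open>The polynomial factor \<open>(b m + 1) ^ d\<close> of the discrepancy is absorbed into \<open>N powr \<epsilon>\<close>
  by \<open>1 + x \<le> exp x\<close>.\<close>

lemma discrepancy_rate:
  assumes b: "b \<ge> 2" and \<epsilon>: "\<epsilon> > 0" and d: "d > 0"
  shows "\<exists>K\<ge>0. \<forall>m\<ge>t. (real b * real (m - t) + 1) ^ d / b ^ (m - t) \<le> K * real (b ^ m) powr (- 1 + \<epsilon>)"
proof -
  \<comment> \<open>Chosen so that \<open>exp (q * m) ^ d\<close> equals
    \<open>real (b ^ m) powr \<epsilon>\<close>.\<close>
  define q where "q = \<epsilon> * ln (real b) / d"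
  have q: "q > 0" using assms by (simp add: q_def)
  \<comment> \<open>The factor \<open>b ^ t\<close> comes from replacing \<open>b ^ (m - t)\<close>
    by \<open>b ^ m\<close> in the denominator.\<close>
  define K where "K = (real b / q + 1) ^ d * b ^ t"
  have "(real b * real (m - t) + 1) ^ d / b ^ (m - t) \<le> K * real (b ^ m) powr (- 1 + \<epsilon>)" if m: "m \<ge> t" for m
  proof -
    have "real b * real (m - t) + 1 \<le> (real b / q + 1) * (q * m + 1)"
    proof -
      have "real b * real (m - t) \<le> real b * m" by (intro mult_left_mono) auto
      moreover have "(real b / q + 1) * (q * m + 1) = real b * m + real b / q + q * m + 1"
        using q by (simp add: field_simps)
      moreover have "0 \<le> real b / q" "0 \<le> q * m" using q by auto
      ultimately show ?thesis by linarith
    qed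
    also have "\<dots> \<le> (real b / q + 1) * exp (q * m)"
      using q exp_ge_add_one_self[of "q * m"] by (intro mult_left_mono) (auto simp: add.commute)
    finally have "(real b * real (m - t) + 1) ^ d \<le> ((real b / q + 1) * exp (q * m)) ^ d"
      by (intro power_mono) auto
    also have "\<dots> = (real b / q + 1) ^ d * exp (q * m) ^ d" by (rule power_mult_distrib)
    finally have "(real b * real (m - t) + 1) ^ d \<le> (real b / q + 1) ^ d * exp (q * m) ^ d" .
    moreover have "exp (q * m) ^ d = exp (\<epsilon> * (m * ln (real b)))"
      using d by (simp add: q_def exp_of_nat_mult[symmetric] mult_ac)
    moreover have "exp (\<epsilon> * (m * ln (real b))) = real (b ^ m) powr \<epsilon>"
      using b by (simp add: powr_def ln_realpow)
    ultimately have num: "(real b * real (m - t) + 1) ^ d \<le> (real b / q + 1) ^ d * real (b ^ m) powr \<epsilon>" by simp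
    have "real (b ^ m) = real (b ^ (m - t)) * real (b ^ t)"
      using m by (simp flip: power_add of_nat_mult)
    then have den: "1 / real (b ^ (m - t)) = real (b ^ t) / real (b ^ m)" using b by simp
    have pe: "real (b ^ m) powr \<epsilon> = real (b ^ m) * real (b ^ m) powr (- 1 + \<epsilon>)"
      using b by (subst powr_add) (simp add: powr_minus)
    have "(real b * real (m - t) + 1) ^ d / b ^ (m - t) = (real b * real (m - t) + 1) ^ d * (real (b ^ t) / real (b ^ m))"
      unfolding den[symmetric] by simp
    also have "\<dots> \<le> (real b / q + 1) ^ d * real (b ^ m) powr \<epsilon> * (real (b ^ t) / real (b ^ m))"
      by (intro mult_right_mono num) auto
    also have "\<dots> = K * real (b ^ m) powr (- 1 + \<epsilon>)"
      unfolding pe using b by (simp add: K_def)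
    finally show ?thesis .
  qed
  moreover have "K \<ge> 0" using q by (simp add: K_def)
  ultimately show ?thesis by (intro exI[of _ K] conjI allI impI)
qed

theorem theorem4p8:
  fixes f \<pi> :: "real^'d::finite \<Rightarrow> real"
    and \<tau> :: "real^'d \<Rightarrow> real^'d"
    and F :: "real \<Rightarrow> real"
    and \<alpha> :: real
    and h :: "real^'d \<Rightarrow> real"
  assumes density: "prob_density \<pi>"
    and diffeo: "C1_diffeomorphism open_cube UNIV \<tau>"
    and cdf: "univariate_cdf F" "\<And>x. 0 < F x \<and> F x < 1"
    and f_smooth: "C_n_on CARD('d) UNIV f"
    and A: "\<And>(l :: 'd \<Rightarrow> nat) B. (\<Sum>k\<in>UNIV. l k) \<le> CARD('d) \<Longrightarrow> B > 0 \<Longrightarrow>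
      \<exists>C1>0. \<forall>x. \<bar>multi_deriv l f x\<bar> \<le> C1 * (\<Prod>k\<in>UNIV. min (F (x $ k)) (1 - F (x $ k)) powr (- B))"
    and \<pi>_smooth: "C_n_on CARD('d) UNIV \<pi>"
    and \<alpha>: "\<alpha> > 0"
    and B: "\<exists>C2>0. \<forall>l :: 'd \<Rightarrow> nat. (\<Sum>k\<in>UNIV. l k) \<le> CARD('d) \<longrightarrow>
      (\<forall>x. \<bar>multi_deriv l \<pi> x\<bar> \<le> C2 * (\<Prod>k\<in>UNIV. exp (- \<alpha> * (x $ k)\<^sup>2)))"
    and \<tau>_smooth: "\<And>i j. C_mixed_on open_cube (partial_deriv i (\<lambda>w. \<tau> w $ j))"
    and C1: "\<And>(v :: 'd set) i j B. B > 0 \<Longrightarrow>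
      \<exists>C3>0. \<forall>u\<in>open_cube. \<bar>mixed_deriv v (partial_deriv i (\<lambda>w. \<tau> w $ j)) u\<bar>
        \<le> C3 * inverse (edge_dist (u $ i)) *
            (\<Prod>k\<in>UNIV. edge_dist (u $ k) powr (- B - (if k \<in> v then 1 else 0)))"
    and C2: "\<exists>B0>0. \<exists>C4>0. \<forall>k. \<forall>u\<in>open_cube.
      inverse (min (F (\<tau> u $ k)) (1 - F (\<tau> u $ k)))
        \<le> C4 * (\<Prod>l\<in>UNIV. edge_dist (u $ l) powr (- B0))"
    and C3: "\<exists>C5 C'. C5 > 1 / \<alpha> \<and> (\<forall>j. \<forall>u\<in>open_cube.
      \<bar>\<tau> u $ j\<bar>\<^sup>2 \<ge> C5 * \<bar>ln (edge_dist (u $ j))\<bar> - C')"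
    and h: "h = pullback_integrand f \<pi> \<tau>"
  shows "C_mixed_on open_cube h \<and>
    (\<forall>B>0. \<exists>C>0. \<forall>v. \<forall>u\<in>open_cube.
      \<bar>mixed_deriv v h u\<bar> \<le> C * (\<Prod>j\<in>UNIV. edge_dist (u $ j) powr (- B - (if j \<in> v then 1 else 0)))) \<and>
    integrable (density lborel (\<lambda>x. ennreal (\<pi> x))) f \<and>
    (\<forall>(b::nat) (t::nat) (m :: nat \<Rightarrow> nat) (P :: nat \<Rightarrow> nat \<Rightarrow> real^'d)
        (M :: nat \<Rightarrow> 'w measure) (\<Sigma> :: nat \<Rightarrow> 'w \<Rightarrow> 'd \<Rightarrow> nat list \<Rightarrow> nat \<Rightarrow> nat) (\<mu>::real).
      b \<ge> 2 \<longrightarrow> filterlim m at_top sequentially \<longrightarrow>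
      (\<forall>n. tms_net b t (m n) (P n)) \<longrightarrow>
      (\<forall>n. nested_uniform_scrambling b (M n) (\<Sigma> n)) \<longrightarrow>
      \<mu> = (\<integral>x. f x \<partial>density lborel (\<lambda>x. ennreal (\<pi> x))) \<longrightarrow>
      (\<forall>n. integrable (M n)
         (\<lambda>\<omega>. \<bar>scrambled_net_estimator b (m n) h (P n) (\<Sigma> n) \<omega> - \<mu>\<bar>\<^sup>2)) \<and>
      (\<forall>\<epsilon>>0. (\<lambda>n. sqrt (\<integral>\<omega>. \<bar>scrambled_net_estimator b (m n) h (P n) (\<Sigma> n) \<omega> - \<mu>\<bar>\<^sup>2 \<partial>M n))
         \<in> O(\<lambda>n. real (b ^ m n) powr (- 1 + \<epsilon>))))"
proof -
  obtain C5 C' where C5: "C5 > 1 / \<alpha>" and far: "\<forall>j. \<forall>u\<in>open_cube. \<bar>\<tau> u $ j\<bar>\<^sup>2 \<ge> C5 * \<bar>ln (edge_dist (u $ j))\<bar> - C'"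
    using C3 by blast
  obtain B0 C4 where B0: "B0 > 0" and tail: "\<forall>k. \<forall>u\<in>open_cube.
      inverse (min (F (\<tau> u $ k)) (1 - F (\<tau> u $ k))) \<le> C4 * edge_weight (\<lambda>_. - B0) u"
    using C2 by (auto simp: edge_weight_def)
  obtain D2 where D2: "D2 > 0" and gauss: "\<And>(l :: 'd \<Rightarrow> nat) x. (\<Sum>k\<in>UNIV. l k) \<le> CARD('d) \<Longrightarrow>
      \<bar>multi_deriv l \<pi> x\<bar> \<le> D2 * (\<Prod>k\<in>UNIV. exp (- \<alpha> * (x $ k)\<^sup>2))"
    using B by blast
  obtain \<tau>' where der: "\<And>u. u \<in> open_cube \<Longrightarrow> (\<tau> has_derivative \<tau>' u) (at u)"
    and jac: "\<And>u. u \<in> open_cube \<Longrightarrow> jacobian_matrix \<tau> u = matrix (\<tau>' u)"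
    using C1_diffeomorphism_derivative[OF diffeo] by metis
  have part: "boundary_growth UNIV (\<lambda>k. - B - (if k = i then 1 else 0)) (partial_deriv i (\<lambda>w. \<tau> w $ j))"
    if Bpos: "B > 0" for i j B
  proof (rule boundary_growth_mixed_derivI[OF \<tau>_smooth])
    fix v
    obtain K where K: "\<And>u. u \<in> open_cube \<Longrightarrow> \<bar>mixed_deriv v (partial_deriv i (\<lambda>w. \<tau> w $ j)) u\<bar>
        \<le> K * inverse (edge_dist (u $ i)) * edge_weight (\<lambda>k. - B - (if k \<in> v then 1 else 0)) u"
      using C1[OF Bpos, of v i j] by (auto simp: edge_weight_def)
    \<comment> \<open>The factor belonging to the differentiated coordinate \<open>i\<close> is
      recast as a weight, so that it merges with the product into a single exponent.\<close>
    have "inverse (edge_dist (u $ i)) = edge_weight (\<lambda>k. - (if k = i then 1 else 0)) u" if "u \<in> open_cube" for u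
    proof -
      have "edge_weight (\<lambda>k. - (if k = i then 1 else 0)) u
        = (\<Prod>k\<in>UNIV. if k = i then inverse (edge_dist (u $ i)) else 1)"
        unfolding edge_weight_def using edge_dist_bounds(1)[OF that]
        by (intro prod.cong) (auto simp: powr_minus less_imp_neq[symmetric] abs_of_pos)
      then show ?thesis by simp
    qed
    then have *: "\<bar>mixed_deriv v (partial_deriv i (\<lambda>w. \<tau> w $ j)) u\<bar>
        \<le> K * edge_weight (\<lambda>k. - (if k = i then 1 else 0) + (- B - (if k \<in> v then 1 else 0))) u"
      if "u \<in> open_cube" for u using K[OF that] that by (simp only: edge_weight_add mult.assoc)
    have eq: "(\<lambda>k. - (if k = i then 1 else 0) + (- B - (if k \<in> v then 1 else 0)))
       = (\<lambda>k. - B - (if k = i then 1 else 0) - (if k \<in> v then 1 else 0 :: real))" by (simp add: fun_eq_iff)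
    show "edge_bounded (\<lambda>k. - B - (if k = i then 1 else 0) - (if k \<in> v then 1 else 0))
        (mixed_deriv v (partial_deriv i (\<lambda>w. \<tau> w $ j)))"
      unfolding edge_bounded_def eq[symmetric] by (intro exI[of _ K] ballI *)
  qed
  have len: "(\<Sum>k\<in>UNIV. count_list js k) = length js" for js :: "'d list"
    by (rule sum_count_set) auto
  have f_bd: "edge_bounded (\<lambda>_. - \<delta>) (\<lambda>u. iter_partial js f (\<tau> u))" if "length js \<le> CARD('d)" "\<delta> > 0" for js \<delta>
  proof (rule edge_bounded_compose_tails[OF cdf(2) tail B0 _ that(2)])
    fix B :: real assume "B > 0"
    then show "\<exists>C1>0. \<forall>x. \<bar>iter_partial js f x\<bar> \<le> C1 * (\<Prod>k\<in>UNIV. min (F (x $ k)) (1 - F (x $ k)) powr (- B))"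
      using A[of "count_list js" B] that(1) multi_deriv_eq_iter_partial[OF open_UNIV f_smooth that(1)] by (simp add: len)
  qed
  have \<pi>_bd: "edge_bounded (\<lambda>_. \<alpha> * C5) (\<lambda>u. iter_partial js \<pi> (\<tau> u))" if "length js \<le> CARD('d)" for js
  proof (rule edge_bounded_compose_gaussian[OF \<alpha> far _ D2])
    show "\<bar>iter_partial js \<pi> x\<bar> \<le> D2 * (\<Prod>k\<in>UNIV. exp (- \<alpha> * (x $ k)\<^sup>2))" for x
      using gauss[of "count_list js" x] that multi_deriv_eq_iter_partial[OF open_UNIV \<pi>_smooth that] by (simp add: len)
  qed
  define c where "c = (\<alpha> * C5 - 1) / 2"
  have "\<alpha> * C5 > 1" using C5 \<alpha> by (simp add: field_simps)
  then have c: "c > 0" by (simp add: c_def)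
  have growth: "boundary_growth UNIV (\<lambda>_. c) h"
    unfolding h c_def
    by (rule boundary_growth_pullback[OF diffeo f_smooth f_bd \<pi>_smooth \<pi>_bd part \<open>\<alpha> * C5 > 1\<close>])
  have h0: "h x = 0" if "x \<notin> open_cube" for x using that by (simp add: h pullback_integrand_def)
  note h_cont = boundary_growth_continuous(1)[OF c growth h0]
  have h_meas [measurable]: "h \<in> borel_measurable borel" by (rule borel_measurable_continuous_onI[OF h_cont])
  obtain K where K: "\<And>x. \<bar>h x\<bar> \<le> K" using boundary_growth_continuous(2)[OF c growth h0] by blast
  have K0: "K \<ge> 0" using K[of 0] by linarith
  have "integrable lborel (\<lambda>x::real^'d. K * indicator (cbox 0 1) x)"
    by (intro integrable_mult_right integrable_real_indicator emeasure_lborel_cbox_finite) simp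
  then have h_int: "integrable lborel h"
  proof (rule Bochner_Integration.integrable_bound)
    have "norm (h x) \<le> norm (K * indicator (cbox 0 1) x)" for x
      using K[of x] K0 h0[of x] box_subset_cbox[of 0 "1::real^'d"]
      by (cases "x \<in> open_cube") (auto simp: open_cube_eq_box indicator_def)
    then show "AE x in lborel. norm (h x) \<le> norm (K * indicator (cbox 0 1) x)" by simp
  qed simp
  have "continuous_on UNIV f" using f_smooth by (auto simp: C_n_on_def dest: spec[of _ "[]"])
  then have f_meas [measurable]: "f \<in> borel_measurable borel" by (rule borel_measurable_continuous_onI)
  have \<pi>_meas [measurable]: "\<pi> \<in> borel_measurable borel" and \<pi>_nn: "\<And>x. 0 \<le> \<pi> x"
    using density by (auto simp: prob_density_def)
  have inj: "inj_on \<tau> open_cube" and onto: "\<tau> ` open_cube = UNIV"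
    using diffeo by (auto simp: C1_diffeomorphism_def bij_betw_def)
  have h_eq: "(\<lambda>u. indicator open_cube u * (\<bar>det (matrix (\<tau>' u))\<bar> * (f (\<tau> u) * \<pi> (\<tau> u)))) = h"
    by (auto simp: h pullback_integrand_def fun_eq_iff jac)
  \<comment> \<open>Boundedness of \<open>h\<close> on the cube is what makes
    \<open>f * \<pi>\<close> integrable, by way of the change of variables.\<close>
  have "integrable lborel (\<lambda>u. indicator open_cube u * (\<bar>det (matrix (\<tau>' u))\<bar> * (f (\<tau> u) * \<pi> (\<tau> u))))"
    unfolding h_eq by (rule h_int)
  note cv = change_of_variables_open[of open_cube \<tau> \<tau>' "\<lambda>x. f x * \<pi> x", OF open_open_cube der inj onto _ this, unfolded h_eq]
  have f_int: "integrable (density lborel (\<lambda>x. ennreal (\<pi> x))) f"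
    using cv(1) \<pi>_nn by (subst integrable_real_density) (auto simp: mult.commute)
  have mu: "(\<integral>x. f x \<partial>density lborel (\<lambda>x. ennreal (\<pi> x))) = (\<integral>x. h x \<partial>lborel)"
    using cv(2) \<pi>_nn by (subst integral_real_density) (auto simp: mult.commute)
  obtain V where V: "V \<ge> 0" and err: "\<And>b t m (P :: nat \<Rightarrow> real^'d) \<sigma>. b \<ge> 2 \<Longrightarrow> tms_net b t m P \<Longrightarrow>
      (\<And>k. digit_permutations b (\<sigma> k)) \<Longrightarrow>
      \<bar>(\<Sum>i<b ^ m. h (scramble b \<sigma> (P i))) / b ^ m - (\<integral>x. h x \<partial>lborel)\<bar>
        \<le> V * ((real b * real (m - t) + 1) ^ CARD('d) / b ^ (m - t))"
    using scrambled_net_error[OF c growth h0] by blast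
  have growth_bound: "\<exists>C>0. \<forall>v. \<forall>u\<in>open_cube. \<bar>mixed_deriv v h u\<bar>
      \<le> C * (\<Prod>j\<in>UNIV. edge_dist (u $ j) powr (- B - (if j \<in> v then 1 else 0)))" if "B > 0" for B
    using boundary_growth_mixed_derivD[OF boundary_growth_mono[OF growth subset_refl, of "\<lambda>_. - B"]] that c
    by (simp add: edge_weight_def)
  \<comment> \<open>The error bound holds at every outcome, so squaring and integrating over a
    probability space preserves it; measurability of the estimator supplies the rest of
    integrability.\<close>
  have mse: "integrable M (\<lambda>\<omega>. \<bar>scrambled_net_estimator b m h P \<Sigma> \<omega> - \<mu>\<bar>\<^sup>2)"
    "sqrt (\<integral>\<omega>. \<bar>scrambled_net_estimator b m h P \<Sigma> \<omega> - \<mu>\<bar>\<^sup>2 \<partial>M)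
       \<le> V * ((real b * real (m - t) + 1) ^ CARD('d) / b ^ (m - t))"
    if b: "b \<ge> 2" and net: "tms_net b t m P" and scr: "nested_uniform_scrambling b M \<Sigma>"
      and \<mu>: "\<mu> = (\<integral>x. f x \<partial>density lborel (\<lambda>x. ennreal (\<pi> x)))"
    for b t m P and M :: "'w measure" and \<Sigma> \<mu>
  proof -
    interpret prob_space M using scr by (simp add: nested_uniform_scrambling_def)
    let ?E = "V * ((real b * real (m - t) + 1) ^ CARD('d) / b ^ (m - t))"
    let ?Z = "\<lambda>\<omega>. scrambled_net_estimator b m h P \<Sigma> \<omega> - \<mu>"
    have b0: "b > 0" using b by simp
    note sm [measurable] = scramble_measurable(1)[OF scr b0]
    have Z [measurable]: "?Z \<in> borel_measurable M"
      unfolding scrambled_net_estimator_def by measurable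
    have bound: "\<bar>?Z \<omega>\<bar> \<le> ?E" if "\<omega> \<in> space M" for \<omega>
      using err[OF b net scramble_measurable(2)[OF scr b0 that]]
      by (simp add: scrambled_net_estimator_def \<mu> mu)
    have sq: "\<bar>?Z \<omega>\<bar>\<^sup>2 \<le> ?E\<^sup>2" if "\<omega> \<in> space M" for \<omega>
      using bound[OF that] by (intro power_mono) auto
    show int: "integrable M (\<lambda>\<omega>. \<bar>?Z \<omega>\<bar>\<^sup>2)"
      by (rule integrable_const_bound[where B = "?E\<^sup>2"]) (use sq in auto)
    have "(\<integral>\<omega>. \<bar>?Z \<omega>\<bar>\<^sup>2 \<partial>M) \<le> (\<integral>\<omega>. ?E\<^sup>2 \<partial>M)"
      by (intro integral_mono int) (use sq in auto)
    also have "(\<integral>\<omega>. ?E\<^sup>2 \<partial>M) = ?E\<^sup>2" by (simp add: prob_space)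
    finally have "sqrt (\<integral>\<omega>. \<bar>?Z \<omega>\<bar>\<^sup>2 \<partial>M) \<le> sqrt (?E\<^sup>2)" by (rule real_sqrt_le_mono)
    also have "\<dots> = ?E" using V by simp
    finally show "sqrt (\<integral>\<omega>. \<bar>?Z \<omega>\<bar>\<^sup>2 \<partial>M) \<le> ?E" .
  qed
  have rate: "(\<lambda>n. sqrt (\<integral>\<omega>. \<bar>scrambled_net_estimator b (m n) h (P n) (\<Sigma> n) \<omega> - \<mu>\<bar>\<^sup>2 \<partial>M n))
         \<in> O(\<lambda>n. real (b ^ m n) powr (- 1 + \<epsilon>))"
    if b: "b \<ge> 2" and net: "\<forall>n. tms_net b t (m n) (P n)" and scr: "\<forall>n. nested_uniform_scrambling b (M n) (\<Sigma> n)"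
      and \<mu>: "\<mu> = (\<integral>x. f x \<partial>density lborel (\<lambda>x. ennreal (\<pi> x)))" and \<epsilon>: "\<epsilon> > 0"
    for b t m P and M :: "nat \<Rightarrow> 'w measure" and \<Sigma> \<mu> \<epsilon>
  proof -
    obtain R where R: "R \<ge> 0"
      "\<And>m. m \<ge> t \<Longrightarrow> (real b * real (m - t) + 1) ^ CARD('d) / b ^ (m - t) \<le> R * real (b ^ m) powr (- 1 + \<epsilon>)"
      using discrepancy_rate[OF b \<epsilon>, of "CARD('d)" t] by auto
    have "norm (sqrt (\<integral>\<omega>. \<bar>scrambled_net_estimator b (m n) h (P n) (\<Sigma> n) \<omega> - \<mu>\<bar>\<^sup>2 \<partial>M n))
      \<le> (V * R) * norm (real (b ^ m n) powr (- 1 + \<epsilon>))" for n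
    proof -
      have "t \<le> m n" using net by (simp add: tms_net_def)
      have "norm (sqrt (\<integral>\<omega>. \<bar>scrambled_net_estimator b (m n) h (P n) (\<Sigma> n) \<omega> - \<mu>\<bar>\<^sup>2 \<partial>M n))
        \<le> V * ((real b * real (m n - t) + 1) ^ CARD('d) / b ^ (m n - t))"
        using mse(2)[OF b spec[OF net, of n] spec[OF scr, of n] \<mu>] by (simp add: integral_nonneg)
      also have "\<dots> \<le> V * (R * real (b ^ m n) powr (- 1 + \<epsilon>))"
        by (intro mult_left_mono R \<open>t \<le> m n\<close> V)
      finally show ?thesis by (simp add: mult.assoc)
    qed
    then show ?thesis by (intro bigoI[where c = "V * R"] always_eventually allI)
  qed
  show ?thesis
  proof (intro conjI allI impI)
    show "C_mixed_on open_cube h" by (rule boundary_growth_imp_C_mixed_on[OF growth])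
    show "integrable (M n) (\<lambda>\<omega>. \<bar>scrambled_net_estimator b (m n) h (P n) (\<Sigma> n) \<omega> - \<mu>\<bar>\<^sup>2)"
      if "b \<ge> 2" "\<forall>n. tms_net b t (m n) (P n)" "\<forall>n. nested_uniform_scrambling b (M n) (\<Sigma> n)"
        "\<mu> = (\<integral>x. f x \<partial>density lborel (\<lambda>x. ennreal (\<pi> x)))"
      for b t m P and M :: "nat \<Rightarrow> 'w measure" and \<Sigma> \<mu> n
      by (rule mse(1)[OF that(1) spec[OF that(2)] spec[OF that(3)] that(4)])
  qed (erule growth_bound, rule f_int, rule rate)
qed

end
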